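(* Let $T=\left(-\frac12,-\frac15\right)\cup\left(\frac1{10},\frac25\right)$. Then $\mathcal{B}(23,4;T)=\mathcal{B}(23,5;T)=11178$. Consequently, the code $C_{\sqrt6/6}$ is a tight $T$-avoiding spherical $5$-design.
   Context: A spherical code is a finite set $C\subset\mathbb{S}^{n-1}$; $I(C)=\{x\cdot y: x,y\in C,\ x\ne y\}$. For $T\subset[-1,1)$, $C$ is $T$-avoiding if $I(C)\cap T=\varnothing$. A spherical $\tau$-design is a spherical code $C$ such that the average over $C$ of every polynomial in $n$ variables of total degree at most $\tau$ equals its average over $\mathbb{S}^{n-1}$ with respect to normalized surface measure. $\mathcal{B}(n,\tau;T)$ is the minimum of $|C|$ over all $T$-avoiding spherical $\tau$-designs $C\subset\mathbb{S}^{n-1}$. Let $P_i^{(n)}$ be the Gegenbauer polynomials: orthogonal on $[-1,1]$ with weight $(1-t^2)^{(n-3)/2}$, $\deg P_i^{(n)}=i$, $P_i^{(n)}(1)=1$; write a real polynomial as $f=\sum_i f_iP_i^{(n)}$. Linear programming gives $\mathcal{B}(n,\tau;T)\ge f(1)/f_0$ for every real polynomial $f$ with $f\ge0$ on $[-1,1]\setminus T$, $f_0>0$, and $f_i\le0$ for all $i\ge\tau+1$. A $T$-avoiding spherical $\tau$-design $C\subset\mathbb{S}^{n-1}$ is called tight if $|C|=f(1)/f_0$ for some such $f$. The code $C_{\sqrt6/6}$: let $L\subset\mathbb{S}^{23}$ be the set of the $196560$ minimal vectors (length $2$) of the Leech lattice $\Lambda_{24}$ (the even unimodular lattice in $\mathbb{R}^{24}$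 of minimum norm $4$) rescaled to unit length. Let $W\in\Lambda_{24}$ be a vector of length $\sqrt6$ and $\widetilde w=W/\sqrt6$. With $\alpha=\frac{\sqrt6}6$, $C_{\sqrt6/6}$ is the set of vectors $(y-\alpha\widetilde w)/\sqrt{1-\alpha^2}$ with $y\in L$, $y\cdot\widetilde w=\alpha$, regarded as a subset of the unit sphere $\mathbb{S}^{22}$ of $\widetilde w^\perp\cong\mathbb{R}^{23}$. It is a spherical $5$-design with $11178$ points and inner products $-\frac12,-\frac15,\frac1{10},\frac25$. *)

theory Defs
  imports "HOL-Analysis.Analysis" "HOL-Probability.Probability"
    "HOL-Computational_Algebra.Polynomial" "HOL-Library.Extended_Nat"
begin

section \<open>Spherical codes and designs\<close>

definition spherical_code :: "(real ^ 'n) set \<Rightarrow> bool" where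
  "spherical_code C \<longleftrightarrow> finite C \<and> C \<subseteq> sphere 0 1"

definition inner_products :: "(real ^ 'n) set \<Rightarrow> real set" where
  "inner_products C = {x \<bullet> y | x y. x \<in> C \<and> y \<in> C \<and> x \<noteq> y}"

definition avoiding :: "real set \<Rightarrow> (real ^ 'n) set \<Rightarrow> bool" where
  "avoiding T C \<longleftrightarrow> inner_products C \<inter> T = {}"

text \<open>
  Normalized surface measure on the unit sphere, as the cone measure: a Borel set \<open>A\<close> of unit
  vectors gets the fraction of the volume of the unit ball occupied by \<open>{r a | 0 < r < 1, a \<in> A}\<close>.
  Here \<open>sgn x = x / norm x\<close>; the origin, which is sent to \<open>0\<close>, is a null set.
\<close>
definition sphere_measure :: "(real ^ 'n) measure" where
  "sphere_measure = distr (uniform_measure lborel (ball 0 1)) borel sgn"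

definition polynomial_of_total_degree_le :: "nat \<Rightarrow> (real ^ 'n \<Rightarrow> real) \<Rightarrow> bool" where
  "polynomial_of_total_degree_le d p \<longleftrightarrow>
     (\<exists>c. p = (\<lambda>x. \<Sum>a | (\<Sum>i\<in>UNIV. a i) \<le> d. c a * (\<Prod>i\<in>UNIV. (x $ i) ^ a i)))"

text \<open>The empty code is not a design: its average of the constant \<open>1\<close> is \<open>0 / 0 = 0\<close>.\<close>
definition spherical_design :: "nat \<Rightarrow> (real ^ 'n) set \<Rightarrow> bool" where
  "spherical_design \<tau> C \<longleftrightarrow> spherical_code C \<and>
     (\<forall>p. polynomial_of_total_degree_le \<tau> p \<longrightarrow>
        (\<Sum>x\<in>C. p x) / real (card C) = (\<integral>x. p x \<partial>sphere_measure))"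

text \<open>
  The dimension is \<open>n = CARD('n)\<close>. The infimum in \<^typ>\<open>enat\<close> is attained unless there is no such
  design, in which case it is \<open>\<infinity>\<close>; hence a finite value is a genuine minimum.
\<close>
definition min_design_card :: "'n::finite itself \<Rightarrow> nat \<Rightarrow> real set \<Rightarrow> enat" where
  "min_design_card _ \<tau> T =
     (INF C \<in> {C :: (real ^ 'n) set. spherical_design \<tau> C \<and> avoiding T C}. enat (card C))"


section \<open>Gegenbauer polynomials and tightness\<close>

definition gegenbauer :: "nat \<Rightarrow> nat \<Rightarrow> real poly" where
  "gegenbauer n = (THE P.
     (\<forall>i. degree (P i) = i \<and> poly (P i) 1 = 1) \<and>
     (\<forall>i j. i \<noteq> j \<longrightarrow>
        integral {-1..1}
          (\<lambda>t. poly (P i) t * poly (P j) t * (1 - t\<^sup>2) powr ((real n - 3) / 2)) = 0))"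

text \<open>
  As \<open>gegenbauer n i\<close> has degree \<open>i\<close>, the expansion of \<open>f\<close> exists, stops at \<open>degree f\<close>, and
  determines \<open>c i\<close> for \<open>i \<le> degree f\<close>; the remaining Gegenbauer coefficients of \<open>f\<close> are zero.
\<close>
definition tight_avoiding_design :: "real set \<Rightarrow> nat \<Rightarrow> (real ^ 'n) set \<Rightarrow> bool" where
  "tight_avoiding_design T \<tau> C \<longleftrightarrow> spherical_design \<tau> C \<and> avoiding T C \<and>
     (\<exists>(f :: real poly) (c :: nat \<Rightarrow> real).
        f = (\<Sum>i\<le>degree f. smult (c i) (gegenbauer CARD('n) i)) \<and>
        (\<forall>t \<in> {-1..1} - T. poly f t \<ge> 0) \<and>
        c 0 > 0 \<and>
        (\<forall>i \<in> {\<tau> + 1..degree f}. c i \<le> 0) \<and>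
        real (card C) = poly f 1 / c 0)"


section \<open>The Leech lattice and the derived code\<close>

text \<open>The columns of \<open>A\<close> form a lattice basis.\<close>
definition even_unimodular_lattice :: "(real ^ 'n) set \<Rightarrow> bool" where
  "even_unimodular_lattice \<Lambda> \<longleftrightarrow>
     (\<exists>A :: real ^ 'n ^ 'n. \<bar>det A\<bar> = 1 \<and> \<Lambda> = {A *v z | z. \<forall>i. z $ i \<in> \<int>}) \<and>
     (\<forall>x \<in> \<Lambda>. \<forall>y \<in> \<Lambda>. x \<bullet> y \<in> \<int>) \<and>
     (\<forall>x \<in> \<Lambda>. \<exists>k :: int. x \<bullet> x = 2 * of_int k)"

text \<open>Minimum norm \<open>4\<close> refers to squared lengths.\<close>
definition leech_lattice :: "(real ^ 24) set \<Rightarrow> bool" where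
  "leech_lattice \<Lambda> \<longleftrightarrow> even_unimodular_lattice \<Lambda> \<and>
     (\<forall>x \<in> \<Lambda>. x \<noteq> 0 \<longrightarrow> x \<bullet> x \<ge> 4) \<and> (\<exists>x \<in> \<Lambda>. x \<bullet> x = 4)"

definition normalized_minimal_vectors :: "(real ^ 24) set \<Rightarrow> (real ^ 24) set" where
  "normalized_minimal_vectors \<Lambda> = {x /\<^sub>R 2 | x. x \<in> \<Lambda> \<and> norm x = 2}"

definition derived_code :: "(real ^ 'n) set \<Rightarrow> real ^ 'n \<Rightarrow> real \<Rightarrow> (real ^ 'n) set" where
  "derived_code L w \<alpha> = {(y - \<alpha> *\<^sub>R w) /\<^sub>R sqrt (1 - \<alpha>\<^sup>2) | y. y \<in> L \<and> y \<bullet> w = \<alpha>}"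

definition code_sqrt6_6 :: "(real ^ 24) set \<Rightarrow> real ^ 24 \<Rightarrow> (real ^ 24) set" where
  "code_sqrt6_6 \<Lambda> W = derived_code (normalized_minimal_vectors \<Lambda>) (W /\<^sub>R sqrt 6) (sqrt 6 / 6)"

text \<open>An identification of the Euclidean space \<open>real ^ 'm\<close> with the hyperplane orthogonal to \<open>w\<close>.\<close>
definition isometry_onto_orthogonal :: "(real ^ 'm \<Rightarrow> real ^ 'n) \<Rightarrow> real ^ 'n \<Rightarrow> bool" where
  "isometry_onto_orthogonal \<phi> w \<longleftrightarrow>
     linear \<phi> \<and> (\<forall>x. norm (\<phi> x) = norm x) \<and> range \<phi> = {v. v \<bullet> w = 0}"

end

(*
  Proof idea.  The polynomial f(t) = (t + 1/2)(t + 1/5)(t - 1/10)(t - 2/5) is nonnegative on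
  [-1,1] outside T, has degree 4, and satisfies f(1)/f_0 = 11178, which is the lower bound.
  The derived code has inner products exactly at the zeros of f, so it attains the bound as
  soon as it is a 5-design.

  For the design property one compares, in two directions x and x' of the same length, the
  theta series sum_v exp(pi i tau |v|^2 + 2 pi i z (v.x)) of an even unimodular lattice without
  roots in dimension 24.  By Poisson summation the first nonvanishing Taylor coefficient in z
  of their difference (suitably normalised) transforms like a modular form of weight
  12 + d <= 20; it vanishes to order 2 at the cusp since there are no roots, and the maximum
  principle applied to a suitable power of its size forces it to be zero.  Hence moments of
  the shells up to degree 8 are rotation invariant.  Applied to the minimal shell and a vector W
  of norm 6, the inner products u.W lie in {-3,...,3}, and the moments determine the
  joint moments of the section u.W = 2 up to degree 3; the involution u -> W - u kills odd
  moments, and the fourth moment is forced by the sum of f over all pairs of the code.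
*)
theory Submission
  imports Defs "HOL-Complex_Analysis.Complex_Analysis"
begin

text \<open>The bound 8 on the degree comes from the analysis: comparing y^k with e^(-8 pi y) above
  a height c < sqrt 3 / 2 requires k / c < 8 pi, which weight 20 meets and weight 22 misses.
  Separating the levels 0, 1, 2, 3 of |u.W| uses the powers 0, 2, 4, 6 of u.W. Together with a
  second moment this ends at degree 8; a fourth moment would need degree 10. Hence the detour
  through f: in a direction x of the code f(y.x) vanishes for every other point y, which is a linear
  equation for the fourth moment, and its solution is the spherical value because 11178 = f(1)/f_0.
  Directions in the code suffice, as a design is recognised from power sums over its pairs.

  The minimum has to be attained, so one lattice is exhibited by a basis whose arithmetic is
  evaluated. Tightness concerns every lattice with the defining properties, so cardinalities and
  moments are derived from evenness, self-duality and minimum 4 alone. Poisson summation is reduced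
  to dimension one through a sublattice with orthogonal basis, over which Gaussian sums
  factor.\<close>

section \<open>Fourier expansions on the torus\<close>

lemma cis_int_mult_periodic: "cis (2 * pi * of_int m * (x + of_int k)) = cis (2 * pi * of_int m * x)"
proof -
  have "2 * pi * of_int m * (x + of_int k) = 2 * pi * of_int m * x + 2 * pi * of_int (m * k)"
    by (simp add: algebra_simps)
  moreover have "cis (2 * pi * of_int (m * k)) = 1"
    by (metis cis_multiple_2pi Ints_of_int)
  ultimately show ?thesis by (simp only: cis_mult[symmetric] mult_1_right)
qed

lemma continuous_on_cis_compose [continuous_intros]:
  "continuous_on A f \<Longrightarrow> continuous_on A (\<lambda>x. cis (f x))"
  unfolding cis_conv_exp by (intro continuous_intros)

text \<open>Finite Fourier sums, generated by monomials and addition alone. Closure under products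
  is proved afterwards and carries real polynomials in the point \<open>cis (2 * pi * x)\<close>
  into this class.\<close>

inductive trig_poly :: "(real \<Rightarrow> complex) \<Rightarrow> bool" where
  trig_poly_mono: "trig_poly (\<lambda>x. c * cis (2 * pi * of_int m * x))"
| trig_poly_add: "trig_poly f \<Longrightarrow> trig_poly g \<Longrightarrow> trig_poly (\<lambda>x. f x + g x)"

lemma trig_poly_mult:
  assumes "trig_poly f" "trig_poly g"
  shows "trig_poly (\<lambda>x. f x * g x)"
  using assms
proof (induction rule: trig_poly.induct)
  case (trig_poly_mono c m)
  from this show ?case
  proof (induction rule: trig_poly.induct)
    case (trig_poly_mono d k)
    have "(\<lambda>x. c * cis (2 * pi * of_int m * x) * (d * cis (2 * pi * of_int k * x)))
        = (\<lambda>x. (c * d) * cis (2 * pi * of_int (m + k) * x))"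
      by (rule ext) (simp add: cis_mult algebra_simps)
    then show ?case by (metis trig_poly.trig_poly_mono)
  next
    case (trig_poly_add f g)
    then show ?case by (simp add: distrib_left trig_poly.trig_poly_add)
  qed
next
  case (trig_poly_add f1 f2)
  then show ?case by (simp add: distrib_right trig_poly.trig_poly_add)
qed

lemma trig_poly_const: "trig_poly (\<lambda>x. c)"
  using trig_poly_mono[of c 0] by simp

text \<open>A real linear functional on the plane is determined by its values at 1 and
  \<open>\<i>\<close>, and cosine and sine are combinations of \<open>cis y\<close> and
  \<open>cis (- y)\<close>; sums and products follow by closure.\<close>

lemma trig_poly_of_real_polynomial:
  assumes "real_polynomial_function q"
  shows "trig_poly (\<lambda>x. of_real (q (cis (2 * pi * x))))"
  using assms
proof (induction rule: real_polynomial_function.induct)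
  case (linear f)
  interpret bounded_linear f by fact
  have f: "f z = Re z * f 1 + Im z * f \<i>" for z
  proof -
    have "f z = f (Re z *\<^sub>R 1 + Im z *\<^sub>R \<i>)"
      by (rule arg_cong[of _ _ f]) (simp add: complex_eq_iff)
    then show ?thesis by (simp add: add scale)
  qed
  have c: "complex_of_real (cos y) = (cis y + cis (- y)) / 2" for y
    by (simp add: complex_eq_iff)
  have s': "cis y - cis (- y) = 2 * \<i> * complex_of_real (sin y)" for y
    by (simp add: complex_eq_iff)
  have s: "complex_of_real (sin y) = (cis y - cis (- y)) / (2 * \<i>)" for y
    unfolding s' by simp
  have eq: "(\<lambda>x. complex_of_real (f (cis (2 * pi * x)))) =
      (\<lambda>x. (of_real (f 1) / 2 + of_real (f \<i>) / (2 * \<i>)) * cis (2 * pi * of_int 1 * x)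
         + (of_real (f 1) / 2 - of_real (f \<i>) / (2 * \<i>)) * cis (2 * pi * of_int (-1) * x))"
    by (rule ext, subst f) (simp add: c s field_simps)
  show ?case unfolding eq by (intro trig_poly_mono trig_poly_add)
qed (auto intro: trig_poly_const trig_poly_add trig_poly_mult)

text \<open>The conjugate is there because the approximant will be multiplied by \<open>h\<close> in
  order to imitate \<open>h x * cnj (h x)\<close>.\<close>

lemma trig_poly_of_polynomial_function:
  assumes "polynomial_function (g :: complex \<Rightarrow> complex)"
  shows "trig_poly (\<lambda>x. cnj (g (cis (2 * pi * x))))"
proof -
  have "real_polynomial_function (Re \<circ> g)" "real_polynomial_function (Im \<circ> g)"
    using assms bounded_linear_Re bounded_linear_Im unfolding polynomial_function_def by blast+
  from this[THEN trig_poly_of_real_polynomial]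
  have *: "trig_poly (\<lambda>x. of_real (Re (g (cis (2 * pi * x)))))"
     "trig_poly (\<lambda>x. of_real (Im (g (cis (2 * pi * x)))))" by simp_all
  have "(\<lambda>x. cnj (g (cis (2 * pi * x)))) = 
     (\<lambda>x. of_real (Re (g (cis (2 * pi * x)))) + (-\<i>) * of_real (Im (g (cis (2 * pi * x)))))"
    by (rule ext) (simp add: complex_eq_iff)
  then show ?thesis
    using trig_poly_add[OF *(1) trig_poly_mult[OF trig_poly_const[of "-\<i>"] *(2)]] by simp
qed

lemma periodic_of_int:
  assumes "\<And>x::real. h (x + 1) = h x"
  shows "h (x + of_int m) = h x"
proof -
  have n: "h (x + of_nat n) = h x" for n x
    by (induction n) (use assms in \<open>auto simp: add.assoc[symmetric] add.commute[of 1] \<close>)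
  show ?thesis
  proof (cases "m \<ge> 0")
    case True
    then show ?thesis using n[of x "nat m"] by simp
  next
    case False
    then show ?thesis using n[of "x + of_int m" "nat (-m)"] by simp
  qed
qed

lemma cis_eq_imp:
  assumes "cis a = cis b"
  shows "\<exists>n::int. a = b + 2 * of_int n * pi"
proof -
  have "sin a = sin b \<and> cos a = cos b" using assms by (simp add: complex_eq_iff)
  then obtain n :: int where "a = b + 2 * pi * n" unfolding sin_cos_eq_iff by blast
  then show ?thesis by (intro exI[of _ n]) simp
qed

lemma cis_Arg_cis: "cis (Arg (cis t)) = cis t"
  by (subst cis_Arg) (auto simp: sgn_eq)

text \<open>\<open>Arg\<close> jumps on the negative real axis, so continuity of the descended
  function rests on two formulas: one through \<open>Arg z\<close> off that axis, and one through
  \<open>Arg (- z)\<close> with a shift by half a period, valid across it.\<close>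

lemma periodic_on_circle:
  fixes h :: "real \<Rightarrow> complex"
  assumes h: "continuous_on UNIV h" "\<And>x. h (x + 1) = h x"
  obtains f where "continuous_on (sphere 0 1) f" "\<And>x. f (cis (2 * pi * x)) = h x"
proof -
  have eq: "h (Arg z / (2 * pi)) = h x" if "z = cis (2 * pi * x)" for x z
  proof -
    have "cis (Arg z) = cis (2 * pi * x)" unfolding that by (rule cis_Arg_cis)
    then obtain n where n: "Arg z = 2 * pi * x + 2 * of_int n * pi"
      using cis_eq_imp by blast
    then have "Arg z / (2 * pi) = x + of_int n" by (simp add: field_simps)
    then show ?thesis using periodic_of_int[of h x n] h by simp
  qed
  define f where "f = (\<lambda>z. h (Arg z / (2 * pi)))"
  have f1: "f (cis (2 * pi * x)) = h x" for x unfolding f_def by (rule eq) simp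
  have onc: "\<exists>x. z = cis (2 * pi * x)" if "z \<in> sphere 0 1" for z
  proof -
    have "cis (Arg z) = z" using that by (subst cis_Arg) (auto simp: sgn_eq)
    then have "z = cis (2 * pi * (Arg z / (2 * pi)))" by simp
    then show ?thesis by blast
  qed
  have f2: "f z = h (Arg (- z) / (2 * pi) + 1 / 2)" if zs: "z \<in> sphere 0 1" for z
  proof -
    obtain x where x: "z = cis (2 * pi * x)" using onc[OF zs] by (rule exE)
    have "cis (2 * pi * (x - 1 / 2)) = cis (2 * pi * x) * cis (- pi)"
      unfolding cis_mult by (simp add: algebra_simps)
    moreover have "cis (- pi) = -1" by (simp add: complex_eq_iff)
    ultimately have mz: "- z = cis (2 * pi * (x - 1 / 2))"
      unfolding x[symmetric] by simp
    have "cis (Arg (- z)) = cis (2 * pi * (x - 1 / 2))" unfolding mz by (rule cis_Arg_cis)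
    then obtain n where n: "Arg (- z) = 2 * pi * (x - 1 / 2) + 2 * of_int n * pi"
      using cis_eq_imp by blast
    have "Arg (- z) / (2 * pi) + 1 / 2 = x + of_int n" unfolding n by (simp add: field_simps)
    then have "h (Arg (- z) / (2 * pi) + 1 / 2) = h x" using periodic_of_int[of h x n] h by simp
    moreover have "f z = h x" unfolding x by (rule f1)
    ultimately show ?thesis by simp
  qed
  have "continuous (at z within sphere 0 1) f" if z: "z \<in> sphere 0 1" for z
  proof (cases "z \<in> \<real>\<^sub>\<le>\<^sub>0")
    case False
    have "isCont h (Arg z / (2 * pi))"
      using h(1) by (simp add: continuous_on_eq_continuous_at)
    moreover have "isCont (\<lambda>z. Arg z / (2 * pi)) z"
      using continuous_at_Arg[OF False] by (intro continuous_intros) auto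
    ultimately have "isCont f z" unfolding f_def
      using isCont_o2[of z "\<lambda>z. Arg z / (2 * pi)" h] by simp
    then show ?thesis by (rule continuous_at_imp_continuous_within)
  next
    case True
    then have "- z \<notin> \<real>\<^sub>\<le>\<^sub>0" using z
      by (metis complex_nonpos_Reals_iff add.inverse_inverse complex_eq_0 dist_0_norm dual_order.antisym mem_sphere neg_0_le_iff_le norm_zero power_zero_numeral uminus_complex.sel(1) zero_complex.sel(1) zero_neq_one complex.expand zero_complex.sel(2))
    then have "isCont Arg (- z)" by (rule continuous_at_Arg)
    then have "isCont (\<lambda>z. Arg (- z)) z" using isCont_o2[of z uminus Arg] by simp
    then have "isCont (\<lambda>z. Arg (- z) / (2 * pi) + 1 / 2) z"
      by (intro continuous_intros) auto
    moreover have "isCont h (Arg (- z) / (2 * pi) + 1 / 2)"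
      using h(1) by (simp add: continuous_on_eq_continuous_at)
    ultimately have "isCont (\<lambda>z. h (Arg (- z) / (2 * pi) + 1 / 2)) z"
      using isCont_o2[of z "\<lambda>z. Arg (- z) / (2 * pi) + 1 / 2" h] by simp
    then have "continuous (at z within sphere 0 1) (\<lambda>z. h (Arg (- z) / (2 * pi) + 1 / 2))"
      by (rule continuous_at_imp_continuous_within)
    then show ?thesis
      by (rule continuous_transform_within[OF _ zero_less_one z]) (simp add: f2)
  qed
  then have "continuous_on (sphere 0 1) f" by (simp add: continuous_on_eq_continuous_within)
  with f1 that show ?thesis by blast
qed

text \<open>Stone-Weierstrass on the circle: every trigonometric polynomial integrates to 0 against
  \<open>h\<close>, yet some of them approximate \<open>cnj h\<close> uniformly, so the mean square
  of \<open>h\<close> is arbitrarily small.\<close>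

lemma fourier_coefficients_zero:
  fixes h :: "real \<Rightarrow> complex"
  assumes h: "continuous_on UNIV h" "\<And>x. h (x + 1) = h x"
    and int: "\<And>m::int. integral {0..1} (\<lambda>x. h x * cis (2 * pi * of_int m * x)) = 0"
  shows "h x = 0"
proof -
  have hc: "continuous_on A h" for A using h(1) continuous_on_subset by blast
  have cq: "continuous_on A q" if "trig_poly q" for q A
    using that by induction (auto intro!: continuous_intros)
  have 0: "integral {0..1} (\<lambda>x. h x * q x) = 0" if "trig_poly q" for q
    using that
  proof induction
    case (trig_poly_mono c m)
    have "(\<lambda>x. h x * (c * cis (2 * pi * of_int m * x))) = (\<lambda>x. c * (h x * cis (2 * pi * of_int m * x)))"
      by (simp add: fun_eq_iff)
    then show ?case using int[of m] by simp
  next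
    case (trig_poly_add f g)
    have "(\<lambda>x. h x * f x) integrable_on {0..1}" "(\<lambda>x. h x * g x) integrable_on {0..1}"
      by (intro integrable_continuous_real continuous_intros hc cq trig_poly_add)+
    with trig_poly_add show ?case by (simp add: distrib_left integral_add)
  qed
  obtain f where f: "continuous_on (sphere 0 1) f" "\<And>x. f (cis (2 * pi * x)) = h x"
    using periodic_on_circle[OF h] by blast
  have "compact (h ` {0..1})" using hc by (intro compact_continuous_image) auto
  then have "bounded (h ` {0..1})" by (rule compact_imp_bounded)
  then obtain B where B: "B > 0" "\<And>x. x \<in> {0..1} \<Longrightarrow> norm (h x) \<le> B"
    unfolding bounded_pos by (auto simp only: ball_simps)
  define J where "J = integral {0..1} (\<lambda>x. (norm (h x))\<^sup>2)"
  have Jc: "of_real J = integral {0..1} (\<lambda>x. h x * cnj (h x))"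
  proof -
    have "((\<lambda>x. (norm (h x))\<^sup>2) has_integral J) {0..1}"
      unfolding J_def by (intro integrable_integral integrable_continuous_real continuous_intros hc)
    from has_integral_linear[OF this bounded_linear_of_real]
    have "integral {0..1} (\<lambda>x. complex_of_real ((norm (h x))\<^sup>2)) = of_real J"
      unfolding o_def by (rule integral_unique)
    also have "(\<lambda>x. complex_of_real ((norm (h x))\<^sup>2)) = (\<lambda>x. h x * cnj (h x))"
      by (rule ext) (rule complex_norm_square)
    finally show ?thesis by (rule sym)
  qed
  have le: "J \<le> B * e" if e: "e > 0" for e
  proof -
    obtain g where g: "polynomial_function g" "\<And>z. z \<in> sphere 0 1 \<Longrightarrow> norm (f z - g z) < e"
      using Stone_Weierstrass_polynomial_function[OF compact_sphere f(1) e] by blast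
    define q where "q = (\<lambda>x. cnj (g (cis (2 * pi * x))))"
    have q: "trig_poly q" unfolding q_def by (rule trig_poly_of_polynomial_function[OF g(1)])
    have i: "(\<lambda>x. h x * cnj (h x)) integrable_on {0..1}" "(\<lambda>x. h x * q x) integrable_on {0..1}"
      by (intro integrable_continuous_real continuous_intros hc cq q)+
    have "of_real J = integral {0..1} (\<lambda>x. h x * cnj (h x) - h x * q x)"
      using i 0[OF q] by (simp add: Jc integral_diff)
    also have "norm \<dots> \<le> integral {0..1} (\<lambda>x::real. B * e)"
    proof (rule integral_norm_bound_integral)
      show "norm (h x * cnj (h x) - h x * q x) \<le> B * e" if "x \<in> {0..1}" for x
      proof -
        have "norm (h x * cnj (h x) - h x * q x) = norm (h x) * norm (cnj (h x) - q x)"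
          by (simp add: norm_mult[symmetric] algebra_simps)
        also have "cnj (h x) - q x = cnj (f (cis (2 * pi * x)) - g (cis (2 * pi * x)))"
          by (simp add: q_def f)
        also have "norm \<dots> = norm (f (cis (2 * pi * x)) - g (cis (2 * pi * x)))"
          by (rule complex_mod_cnj)
        also have "norm (h x) * \<dots> \<le> B * e"
          using g(2)[of "cis (2 * pi * x)"] B(2)[OF that] B(1) by (intro mult_mono) auto
        finally show ?thesis .
      qed
    qed (use i in \<open>auto intro: integrable_diff\<close>)
    finally show ?thesis by simp
  qed
  have "J \<le> 0"
  proof (rule field_le_epsilon)
    fix e :: real assume "e > 0"
    then show "J \<le> 0 + e" using le[of "e / B"] B(1) by simp
  qed
  moreover have "J \<ge> 0" unfolding J_def by (rule integral_nonneg) (auto intro!: integrable_continuous_real continuous_intros hc)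
  ultimately have "J = 0" by simp
  then have z: "h x = 0" if "x \<in> {0..1}" for x
  proof -
    have c: "continuous_on {0..1} (\<lambda>x. (norm (h x))\<^sup>2)" by (intro continuous_intros hc)
    have "integral {0..1} (\<lambda>x. (norm (h x))\<^sup>2) = 0" using \<open>J = 0\<close> unfolding J_def .
    then have "\<forall>x\<in>{0..1}. (norm (h x))\<^sup>2 = 0"
      by (subst (asm) integral_eq_0_iff[OF c]) auto
    then have "(norm (h x))\<^sup>2 = 0" using that by (rule bspec)
    then show ?thesis by simp
  qed
  have "h (frac x + of_int \<lfloor>x\<rfloor>) = h (frac x)" by (rule periodic_of_int[of h, OF h(2)])
  moreover have "frac x + of_int \<lfloor>x\<rfloor> = x" by (simp add: frac_def)
  moreover have "h (frac x) = 0"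
    by (rule z) (use frac_lt_1[of x] frac_ge_0[of x] in \<open>simp add: less_imp_le\<close>)
  ultimately show ?thesis by simp
qed

section \<open>Poisson summation and theta inversion\<close>

lemma summable_on_inverse_square_int: "(\<lambda>m::int. 1 / (1 + (of_int m)\<^sup>2 :: real)) summable_on UNIV"
proof -
  have s: "summable (\<lambda>n. 1 / (1 + (real n)\<^sup>2))"
  proof (rule summable_comparison_test'[of "\<lambda>n. 1 / (real n)\<^sup>2" 1])
    show "summable (\<lambda>n. 1 / (real n)\<^sup>2)"
      using inverse_power_summable[of 2, where ?'a = real] by (simp add: inverse_eq_divide)
    fix n :: nat assume "1 \<le> n"
    then show "norm (1 / (1 + (real n)\<^sup>2)) \<le> 1 / (real n)\<^sup>2"
      by (subst real_norm_def, subst abs_of_nonneg) (auto intro!: frac_le)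
  qed
  let ?f = "\<lambda>m::int. 1 / (1 + (of_int m)\<^sup>2 :: real)"
  have 1: "?f summable_on range int"
    by (subst summable_on_reindex)
       (use s in \<open>auto simp: o_def intro!: norm_summable_imp_summable_on\<close>)
  have 2: "?f summable_on range (\<lambda>n. - int n)"
    by (subst summable_on_reindex)
       (use s in \<open>auto simp: o_def inj_on_def intro!: norm_summable_imp_summable_on\<close>)
  have "range int \<union> range (\<lambda>n. - int n) = UNIV"
  proof -
    have "m \<in> range int \<union> range (\<lambda>n. - int n)" for m
      by (cases m rule: int_cases2) auto
    then show ?thesis by blast
  qed
  with summable_on_union[OF 1 2] show ?thesis by simp
qed

lemma infsum_diff:
  fixes f g :: "'a \<Rightarrow> complex"
  assumes "f summable_on A" "g summable_on A"
  shows "(\<Sum>\<^sub>\<infinity>x\<in>A. f x - g x) = infsum f A - infsum g A"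
proof -
  have "((\<lambda>x. - g x) has_sum - infsum g A) A"
    by (subst has_sum_uminus) (simp add: has_sum_infsum assms)
  from has_sum_add[OF has_sum_infsum[OF assms(1)] this] show ?thesis by (simp add: infsumI)
qed

text \<open>The windows are half open so that the unit intervals starting at their members tile
  \<open>{- real N..real N}\<close> exactly, as \<open>integral_sum_shifts\<close> requires.\<close>

lemma filterlim_symmetric_int_interval:
  "filterlim (\<lambda>N. {- int N..<int N}) (finite_subsets_at_top UNIV) sequentially"
  unfolding filterlim_finite_subsets_at_top
proof (intro allI impI)
  fix X :: "int set" assume X: "finite X \<and> X \<subseteq> UNIV"
  define B where "B = Max (insert 0 (abs ` X))"
  have B: "\<bar>x\<bar> \<le> B" if "x \<in> X" for x
    unfolding B_def using X that by (intro Max_ge) auto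
  show "\<forall>\<^sub>F N in sequentially. finite {- int N..<int N} \<and> X \<subseteq> {- int N..<int N} \<and> {- int N..<int N} \<subseteq> UNIV"
    using eventually_ge_at_top[of "nat (B + 1)"]
  proof eventually_elim
    case (elim N)
    have "x \<in> {- int N..<int N}" if "x \<in> X" for x
      using B[OF that] elim by auto
    then show ?case by blast
  qed
qed

lemma uniform_limit_symmetric_sum:
  fixes f :: "int \<Rightarrow> 'a \<Rightarrow> complex"
  assumes "\<And>m x. x \<in> Y \<Longrightarrow> norm (f m x) \<le> K / (1 + (of_int m)\<^sup>2)"
  shows "uniform_limit Y (\<lambda>N x. \<Sum>m\<in>{- int N..<int N}. f m x) (\<lambda>x. \<Sum>\<^sub>\<infinity>m. f m x) sequentially"
proof -
  have "uniform_limit Y (\<lambda>X x. \<Sum>m\<in>X. f m x) (\<lambda>x. \<Sum>\<^sub>\<infinity>m. f m x) (finite_subsets_at_top UNIV)"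
  proof (rule Weierstrass_m_test_general)
    show "(\<lambda>m::int. K / (1 + (of_int m)\<^sup>2)) summable_on UNIV"
      using summable_on_cmult_right[OF summable_on_inverse_square_int, of K] by simp
  qed (use assms in auto)
  then show ?thesis
    by (rule filterlim_compose[OF _ filterlim_symmetric_int_interval])
qed

lemma summable_on_int_square_bound:
  fixes f :: "int \<Rightarrow> complex"
  assumes "\<And>m. norm (f m) \<le> K / (1 + (of_int m)\<^sup>2)"
  shows "(\<lambda>m. norm (f m)) summable_on UNIV"
proof (rule Infinite_Sum.abs_summable_on_comparison_test')
  show "(\<lambda>m::int. K / (1 + (of_int m)\<^sup>2)) summable_on UNIV"
    using summable_on_cmult_right[OF summable_on_inverse_square_int, of K] by simp
qed (use assms in auto)

lemma integral_sum_shifts: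
  fixes G :: "real \<Rightarrow> complex"
  assumes G: "continuous_on UNIV G"
  shows "integral {0..1} (\<lambda>w. \<Sum>m\<in>{- int N..<int N}. G (w + of_int m)) = integral {- real N..real N} G"
proof -
  have Gc: "continuous_on A G" for A using G continuous_on_subset by blast
  have cs: "continuous_on A (\<lambda>w. G (w + c))" for A and c :: real
    by (rule continuous_on_compose2[OF G]) (auto intro!: continuous_intros)
  have sh: "integral {0..1} (\<lambda>w. G (w + c)) = integral {c..c+1} G" for c
    using integral_shift[of 0 c 1 G, OF Gc] by (simp add: o_def add.commute)
  have "integral {0..1} (\<lambda>w. \<Sum>m\<in>{- int N..<int N}. G (w + of_int m))
      = (\<Sum>m\<in>{- int N..<int N}. integral {of_int m..of_int m + 1} G)"
    by (subst integral_sum) (auto intro!: integrable_continuous_real cs simp: sh)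
  also have "\<dots> = integral {- real N..real N} G"
  proof (induction N)
    case (Suc N)
    have i: "G integrable_on {a..b}" for a b by (intro integrable_continuous_real Gc)
    have "{- int (Suc N)..<int (Suc N)} = insert (- int (Suc N)) (insert (int N) {- int N..<int N})"
      by auto
    then have "(\<Sum>m\<in>{- int (Suc N)..<int (Suc N)}. integral {of_int m..of_int m + 1} G) =
       integral {- real (Suc N)..- real N} G + (integral {real N..real (Suc N)} G + integral {- real N..real N} G)"
      using Suc by (simp add: add.commute)
    also have "\<dots> = integral {- real (Suc N)..- real N} G + integral {- real N..real (Suc N)} G"
      using Henstock_Kurzweil_Integration.integral_combine[of "- real N" "real N" "real (Suc N)" G] i
      by (simp add: add.commute)
    also have "\<dots> = integral {- real (Suc N)..real (Suc N)} G"
      using Henstock_Kurzweil_Integration.integral_combine[of "- real (Suc N)" "- real N" "real (Suc N)" G] i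
      by simp
    finally show ?case .
  qed simp
  finally show ?thesis .
qed

lemma integral_symmetric_tendsto:
  fixes G :: "real \<Rightarrow> complex"
  assumes G: "integrable lborel G"
  shows "(\<lambda>N. integral {- real N..real N} G) \<longlonglongrightarrow> (\<integral>w. G w \<partial>lborel)"
proof -
  have "(\<lambda>N. \<integral>w. indicator {- real N..real N} w *\<^sub>R G w \<partial>lborel) \<longlonglongrightarrow> (\<integral>w. G w \<partial>lborel)"
  proof (rule integral_dominated_convergence[where w = "\<lambda>w. norm (G w)"])
    show "AE w in lborel. (\<lambda>N. indicator {- real N..real N} w *\<^sub>R G w) \<longlonglongrightarrow> G w"
    proof (rule AE_I2, rule tendsto_eventually)
      fix w :: real
      show "\<forall>\<^sub>F N in sequentially. indicator {- real N..real N} w *\<^sub>R G w = G w"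
        using eventually_ge_at_top[of "nat \<lceil>\<bar>w\<bar>\<rceil>"]
      proof eventually_elim
        case (elim N)
        then have "\<bar>w\<bar> \<le> real N" by linarith
        then show ?case by (auto simp: indicator_def abs_le_iff)
      qed
    qed
  qed (use G in \<open>auto simp: indicator_def borel_measurable_integrable\<close>)
  moreover have "(\<integral>w. indicator {- real N..real N} w *\<^sub>R G w \<partial>lborel) = integral {- real N..real N} G" for N
  proof -
    have "set_integrable lborel {- real N..real N} G"
      unfolding set_integrable_def
      by (rule integrable_mult_indicator) (use G in auto)
    from set_borel_integral_eq_integral(2)[OF this] show ?thesis
      by (simp add: set_lebesgue_integral_def)
  qed
  ultimately show ?thesis by simp
qed

lemma has_integral_cis_period:
  "((\<lambda>w. cis (2 * pi * of_int k * w)) has_integral (if k = 0 then 1 else 0)) {0..1}"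
proof (cases "k = 0")
  case True
  then show ?thesis using has_integral_const_real[of "1::complex" 0 1] by simp
next
  case False
  let ?F = "\<lambda>w. cis (2 * pi * of_int k * w) / (2 * pi * of_int k * \<i>)"
  have "((\<lambda>w. cis (2 * pi * of_int k * w)) has_integral ?F 1 - ?F 0) {0..1}"
  proof (rule fundamental_theorem_of_calculus)
    fix x :: real
    have "((\<lambda>z. exp (2 * of_real pi * of_int k * \<i> * z) / (2 * of_real pi * of_int k * \<i>)) has_field_derivative
       exp (2 * of_real pi * of_int k * \<i> * of_real x)) (at (of_real x))"
      using False by (auto intro!: derivative_eq_intros)
    from has_vector_derivative_real_field[OF this]
    show "(?F has_vector_derivative cis (2 * pi * of_int k * x)) (at x within {0..1})"
      by (simp add: cis_conv_exp mult_ac)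
  qed simp
  moreover have "cis (2 * pi * of_int k * 1) = 1" using cis_int_mult_periodic[of k 0 1] by simp
  ultimately show ?thesis using False by simp
qed

text \<open>Both sides are continuous and 1-periodic in \<open>w\<close>, so it suffices that their
  difference has vanishing Fourier coefficients. A coefficient of the left side unfolds to an
  integral over the line, which \<open>hat\<close> evaluates. Integrating against
  \<open>cis (2 * pi * of_int j * w)\<close> selects the frequency \<open>- j\<close>, whence the
  sign in that hypothesis.\<close>

theorem poisson_summation:
  fixes g :: "real \<Rightarrow> complex" and gh :: "int \<Rightarrow> complex"
  assumes cont: "continuous_on UNIV g" and int: "integrable lborel g"
    and decay: "\<And>w. norm (g w) \<le> C / (1 + w\<^sup>2)"
    and hat: "\<And>j. (\<integral>w. g w * cis (2 * pi * of_int j * w) \<partial>lborel) = gh (- j)"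
    and hat_decay: "\<And>j. norm (gh j) \<le> D / (1 + (of_int j)\<^sup>2)"
  shows "(\<Sum>\<^sub>\<infinity>m. g (w + of_int m)) = (\<Sum>\<^sub>\<infinity>m. gh m * cis (2 * pi * of_int m * w))"
    and "(\<lambda>m. norm (g (w + of_int m))) summable_on UNIV"
    and "(\<lambda>m. norm (gh m * cis (2 * pi * of_int m * w))) summable_on UNIV"
proof -
  have C: "C \<ge> 0" and D: "D \<ge> 0"
    using order_trans[OF norm_ge_zero decay[of 0]] order_trans[OF norm_ge_zero hat_decay[of 0]] by auto
  \<comment> \<open>For bounded \<open>w\<close> the translates decay in \<open>m\<close> uniformly,
    since 1 + m^2 is at most (2 + 2 R^2) (1 + (w + m)^2).\<close>
  have dec: "norm (g (w + of_int m)) \<le> C * (2 + 2 * R\<^sup>2) / (1 + (of_int m)\<^sup>2)"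
    if "w \<in> {-R..R}" for w R :: real and m :: int
  proof -
    have w: "w\<^sup>2 \<le> R\<^sup>2" using that by (simp add: abs_le_square_iff[symmetric] abs_le_iff)
    have sq: "(of_int m :: real)\<^sup>2 \<le> 2 * (w + of_int m)\<^sup>2 + 2 * w\<^sup>2"
    proof -
      have "0 \<le> (w + (w + of_int m))\<^sup>2" by simp
      then show ?thesis by (simp add: power2_eq_square algebra_simps)
    qed
    have nn: "0 \<le> R\<^sup>2 * (w + of_int m)\<^sup>2" by simp
    have "1 + (of_int m :: real)\<^sup>2 \<le> (2 + 2 * R\<^sup>2) * (1 + (w + of_int m)\<^sup>2)"
      using sq w nn by (simp only: distrib_left distrib_right)
    then have "1 / (1 + (w + of_int m)\<^sup>2) \<le> (2 + 2 * R\<^sup>2) / (1 + (of_int m)\<^sup>2)"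
      by (simp add: divide_simps mult.commute add_pos_nonneg)
    from mult_left_mono[OF this C] decay[of "w + of_int m"] show ?thesis by simp
  qed
  have gs: "(\<lambda>m. norm (g (w + of_int m))) summable_on UNIV" for w
    by (rule summable_on_int_square_bound[OF dec[of w "\<bar>w\<bar>"]]) auto
  have hs: "(\<lambda>m. norm (gh m * cis (2 * pi * of_int m * w))) summable_on UNIV" for w
    by (rule summable_on_int_square_bound[of _ D]) (simp add: norm_mult hat_decay)
  show "(\<lambda>m. norm (g (w + of_int m))) summable_on UNIV" 
    "(\<lambda>m. norm (gh m * cis (2 * pi * of_int m * w))) summable_on UNIV" by fact+
  note gs' = abs_summable_summable[OF gs] and hs' = abs_summable_summable[OF hs]
  define f where "f = (\<lambda>j m w. (g (w + of_int m) - gh m * cis (2 * pi * of_int m * w)) * cis (2 * pi * of_int j * w))"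
  define h where "h = (\<lambda>w. \<Sum>\<^sub>\<infinity>m. g (w + of_int m) - gh m * cis (2 * pi * of_int m * w))"
  have gc: "continuous_on A (\<lambda>w. g (w + c))" for A and c :: real
    by (rule continuous_on_compose2[OF cont]) (auto intro!: continuous_intros)
  have fc: "continuous_on A (\<lambda>w. f j m w)" for A j m
    unfolding f_def by (intro continuous_intros gc)
  have ul: "uniform_limit {-R..R} (\<lambda>N x. \<Sum>m\<in>{- int N..<int N}. f j m x) (\<lambda>x. \<Sum>\<^sub>\<infinity>m. f j m x) sequentially" for j R
  proof (rule uniform_limit_symmetric_sum)
    fix m :: int and x assume x: "x \<in> {-R..R}"
    have "norm (f j m x) \<le> norm (g (x + of_int m)) + norm (gh m)"
      unfolding f_def using norm_triangle_ineq4[of "g (x + of_int m)" "gh m * cis (2 * pi * of_int m * x)"]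
      by (simp add: norm_mult)
    also have "\<dots> \<le> C * (2 + 2 * R\<^sup>2) / (1 + (of_int m)\<^sup>2) + D / (1 + (of_int m)\<^sup>2)"
      by (intro add_mono dec x hat_decay)
    finally show "norm (f j m x) \<le> (C * (2 + 2 * R\<^sup>2) + D) / (1 + (of_int m)\<^sup>2)"
      by (simp add: add_divide_distrib)
  qed
  have fh: "(\<Sum>\<^sub>\<infinity>m. f j m x) = h x * cis (2 * pi * of_int j * x)" for j x
    unfolding f_def h_def by (rule infsum_cmult_left') 
  have hR: "continuous_on {-R..R} h" for R
  proof -
    have "continuous_on {-R..R} (\<lambda>x. \<Sum>\<^sub>\<infinity>m. f 0 m x)"
      by (rule uniform_limit_theorem[OF _ ul]) (auto intro!: always_eventually continuous_on_sum fc)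
    then show ?thesis by (simp add: fh)
  qed
  have hcont: "continuous_on UNIV h"
  proof -
    have "isCont h x" for x
    proof -
      have "x \<in> interior {-(\<bar>x\<bar>+1)..\<bar>x\<bar>+1}" by auto
      then show ?thesis by (rule continuous_on_interior[OF hR[of "\<bar>x\<bar>+1"]])
    qed
    then show ?thesis by (simp add: continuous_on_eq_continuous_at)
  qed
  have hper: "h (x + 1) = h x" for x
  proof -
    have a: "g (x + 1 + of_int m) = g (x + of_int (m + 1))" for m by (simp add: algebra_simps)
    have b: "cis (2 * pi * of_int m * (x + 1)) = cis (2 * pi * of_int m * x)" for m
      using cis_int_mult_periodic[of m x 1] by simp
    have "h (x + 1) = (\<Sum>\<^sub>\<infinity>m. g (x + 1 + of_int m)) - (\<Sum>\<^sub>\<infinity>m. gh m * cis (2 * pi * of_int m * (x + 1)))"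
      unfolding h_def by (rule infsum_diff[OF gs' hs'])
    also have "(\<Sum>\<^sub>\<infinity>m. g (x + 1 + of_int m)) = (\<Sum>\<^sub>\<infinity>m. g (x + of_int m))"
      unfolding a by (rule infsum_reindex_bij_witness[of UNIV "\<lambda>m. m - 1" "\<lambda>m. m + 1"]) auto
    also have "\<dots> - (\<Sum>\<^sub>\<infinity>m. gh m * cis (2 * pi * of_int m * (x + 1))) = h x"
      unfolding h_def b by (rule infsum_diff[symmetric, OF gs' hs'])
    finally show ?thesis .
  qed
  have coeff: "integral {0..1} (\<lambda>x. h x * cis (2 * pi * of_int j * x)) = 0" for j
  proof -
    have u: "uniform_limit {0..1} (\<lambda>N x. \<Sum>m\<in>{- int N..<int N}. f j m x) (\<lambda>x. h x * cis (2 * pi * of_int j * x)) sequentially"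
      using uniform_limit_on_subset[OF ul[where R = 1 and j = j], of "{0..1}"] by (simp add: fh)
    have cs: "continuous_on {0..1} (\<lambda>x. \<Sum>m\<in>{- int N..<int N}. f j m x)" for N
      by (intro continuous_on_sum fc)
    obtain I J where IJ: "\<And>N. ((\<lambda>x. \<Sum>m\<in>{- int N..<int N}. f j m x) has_integral I N) {0..1}"
      "((\<lambda>x. h x * cis (2 * pi * of_int j * x)) has_integral J) {0..1}" "I \<longlonglongrightarrow> J"
    proof (rule uniform_limit_integral[OF u cs sequentially_bot])
      fix I J
      assume "\<And>N. ((\<lambda>x. \<Sum>m\<in>{- int N..<int N}. f j m x) has_integral I N) {0..1}"
        "((\<lambda>x. h x * cis (2 * pi * of_int j * x)) has_integral J) {0..1}" "I \<longlonglongrightarrow> J"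
      then show thesis by (rule that)
    qed
    define G where "G = (\<lambda>w. g w * cis (2 * pi * of_int j * w))"
    have Gi: "integrable lborel G"
    proof (rule Bochner_Integration.integrable_bound[OF int])
      have "continuous_on UNIV G" unfolding G_def by (intro continuous_intros cont)
      then show "G \<in> borel_measurable lborel" by (simp add: borel_measurable_continuous_onI)
    qed (simp add: G_def norm_mult)
    have Gc: "continuous_on UNIV G" unfolding G_def by (intro continuous_intros cont)
    \<comment> \<open>The window has to contain the frequency \<open>- j\<close> already; every
      other exponential integrates to 0 over a period.\<close>
    have I: "I N = integral {- real N..real N} G - gh (- j)" if "N > nat \<bar>j\<bar>" for N
    proof -
      have fG: "f j m w = G (w + of_int m) - gh m * cis (2 * pi * of_int (m + j) * w)" for m w
        unfolding f_def G_def cis_int_mult_periodic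
        by (simp add: algebra_simps cis_mult[symmetric] flip: cis_mult)
      have Gs: "continuous_on A (\<lambda>w. G (w + c))" for A and c :: real
        by (rule continuous_on_compose2[OF Gc]) (auto intro!: continuous_intros)
      have 1: "((\<lambda>w. \<Sum>m\<in>{- int N..<int N}. G (w + of_int m)) has_integral integral {- real N..real N} G) {0..1}"
        unfolding integral_sum_shifts[OF Gc, symmetric]
        by (intro integrable_integral integrable_continuous_real continuous_on_sum Gs)
      have 2: "((\<lambda>w. \<Sum>m\<in>{- int N..<int N}. gh m * cis (2 * pi * of_int (m + j) * w)) has_integral
           (\<Sum>m\<in>{- int N..<int N}. gh m * (if m + j = 0 then 1 else 0))) {0..1}"
        by (intro has_integral_sum has_integral_mult_right has_integral_cis_period) simp
      have 3: "(\<Sum>m\<in>{- int N..<int N}. gh m * (if m + j = 0 then 1 else 0)) = gh (- j)"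
      proof -
        have "(\<Sum>m\<in>{- int N..<int N}. gh m * (if m + j = 0 then 1 else 0)) = (\<Sum>m\<in>{- int N..<int N}. if m = - j then gh m else 0)"
          by (intro sum.cong) auto
        also have "\<dots> = gh (- j)" using that by (subst sum.delta) auto
        finally show ?thesis .
      qed
      have "((\<lambda>w. \<Sum>m\<in>{- int N..<int N}. f j m w) has_integral integral {- real N..real N} G - gh (- j)) {0..1}"
        using has_integral_diff[OF 1 2] unfolding fG sum_subtractf 3 .
      with IJ(1)[of N] show ?thesis by (rule has_integral_unique)
    qed
    have ev: "\<forall>\<^sub>F N in sequentially. integral {- real N..real N} G - gh (- j) = I N"
      using eventually_gt_at_top[of "nat \<bar>j\<bar>"] by eventually_elim (rule I[symmetric])
    have "(\<lambda>N. integral {- real N..real N} G - gh (- j)) \<longlonglongrightarrow> (\<integral>w. G w \<partial>lborel) - gh (- j)"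
      by (intro tendsto_intros integral_symmetric_tendsto Gi)
    also have "(\<integral>w. G w \<partial>lborel) - gh (- j) = 0" using hat[of j] by (simp add: G_def)
    finally have "I \<longlonglongrightarrow> 0" using ev by (rule Lim_transform_eventually)
    then have "J = 0" by (rule LIMSEQ_unique[OF IJ(3)])
    then show ?thesis using IJ(2) by (simp add: integral_unique)
  qed
  have "h w = 0" by (rule fourier_coefficients_zero[OF hcont hper coeff])
  moreover have "h w = (\<Sum>\<^sub>\<infinity>m. g (w + of_int m)) - (\<Sum>\<^sub>\<infinity>m. gh m * cis (2 * pi * of_int m * w))"
    unfolding h_def by (rule infsum_diff[OF gs' hs'])
  ultimately show "(\<Sum>\<^sub>\<infinity>m. g (w + of_int m)) = (\<Sum>\<^sub>\<infinity>m. gh m * cis (2 * pi * of_int m * w))" by simp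
qed

section \<open>Gaussians and theta inversion in dimension one\<close>

lemma gaussian_fourier:
  assumes a: "a > 0"
  shows "integrable lborel (\<lambda>w. exp (- pi * w\<^sup>2 / a) * cis (- 2 * pi * w * y))"
    and "(\<integral>w. exp (- pi * w\<^sup>2 / a) * cis (- 2 * pi * w * y) \<partial>lborel) = of_real (sqrt a * exp (- pi * a * y\<^sup>2))"
proof -
  \<comment> \<open>The Gaussian has variance a / (2 pi), so w = b x turns it into the standard
    normal density, whose characteristic function is known.\<close>
  define b where "b = sqrt (a / (2 * pi))"
  have b: "b > 0" "b\<^sup>2 = a / (2 * pi)" using a by (auto simp: b_def)
  let ?g = "\<lambda>w. complex_of_real (exp (- pi * w\<^sup>2 / a)) * cis (- 2 * pi * w * y)"
  define t where "t = - 2 * pi * y * b"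
  have e: "?g (b * x) = of_real (sqrt (2 * pi)) * (of_real (std_normal_density x) * iexp (t * x))" for x
  proof -
    have "pi * (b * x)\<^sup>2 / a = x\<^sup>2 / 2" using a by (simp add: power_mult_distrib b)
    then show ?thesis by (simp add: std_normal_density_def t_def cis_conv_exp mult_ac)
  qed
  have i1: "integrable std_normal_distribution (\<lambda>x. iexp (t * x))"
    by (rule prob_space.integrable_iexp) (auto intro: real_distribution.axioms(1) real_dist_normal_dist)
  then have i2: "integrable lborel (\<lambda>x. std_normal_density x *\<^sub>R iexp (t * x))"
    by (subst (asm) integrable_density) auto
  have "integrable lborel (\<lambda>x. ?g (0 + b * x))"
    using integrable_mult_right[OF i2[unfolded scaleR_conv_of_real], of "of_real (sqrt (2 * pi))"]
    by (simp only: e add_0_left)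
  then show "integrable lborel ?g"
    using lborel_integrable_real_affine_iff[of b ?g 0] b(1) by simp
  have "(\<integral>x. std_normal_density x *\<^sub>R iexp (t * x) \<partial>lborel) = char std_normal_distribution t"
    unfolding char_def by (subst integral_density) auto
  also have "\<dots> = exp (- (t\<^sup>2) / 2)" by (simp add: char_std_normal_distribution)
  finally have c0: "(\<integral>x. std_normal_density x *\<^sub>R iexp (t * x) \<partial>lborel) = of_real (exp (- (t\<^sup>2) / 2))" .
  have c: "(\<integral>x. of_real (std_normal_density x) * iexp (t * x) \<partial>lborel) = of_real (exp (- (t\<^sup>2) / 2))"
    using c0 unfolding scaleR_conv_of_real .
  have "(\<integral>w. ?g w \<partial>lborel) = \<bar>b\<bar> *\<^sub>R (\<integral>x. ?g (0 + b * x) \<partial>lborel)"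
    by (rule lborel_integral_real_affine) (use b in auto)
  also have "(\<integral>x. ?g (0 + b * x) \<partial>lborel) = complex_of_real (sqrt (2 * pi)) * complex_of_real (exp (- (t\<^sup>2) / 2))"
    unfolding add_0_left e by (subst integral_mult_right_zero) (simp only: c)
  also have "\<bar>b\<bar> *\<^sub>R (complex_of_real (sqrt (2 * pi)) * complex_of_real (exp (- (t\<^sup>2) / 2))) = of_real ((b * sqrt (2 * pi)) * exp (- (t\<^sup>2) / 2))"
    using b by (simp add: scaleR_conv_of_real)
  also have "b * sqrt (2 * pi) = sqrt a" using a by (simp add: b_def real_sqrt_divide)
  also have "- (t\<^sup>2) / 2 = - pi * a * y\<^sup>2"
    by (simp add: t_def power_mult_distrib b) (simp add: power2_eq_square)
  finally show "(\<integral>w. ?g w \<partial>lborel) = of_real (sqrt a * exp (- pi * a * y\<^sup>2))" by simp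
qed

lemma exp_neg_square_decay:
  assumes "c > 0"
  shows "exp (- (c * w\<^sup>2)) \<le> (1 + 1 / c) / (1 + (w::real)\<^sup>2)"
proof -
  have "1 + w\<^sup>2 \<le> (1 + 1 / c) * (1 + c * w\<^sup>2)"
    using assms by (simp add: algebra_simps)
  also have "\<dots> \<le> (1 + 1 / c) * exp (c * w\<^sup>2)"
    using assms exp_ge_add_one_self[of "c * w\<^sup>2"] by (intro mult_left_mono) auto
  finally show ?thesis
    using assms by (simp add: exp_minus field_simps add_pos_nonneg)
qed

text \<open>Poisson summation for a Gaussian with a phase, read from right to left: its transform is
  the Gaussian on the left side. Later the shift \<open>x\<close> is a coordinate of a coset and the
  frequency \<open>w\<close> a coordinate of the vector \<open>y\<close>.\<close>

theorem theta_inversion: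
  fixes a x w :: real
  assumes a: "a > 0"
  shows "(\<Sum>\<^sub>\<infinity>j::int. exp (- pi * a * (of_int j + x)\<^sup>2) * cis (2 * pi * w * (of_int j + x))) =
     of_real (1 / sqrt a) * (\<Sum>\<^sub>\<infinity>m::int. cis (2 * pi * of_int m * x) * exp (- pi * (of_int m - w)\<^sup>2 / a))"
    and "(\<lambda>j::int. norm (exp (- pi * a * (of_int j + x)\<^sup>2) * cis (2 * pi * w * (of_int j + x)))) summable_on UNIV"
    and "(\<lambda>m::int. norm (cis (2 * pi * of_int m * x) * exp (- pi * (of_int m - w)\<^sup>2 / a))) summable_on UNIV"
proof -
  define g where "g = (\<lambda>w. exp (- pi * w\<^sup>2 / a) * cis (- 2 * pi * w * x))"
  define gh where "gh = (\<lambda>j::int. complex_of_real (sqrt a * exp (- pi * a * (of_int j + x)\<^sup>2)))"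
  have g1: "continuous_on UNIV g" unfolding g_def by (intro continuous_intros) (use a in auto)
  have g2: "integrable lborel g" unfolding g_def by (rule gaussian_fourier[OF a])
  have g3: "norm (g w) \<le> (1 + 1 / (pi / a)) / (1 + w\<^sup>2)" for w
    using exp_neg_square_decay[of "pi / a" w] a by (simp add: g_def norm_mult)
  have g4: "(\<integral>w. g w * cis (2 * pi * of_int j * w) \<partial>lborel) = gh (- j)" for j
  proof -
    have "g w * cis (2 * pi * of_int j * w) = exp (- pi * w\<^sup>2 / a) * cis (- 2 * pi * w * (x - of_int j))" for w
      unfolding g_def mult.assoc cis_mult by (simp add: algebra_simps)
    then show ?thesis using gaussian_fourier(2)[OF a, of "x - of_int j"] by (simp add: gh_def)
  qed
  define D where "D = sqrt a * (1 + 1 / (pi * a)) * (2 + 2 * x\<^sup>2)"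
  have g5: "norm (gh j) \<le> D / (1 + (of_int j)\<^sup>2)" for j
  proof -
    have sq: "(of_int j :: real)\<^sup>2 \<le> 2 * (x + of_int j)\<^sup>2 + 2 * x\<^sup>2"
    proof -
      have "0 \<le> (x + (x + of_int j))\<^sup>2" by simp
      then show ?thesis by (simp add: power2_eq_square algebra_simps)
    qed
    have nn: "0 \<le> x\<^sup>2 * (x + of_int j)\<^sup>2" by simp
    have "1 + (of_int j :: real)\<^sup>2 \<le> (2 + 2 * x\<^sup>2) * (1 + (x + of_int j)\<^sup>2)"
      using sq nn by (simp only: distrib_left distrib_right)
    then have le: "1 / (1 + (x + of_int j)\<^sup>2) \<le> (2 + 2 * x\<^sup>2) / (1 + (of_int j)\<^sup>2)"
      by (simp add: divide_simps mult.commute add_pos_nonneg)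
    have "norm (gh j) = sqrt a * exp (- (pi * a * (x + of_int j)\<^sup>2))"
      using a by (simp add: gh_def norm_mult add.commute)
    also have "\<dots> \<le> sqrt a * ((1 + 1 / (pi * a)) / (1 + (x + of_int j)\<^sup>2))"
      using a by (intro mult_left_mono exp_neg_square_decay) auto
    also have "\<dots> = sqrt a * (1 + 1 / (pi * a)) * (1 / (1 + (x + of_int j)\<^sup>2))" by simp
    also have "\<dots> \<le> sqrt a * (1 + 1 / (pi * a)) * ((2 + 2 * x\<^sup>2) / (1 + (of_int j)\<^sup>2))"
      using a by (intro mult_left_mono le) auto
    finally show ?thesis by (simp add: D_def)
  qed
  note P = poisson_summation[OF g1 g2 g3 g4 g5]
  have L: "exp (- pi * a * (of_int j + x)\<^sup>2) * cis (2 * pi * w * (of_int j + x)) =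
      (of_real (1 / sqrt a) * cis (2 * pi * w * x)) * (gh j * cis (2 * pi * of_int j * w))" for j
    using a by (simp add: gh_def distrib_left mult_ac flip: cis_mult)
  have R: "cis (2 * pi * w * x) * g (w + of_int m) = cis (2 * pi * of_int (- m) * x) * exp (- pi * (of_int (- m) - w)\<^sup>2 / a)" for m
  proof -
    have "(w + of_int m)\<^sup>2 = (of_int (- m) - w)\<^sup>2" by (simp add: power2_eq_square algebra_simps)
    moreover have "cis (2 * pi * w * x) * cis (- 2 * pi * (w + of_int m) * x) = cis (2 * pi * of_int (- m) * x)"
      by (simp add: cis_mult algebra_simps)
    ultimately show ?thesis unfolding g_def by (simp add: mult_ac)
  qed
  have bij: "bij_betw uminus (UNIV :: int set) UNIV"
    by (rule bij_betwI[of _ _ _ uminus]) auto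
  have Rs: "(\<lambda>m. norm (cis (2 * pi * w * x) * g (w + of_int m))) summable_on UNIV"
    using P(2)[of w] by (simp add: norm_mult)
  then show "(\<lambda>m::int. norm (cis (2 * pi * of_int m * x) * exp (- pi * (of_int m - w)\<^sup>2 / a))) summable_on UNIV"
    unfolding R using summable_on_reindex_bij_betw[OF bij, of "\<lambda>m. norm (cis (2 * pi * of_int m * x) * exp (- pi * (of_int m - w)\<^sup>2 / a))"]
    by simp
  show "(\<lambda>j::int. norm (exp (- pi * a * (of_int j + x)\<^sup>2) * cis (2 * pi * w * (of_int j + x)))) summable_on UNIV"
    unfolding L using summable_on_cmult_right[OF P(3)[of w], of "norm (of_real (1 / sqrt a) * cis (2 * pi * w * x))"]
    by (simp add: norm_mult norm_divide mult_ac)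
  have "(\<Sum>\<^sub>\<infinity>j::int. exp (- pi * a * (of_int j + x)\<^sup>2) * cis (2 * pi * w * (of_int j + x))) =
    (of_real (1 / sqrt a) * cis (2 * pi * w * x)) * (\<Sum>\<^sub>\<infinity>j. gh j * cis (2 * pi * of_int j * w))"
    unfolding L by (rule infsum_cmult_right')
  also have "\<dots> = of_real (1 / sqrt a) * (cis (2 * pi * w * x) * (\<Sum>\<^sub>\<infinity>m. g (w + of_int m)))"
    using P(1)[of w] by simp
  also have "cis (2 * pi * w * x) * (\<Sum>\<^sub>\<infinity>m. g (w + of_int m)) = (\<Sum>\<^sub>\<infinity>m. cis (2 * pi * w * x) * g (w + of_int m))"
    by (rule infsum_cmult_right'[symmetric])
  also have "\<dots> = (\<Sum>\<^sub>\<infinity>m::int. cis (2 * pi * of_int m * x) * exp (- pi * (of_int m - w)\<^sup>2 / a))"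
    unfolding R using infsum_reindex_bij_betw[OF bij, of "\<lambda>m. cis (2 * pi * of_int m * x) * exp (- pi * (of_int m - w)\<^sup>2 / a)"]
    by simp
  finally show "(\<Sum>\<^sub>\<infinity>j::int. exp (- pi * a * (of_int j + x)\<^sup>2) * cis (2 * pi * w * (of_int j + x))) =
     of_real (1 / sqrt a) * (\<Sum>\<^sub>\<infinity>m::int. cis (2 * pi * of_int m * x) * exp (- pi * (of_int m - w)\<^sup>2 / a))" .
qed

section \<open>Theta functions of self-dual lattices\<close>

lemma summable_on_prod_fun:
  fixes f :: "'i::finite \<Rightarrow> 'b \<Rightarrow> complex"
  assumes "\<And>i. (\<lambda>x. norm (f i x)) summable_on UNIV"
  shows "(\<lambda>k. norm (\<Prod>i\<in>UNIV. f i (k i))) summable_on UNIV"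
proof (rule nonneg_bdd_above_summable_on)
  show "bdd_above (sum (\<lambda>k. norm (\<Prod>i\<in>UNIV. f i (k i))) ` {F. F \<subseteq> UNIV \<and> finite F})"
  proof (rule bdd_aboveI2)
    fix F :: "('i \<Rightarrow> 'b) set" assume "F \<in> {F. F \<subseteq> UNIV \<and> finite F}"
    then have F: "finite F" by simp
    define B where "B i = (\<lambda>k. k i) ` F" for i
    have B: "finite (B i)" for i by (simp add: B_def F)
    have "F \<subseteq> PiE UNIV B" by (auto simp: B_def)
    then have "(\<Sum>k\<in>F. norm (\<Prod>i\<in>UNIV. f i (k i))) \<le> (\<Sum>k\<in>PiE UNIV B. norm (\<Prod>i\<in>UNIV. f i (k i)))"
      by (intro sum_mono2 finite_PiE B) auto
    also have "\<dots> = (\<Prod>i\<in>UNIV. \<Sum>x\<in>B i. norm (f i x))"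
      by (subst prod_sum_PiE) (auto simp: B prod_norm)
    also have "\<dots> \<le> (\<Prod>i\<in>UNIV. \<Sum>\<^sub>\<infinity>x. norm (f i x))"
      by (intro prod_mono conjI sum_nonneg finite_sum_le_infsum assms B) auto
    finally show "(\<Sum>k\<in>F. norm (\<Prod>i\<in>UNIV. f i (k i))) \<le> (\<Prod>i\<in>UNIV. \<Sum>\<^sub>\<infinity>x. norm (f i x))" .
  qed
qed simp

lemma infsum_prod_fun:
  fixes f :: "'i::finite \<Rightarrow> 'b \<Rightarrow> complex"
  assumes "\<And>i. (\<lambda>x. norm (f i x)) summable_on UNIV"
  shows "(\<Sum>\<^sub>\<infinity>k. \<Prod>i\<in>UNIV. f i (k i)) = (\<Prod>i\<in>UNIV. \<Sum>\<^sub>\<infinity>x. f i x)"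
  using infsum_prod_PiE_abs[of UNIV f "\<lambda>_. UNIV"] assms by simp

lemma infsum_sum:
  fixes f :: "'a \<Rightarrow> 'b \<Rightarrow> complex"
  assumes "finite R" "\<And>r. r \<in> R \<Longrightarrow> f r summable_on A"
  shows "(\<Sum>\<^sub>\<infinity>x\<in>A. \<Sum>r\<in>R. f r x) = (\<Sum>r\<in>R. \<Sum>\<^sub>\<infinity>x\<in>A. f r x)"
proof -
  have "((\<lambda>x. \<Sum>r\<in>R. f r x) has_sum (\<Sum>r\<in>R. \<Sum>\<^sub>\<infinity>x\<in>A. f r x)) A"
    using assms by (induction R rule: finite_induct) (auto intro!: has_sum_add has_sum_infsum)
  then show ?thesis by (rule infsumI)
qed

lemma exp_sum': "finite I \<Longrightarrow> (\<Prod>i\<in>I. complex_of_real (exp (g i))) = of_real (exp (\<Sum>i\<in>I. g i))"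
  by (simp add: exp_sum)

lemma cis_sum: "finite I \<Longrightarrow> (\<Prod>i\<in>I. cis (g i)) = cis (\<Sum>i\<in>I. g i)"
  by (induction I rule: finite_induct) (auto simp: cis_mult)

text \<open>No basis is fixed: \<open>integral\<close> and \<open>dual\<close> together say that the
  lattice equals its dual, and \<open>spanning\<close> lets an orthogonal frame be found inside
  it.\<close>

locale self_dual_lattice =
  fixes \<Lambda> :: "(real ^ 'n) set"
  assumes zero: "0 \<in> \<Lambda>" and add: "x \<in> \<Lambda> \<Longrightarrow> y \<in> \<Lambda> \<Longrightarrow> x + y \<in> \<Lambda>" and minus: "x \<in> \<Lambda> \<Longrightarrow> - x \<in> \<Lambda>"
    and integral: "x \<in> \<Lambda> \<Longrightarrow> y \<in> \<Lambda> \<Longrightarrow> x \<bullet> y \<in> \<int>"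
    and dual: "(\<And>y. y \<in> \<Lambda> \<Longrightarrow> x \<bullet> y \<in> \<int>) \<Longrightarrow> x \<in> \<Lambda>"
    and spanning: "span \<Lambda> = UNIV"
begin

lemma diff: "x \<in> \<Lambda> \<Longrightarrow> y \<in> \<Lambda> \<Longrightarrow> x - y \<in> \<Lambda>"
  using add[of x "- y"] minus[of y] by simp

lemma scale_nat: "x \<in> \<Lambda> \<Longrightarrow> real m *\<^sub>R x \<in> \<Lambda>"
  by (induction m) (auto simp: zero add scaleR_left_distrib)

lemma scale: "x \<in> \<Lambda> \<Longrightarrow> c \<in> \<int> \<Longrightarrow> c *\<^sub>R x \<in> \<Lambda>"
proof -
  assume x: "x \<in> \<Lambda>" and "c \<in> \<int>"
  then obtain m where c: "c = of_int m" by (auto elim: Ints_cases)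
  show ?thesis
  proof (cases "m \<ge> 0")
    case True
    then show ?thesis using scale_nat[OF x, of "nat m"] c by simp
  next
    case False
    then show ?thesis using minus[OF scale_nat[OF x, of "nat (- m)"]] c by simp
  qed
qed

lemma sum_mem: "(\<And>i. i \<in> I \<Longrightarrow> f i \<in> \<Lambda>) \<Longrightarrow> (\<Sum>i\<in>I. f i) \<in> \<Lambda>"
  by (induction I rule: infinite_finite_induct) (auto simp: zero add)

definition orth :: "(real ^ 'n) set \<Rightarrow> bool" where
  "orth B \<longleftrightarrow> B \<subseteq> \<Lambda> \<and> 0 \<notin> B \<and> pairwise orthogonal B"

lemma orth_independent: "orth B \<Longrightarrow> independent B"
  unfolding orth_def using pairwise_orthogonal_independent by blast

text \<open>Gram-Schmidt inside the lattice: the projection onto the span of \<open>B\<close> has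
  the denominators \<open>b \<bullet> b\<close>, and scaling by their product \<open>D\<close>
  clears them.\<close>

lemma orth_extend:
  assumes B: "orth B" and c: "card B < CARD('n)"
  obtains w where "w \<notin> B" "orth (insert w B)"
proof -
  have fin: "finite B" using orth_independent[OF B] by (rule independent_imp_finite)
  have "\<not> \<Lambda> \<subseteq> span B"
  proof
    assume "\<Lambda> \<subseteq> span B"
    then have "span \<Lambda> \<subseteq> span B" by (rule span_minimal) (rule subspace_span)
    then have "span B = UNIV" using spanning by auto
    then have "dim (UNIV :: (real ^ 'n) set) \<le> card B"
      by (intro dim_le_card) (auto simp: fin)
    then show False using c by (simp add: dim_UNIV)
  qed
  then obtain a where a: "a \<in> \<Lambda>" "a \<notin> span B" by blast
  define D where "D = (\<Prod>b\<in>B. b \<bullet> b)"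
  define p where "p = (\<Sum>b\<in>B. ((a \<bullet> b) / (b \<bullet> b)) *\<^sub>R b)"
  define w where "w = D *\<^sub>R (a - p)"
  have b0: "b \<bullet> b \<noteq> 0" if "b \<in> B" for b using that B by (auto simp: orth_def)
  have D: "D \<noteq> 0" "D \<in> \<int>"
    unfolding D_def using B b0 fin by (auto simp: orth_def intro!: Ints_prod integral)
  have pB: "p \<in> span B" unfolding p_def by (intro span_sum span_scale span_base)
  have w0: "w \<noteq> 0"
  proof
    assume "w = 0"
    then have "a = p" using D by (simp add: w_def)
    then show False using a pB by simp
  qed
  have "D *\<^sub>R p \<in> \<Lambda>"
  proof -
    have "D *\<^sub>R p = (\<Sum>b\<in>B. ((a \<bullet> b) * (\<Prod>b'\<in>B - {b}. b' \<bullet> b')) *\<^sub>R b)"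
      unfolding p_def scaleR_sum_right
    proof (rule sum.cong[OF refl])
      fix b assume b: "b \<in> B"
      have "D = (b \<bullet> b) * (\<Prod>b'\<in>B - {b}. b' \<bullet> b')" unfolding D_def by (rule prod.remove[OF fin b])
      then show "D *\<^sub>R ((a \<bullet> b) / (b \<bullet> b)) *\<^sub>R b = ((a \<bullet> b) * (\<Prod>b'\<in>B - {b}. b' \<bullet> b')) *\<^sub>R b"
        using b0[OF b] by simp
    qed
    also have "\<dots> \<in> \<Lambda>"
      using B a by (intro sum_mem scale Ints_mult Ints_prod integral) (auto simp: orth_def)
    finally show ?thesis .
  qed
  then have wL: "w \<in> \<Lambda>" using diff[OF scale[OF a(1) D(2)]] by (simp add: w_def scaleR_diff_right)
  have wb: "w \<bullet> b = 0" if b: "b \<in> B" for b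
  proof -
    have "p \<bullet> b = (\<Sum>b'\<in>B. ((a \<bullet> b') / (b' \<bullet> b')) * (b' \<bullet> b))"
      by (simp add: p_def inner_sum_left)
    also have "\<dots> = (\<Sum>b'\<in>B. if b' = b then a \<bullet> b else 0)"
      using B b b0 by (intro sum.cong) (auto simp: orth_def pairwise_def orthogonal_def)
    also have "\<dots> = a \<bullet> b" using b fin by simp
    finally show ?thesis by (simp add: w_def inner_diff_left)
  qed
  have "w \<notin> B" using wb[of w] w0 by auto
  moreover have "orth (insert w B)"
    using B wL w0 wb by (auto simp: orth_def pairwise_insert orthogonal_def inner_commute)
  ultimately show ?thesis by (rule that)
qed

lemma orthogonal_frame:
  obtains v :: "'n \<Rightarrow> real ^ 'n" where "\<And>i. v i \<in> \<Lambda>" "\<And>i. v i \<noteq> 0" "\<And>i j. i \<noteq> j \<Longrightarrow> v i \<bullet> v j = 0"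
proof -
  have "\<exists>B. orth B \<and> card B = m" if "m \<le> CARD('n)" for m
    using that
  proof (induction m)
    case 0
    then show ?case by (intro exI[of _ "{}"]) (simp add: orth_def)
  next
    case (Suc m)
    then obtain B where B: "orth B" "card B = m" by auto
    then obtain w where w: "w \<notin> B" "orth (insert w B)" using orth_extend[of B] Suc.prems by auto
    have "finite B" using orth_independent[OF B(1)] by (rule independent_imp_finite)
    then show ?case using w B by (intro exI[of _ "insert w B"]) simp
  qed
  then obtain B where B: "orth B" "card B = CARD('n)" by blast
  have "finite B" using orth_independent[OF B(1)] by (rule independent_imp_finite)
  then have "\<exists>h. bij_betw h (UNIV :: 'n set) B"
    by (intro finite_same_card_bij) (simp_all add: B(2))
  then obtain v where v: "bij_betw v (UNIV :: 'n set) B" by (rule exE)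
  have vB: "v i \<in> B" for i using v by (auto simp: bij_betw_def)
  show ?thesis
  proof (rule that)
    show "v i \<in> \<Lambda>" "v i \<noteq> 0" for i using vB[of i] B(1) by (auto simp: orth_def)
    show "v i \<bullet> v j = 0" if "i \<noteq> j" for i j
    proof -
      have "v i \<noteq> v j" using v that by (auto simp: bij_betw_def inj_on_def)
      then show ?thesis using B(1) vB[of i] vB[of j] by (auto simp: orth_def pairwise_def orthogonal_def)
    qed
  qed
qed

end

section \<open>Poisson summation by cosets of an orthogonal frame\<close>

locale framed_lattice = self_dual_lattice \<Lambda> for \<Lambda> :: "(real ^ 'n) set" +
  fixes v :: "'n \<Rightarrow> real ^ 'n"
  assumes v_mem: "v i \<in> \<Lambda>" and v_nz: "v i \<noteq> 0" and v_orth: "i \<noteq> j \<Longrightarrow> v i \<bullet> v j = 0"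
begin

definition N :: "'n \<Rightarrow> int" where "N i = \<lfloor>v i \<bullet> v i\<rfloor>"

lemma N: "of_int (N i) = v i \<bullet> v i" "N i > 0"
proof -
  show *: "of_int (N i) = v i \<bullet> v i"
    using integral[OF v_mem v_mem, of i i] by (auto simp: N_def elim: Ints_cases)
  have "v i \<bullet> v i > 0" using v_nz by simp
  then show "N i > 0" unfolding *[symmetric] by simp
qed

text \<open>The coordinates are inner products with the frame vectors. Thus all integer vectors
  together describe the dual of the frame lattice, and this dual contains
  \<open>\<Lambda>\<close>.\<close>

definition emb :: "('n \<Rightarrow> int) \<Rightarrow> real ^ 'n" where
  "emb k = (\<Sum>i\<in>UNIV. (of_int (k i) / of_int (N i)) *\<^sub>R v i)"

lemma sum_v_inner: "(\<Sum>i\<in>UNIV. c i *\<^sub>R v i) \<bullet> v j = c j * (v j \<bullet> v j)"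
proof -
  have "(\<Sum>i\<in>UNIV. c i *\<^sub>R v i) \<bullet> v j = (\<Sum>i\<in>UNIV. if i = j then c j * (v j \<bullet> v j) else 0)"
    unfolding inner_sum_left by (intro sum.cong) (auto simp: v_orth)
  then show ?thesis by simp
qed

lemma emb_inner: "emb k \<bullet> v j = of_int (k j)"
  unfolding emb_def sum_v_inner using N[of j] by (simp add: N(1)[symmetric])

lemma expansion: "x = (\<Sum>i\<in>UNIV. ((x \<bullet> v i) / of_int (N i)) *\<^sub>R v i)"
proof -
  define y where "y = x - (\<Sum>i\<in>UNIV. ((x \<bullet> v i) / of_int (N i)) *\<^sub>R v i)"
  have y: "y \<bullet> v j = 0" for j
    unfolding y_def inner_diff_left sum_v_inner using N[of j] by (simp add: N(1)[symmetric])
  have inj: "inj v"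
  proof (rule injI)
    fix i j assume "v i = v j"
    then show "i = j" using v_orth[of i j] v_nz[of i] by auto
  qed
  have "pairwise orthogonal (range v)"
  proof (rule pairwiseI)
    fix x y assume "x \<in> range v" "y \<in> range v" "x \<noteq> y"
    then obtain i j where "x = v i" "y = v j" "i \<noteq> j" by auto
    then show "orthogonal x y" using v_orth by (simp add: orthogonal_def)
  qed
  moreover have "0 \<notin> range v"
  proof
    assume "0 \<in> range v"
    then obtain i where "0 = v i" by (rule imageE)
    then show False using v_nz[of i] by simp
  qed
  ultimately have ind: "independent (range v)" by (rule pairwise_orthogonal_independent)
  have "card (range v) = CARD('n)" using inj by (rule card_image)
  then have "UNIV \<subseteq> span (range v)"
    by (intro card_ge_dim_independent ind) (auto simp: dim_UNIV)
  then have "y \<in> span (range v)" by blast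
  then have "orthogonal y y"
    by (rule orthogonal_to_span) (use y in \<open>auto simp: orthogonal_def\<close>)
  then have "y = 0" by (simp add: orthogonal_def)
  then show ?thesis by (simp add: y_def)
qed

lemma inner_expansion: "x \<bullet> y = (\<Sum>i\<in>UNIV. (x \<bullet> v i) * (y \<bullet> v i) / of_int (N i))"
  by (subst expansion[of x]) (simp add: inner_sum_left inner_sum_right inner_commute)

definition K :: "('n \<Rightarrow> int) set" where "K = {k. emb k \<in> \<Lambda>}"

lemma emb_bij: "bij_betw emb K \<Lambda>"
proof (rule bij_betw_imageI)
  show "inj_on emb K"
  proof (rule inj_onI)
    fix k l assume e: "emb k = emb l"
    have "k i = l i" for i using arg_cong[OF e, of "\<lambda>x. x \<bullet> v i"] by (simp add: emb_inner)
    then show "k = l" by auto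
  qed
  have "u \<in> emb ` K" if u: "u \<in> \<Lambda>" for u
  proof -
    define k where "k i = \<lfloor>u \<bullet> v i\<rfloor>" for i
    have "of_int (k i) = u \<bullet> v i" for i
      using integral[OF u v_mem, of i] by (auto simp: k_def elim: Ints_cases)
    then have "emb k = u" using expansion[of u] by (simp add: emb_def)
    then show ?thesis using u by (auto simp: K_def)
  qed
  then show "emb ` K = \<Lambda>" by (auto simp: K_def)
qed

text \<open>Translation by the frame vector with coefficients \<open>j\<close>: adding
  \<open>N i\<close> to a coordinate adds one copy of \<open>v i\<close>.\<close>

definition comb :: "('n \<Rightarrow> int) \<Rightarrow> ('n \<Rightarrow> int) \<Rightarrow> 'n \<Rightarrow> int" where
  "comb r j = (\<lambda>i. r i + N i * j i)"

lemma emb_comb: "emb (comb r j) = emb r + (\<Sum>i\<in>UNIV. of_int (j i) *\<^sub>R v i)"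
proof -
  have "(of_int (r i + N i * j i) / of_int (N i)) *\<^sub>R v i = (of_int (r i) / of_int (N i)) *\<^sub>R v i + of_int (j i) *\<^sub>R v i" for i
    using N(2)[of i] by (simp add: add_divide_distrib scaleR_left_distrib)
  then show ?thesis by (simp add: emb_def comb_def sum.distrib)
qed

lemma comb_K: "comb r j \<in> K \<longleftrightarrow> r \<in> K"
proof -
  have s: "(\<Sum>i\<in>UNIV. of_int (j i) *\<^sub>R v i) \<in> \<Lambda>" by (intro sum_mem scale v_mem) auto
  have "emb r \<in> \<Lambda>" if "emb r + (\<Sum>i\<in>UNIV. of_int (j i) *\<^sub>R v i) \<in> \<Lambda>"
    using diff[OF that s] by simp
  then show ?thesis
    unfolding K_def mem_Collect_eq emb_comb using add[OF _ s, of "emb r"] by (rule iffI)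
qed

text \<open>Representatives of the finite quotient of \<open>\<Lambda>\<close> by the frame
  lattice.\<close>

definition RK :: "('n \<Rightarrow> int) set" where "RK = {r. \<forall>i. 0 \<le> r i \<and> r i < N i} \<inter> K"

lemma finite_RK: "finite RK"
proof -
  have "RK \<subseteq> PiE UNIV (\<lambda>i. {0..<N i})" by (auto simp: RK_def)
  then show ?thesis by (rule finite_subset) (intro finite_PiE; simp)
qed

definition red :: "('n \<Rightarrow> int) \<Rightarrow> 'n \<Rightarrow> int" where "red k = (\<lambda>i. k i mod N i)"

lemma comb_red: "comb (red k) (\<lambda>i. k i div N i) = k"
  by (simp add: comb_def red_def fun_eq_iff)

lemma red_RK: "k \<in> K \<Longrightarrow> red k \<in> RK"
  using comb_K[of "red k" "\<lambda>i. k i div N i"] N(2) unfolding comb_red RK_def by (simp add: red_def)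

lemma red_comb: "r \<in> RK \<Longrightarrow> red (comb r j) = r"
  by (auto simp: RK_def red_def comb_def fun_eq_iff)

lemma comb_bij: "bij_betw (\<lambda>(r, j). comb r j) (RK \<times> UNIV) K"
proof (rule bij_betwI[where g = "\<lambda>k. (red k, \<lambda>i. k i div N i)"])
  show "(\<lambda>(r, j). comb r j) \<in> RK \<times> UNIV \<rightarrow> K" by (auto simp: comb_K RK_def)
  show "(\<lambda>k. (red k, \<lambda>i. k i div N i)) \<in> K \<rightarrow> RK \<times> UNIV" by (auto simp: red_RK)
  fix p assume p: "p \<in> RK \<times> (UNIV :: ('n \<Rightarrow> int) set)"
  obtain r j where rj: "p = (r, j)" by (cases p)
  have "(r i + N i * j i) div N i = j i" for i
    using p rj N(2)[of i] by (auto simp: RK_def)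
  then have "(\<lambda>i. comb r j i div N i) = j" by (simp add: comb_def)
  then show "(red (case p of (r, j) \<Rightarrow> comb r j), \<lambda>i. (case p of (r, j) \<Rightarrow> comb r j) i div N i) = p"
    using red_comb[of r j] p rj by simp
next
  show "(case (red k, \<lambda>i. k i div N i) of (r, j) \<Rightarrow> comb r j) = k" for k by (simp add: comb_red)
qed

definition chi :: "('n \<Rightarrow> int) \<Rightarrow> ('n \<Rightarrow> int) \<Rightarrow> complex" where
  "chi m r = cis (2 * pi * (emb m \<bullet> emb r))"

lemma chi_comb: "chi m (comb r j) = chi m r"
proof -
  have "emb m \<bullet> (\<Sum>i\<in>UNIV. of_int (j i) *\<^sub>R v i) = of_int (\<Sum>i\<in>UNIV. j i * m i)"
    by (simp add: inner_sum_right emb_inner)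
  then have "2 * pi * (emb m \<bullet> emb (comb r j)) = 2 * pi * (emb m \<bullet> emb r) + 2 * pi * of_int (\<Sum>i\<in>UNIV. j i * m i)"
    by (simp add: emb_comb inner_add_right distrib_left)
  moreover have "cis (2 * pi * of_int (\<Sum>i\<in>UNIV. j i * m i)) = 1"
    by (rule cis_multiple_2pi) (rule Ints_of_int)
  ultimately show ?thesis unfolding chi_def by (simp only: cis_mult[symmetric] mult_1_right)
qed

lemma emb_add: "emb (\<lambda>i. k i + l i) = emb k + emb l"
  by (simp add: emb_def add_divide_distrib scaleR_left_distrib sum.distrib)

lemma emb_neg: "emb (\<lambda>i. - k i) = - emb k"
  by (simp add: emb_def sum_negf)

text \<open>Orthogonality of characters on the quotient by the frame lattice. Outside
  \<open>K\<close>, self-duality supplies a lattice vector with non-integral pairing, and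
  translating by it multiplies the sum by a factor different from 1.\<close>

lemma character_sum: "(\<Sum>r\<in>RK. chi m r) = (if m \<in> K then of_nat (card RK) else 0)"
proof (cases "m \<in> K")
  case True
  have "chi m r = 1" if "r \<in> RK" for r
    unfolding chi_def
    by (rule cis_multiple_2pi) (use integral True that in \<open>auto simp: K_def RK_def\<close>)
  then show ?thesis using True by simp
next
  case False
  then obtain u where u: "u \<in> \<Lambda>" "emb m \<bullet> u \<notin> \<int>" using dual by (auto simp: K_def)
  then obtain s where s: "s \<in> K" "u = emb s" using emb_bij by (auto simp: bij_betw_def)
  have chi_red: "chi m (red k) = chi m k" for k
    using chi_comb[of m "red k" "\<lambda>i. k i div N i"] by (simp add: comb_red)
  have sum_K: "(\<lambda>i. k i + l i) \<in> K" if "k \<in> K" "l \<in> K" for k l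
    using that add by (simp add: K_def emb_add)
  have ns: "(\<lambda>i. - s i) \<in> K" using s minus by (simp add: K_def emb_neg)
  define sh where "sh r = red (\<lambda>i. r i + s i)" for r
  define sh' where "sh' r = red (\<lambda>i. r i + - s i)" for r
  have RK_K: "r \<in> K" if "r \<in> RK" for r using that by (simp add: RK_def)
  have bij: "bij_betw sh RK RK"
  proof (rule bij_betwI[where g = sh'])
    show "sh \<in> RK \<rightarrow> RK" unfolding sh_def using red_RK sum_K RK_K s(1) by blast
    show "sh' \<in> RK \<rightarrow> RK" unfolding sh'_def using red_RK[OF sum_K[OF RK_K ns]] by blast
    show "sh' (sh r) = r" if "r \<in> RK" for r
      using that by (auto simp: sh_def sh'_def red_def RK_def fun_eq_iff mod_simps simp del: add_uminus_conv_diff)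
    show "sh (sh' r) = r" if "r \<in> RK" for r
      using that by (auto simp: sh_def sh'_def red_def RK_def fun_eq_iff mod_simps simp del: add_uminus_conv_diff)
  qed
  have "(\<Sum>r\<in>RK. chi m r) = (\<Sum>r\<in>RK. chi m (sh r))"
    by (rule sum.reindex_bij_betw[OF bij, symmetric])
  also have "\<dots> = (\<Sum>r\<in>RK. chi m s * chi m r)"
    unfolding sh_def chi_red by (simp add: chi_def emb_add inner_add_right distrib_left cis_mult add.commute)
  also have "\<dots> = chi m s * (\<Sum>r\<in>RK. chi m r)" by (rule sum_distrib_left[symmetric])
  finally have "(1 - chi m s) * (\<Sum>r\<in>RK. chi m r) = 0" by (simp add: algebra_simps)
  moreover have "chi m s \<noteq> 1"
  proof
    assume "chi m s = 1"
    then have "cis (2 * pi * (emb m \<bullet> u)) = cis 0" by (simp add: chi_def s)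
    then obtain n :: int where "2 * pi * (emb m \<bullet> u) = 0 + 2 * of_int n * pi" using cis_eq_imp by blast
    then have "emb m \<bullet> u = of_int n" by simp
    then show False using u(2) by simp
  qed
  ultimately show ?thesis using False by simp
qed

text \<open>On each coset of the frame lattice the sum is a product of one-dimensional theta series
  with parameter t N_i, shift r_i / N_i and frequency y.v_i. After inversion the dual sum runs over
  all integer vectors; summing over the cosets cuts it down to \<open>K\<close> by
  \<open>character_sum\<close>. The constant in front is left unevaluated.\<close>

lemma lattice_sum_identity:
  fixes t :: real and y :: "real ^ 'n"
  assumes t: "t > 0"
  defines "g \<equiv> \<lambda>u. exp (- pi * t * (u \<bullet> u)) * cis (2 * pi * (u \<bullet> y))"
    and "h \<equiv> \<lambda>w. complex_of_real (exp (- pi * ((w - y) \<bullet> (w - y)) / t))"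
  shows "(\<lambda>u. norm (g u)) summable_on \<Lambda>" "(\<lambda>w. norm (h w)) summable_on \<Lambda>"
    "(\<Sum>\<^sub>\<infinity>u\<in>\<Lambda>. g u) = of_real (real (card RK) * (\<Prod>i\<in>UNIV. 1 / sqrt (of_int (N i)))) * of_real ((1 / sqrt t) ^ CARD('n)) * (\<Sum>\<^sub>\<infinity>w\<in>\<Lambda>. h w)"
proof -
  define gi where "gi i k = exp (- pi * t * (of_int k)\<^sup>2 / of_int (N i)) * cis (2 * pi * (of_int k * (y \<bullet> v i) / of_int (N i)))" for i and k :: int
  define hi where "hi i k = complex_of_real (exp (- pi * (of_int k - y \<bullet> v i)\<^sup>2 / (t * of_int (N i))))" for i and k :: int
  have N0: "real_of_int (N i) > 0" for i using N(2)[of i] by simp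
  have tN: "t * of_int (N i) > 0" for i using t N0 by simp
  have g_prod: "g (emb k) = (\<Prod>i\<in>UNIV. gi i (k i))" for k
  proof -
    have "(\<Prod>i\<in>UNIV. gi i (k i)) = of_real (exp (\<Sum>i\<in>UNIV. - pi * t * (of_int (k i))\<^sup>2 / of_int (N i))) * cis (\<Sum>i\<in>UNIV. 2 * pi * (of_int (k i) * (y \<bullet> v i) / of_int (N i)))"
      unfolding gi_def prod.distrib by (simp only: exp_sum' cis_sum finite)
    moreover have "(\<Sum>i\<in>UNIV. - pi * t * (of_int (k i))\<^sup>2 / of_int (N i)) = - pi * t * (emb k \<bullet> emb k)"
      unfolding inner_expansion[of "emb k" "emb k"] emb_inner sum_distrib_left by (simp add: power2_eq_square)
    moreover have "(\<Sum>i\<in>UNIV. 2 * pi * (of_int (k i) * (y \<bullet> v i) / of_int (N i))) = 2 * pi * (emb k \<bullet> y)"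
      unfolding inner_expansion[of "emb k" y] emb_inner sum_distrib_left by simp
    ultimately show ?thesis by (simp add: g_def)
  qed
  have h_prod: "h (emb k) = (\<Prod>i\<in>UNIV. hi i (k i))" for k
  proof -
    have "(\<Prod>i\<in>UNIV. hi i (k i)) = of_real (exp (\<Sum>i\<in>UNIV. - pi * (of_int (k i) - y \<bullet> v i)\<^sup>2 / (t * of_int (N i))))"
      unfolding hi_def by (rule exp_sum') simp
    moreover have "(\<Sum>i\<in>UNIV. - pi * (of_int (k i) - y \<bullet> v i)\<^sup>2 / (t * of_int (N i))) = - pi * ((emb k - y) \<bullet> (emb k - y)) / t"
      by (subst inner_expansion[of "emb k - y" "emb k - y"])
         (simp add: inner_diff_left[of "emb k" y "v _"] emb_inner sum_distrib_left sum_divide_distrib power2_eq_square mult_ac)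
    ultimately show ?thesis by (simp add: h_def)
  qed
  have theta: "(\<Sum>\<^sub>\<infinity>j. gi i (r + N i * j)) = of_real (1 / sqrt (t * of_int (N i))) * (\<Sum>\<^sub>\<infinity>m. cis (2 * pi * of_int m * (of_int r / of_int (N i))) * hi i m)"
    and gi_sum: "(\<lambda>j. norm (gi i (r + N i * j))) summable_on UNIV"
    and hi_sum': "(\<lambda>m. norm (cis (2 * pi * of_int m * (of_int r / of_int (N i))) * hi i m)) summable_on UNIV" for i r
  proof -
    have e: "gi i (r + N i * j) = exp (- pi * (t * of_int (N i)) * (of_int j + of_int r / of_int (N i))\<^sup>2) *
        cis (2 * pi * (y \<bullet> v i) * (of_int j + of_int r / of_int (N i)))" for j
    proof -
      have x: "of_int (r + N i * j) = of_int (N i) * (of_int j + of_int r / of_int (N i) :: real)"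
        using N0[of i] by (simp add: field_simps)
      have "(of_int (r + N i * j))\<^sup>2 / of_int (N i) = of_int (N i) * (of_int j + of_int r / of_int (N i) :: real)\<^sup>2"
        unfolding x using N0[of i] by (simp add: power2_eq_square)
      moreover have "of_int (r + N i * j) * (y \<bullet> v i) / of_int (N i) = (y \<bullet> v i) * (of_int j + of_int r / of_int (N i))"
        unfolding x using N0[of i] by simp
      ultimately show ?thesis
        unfolding gi_def by (simp only: times_divide_eq_right[symmetric] mult.assoc)
    qed
    note T = theta_inversion[OF tN[of i], where x = "of_int r / of_int (N i)" and w = "y \<bullet> v i"]
    show "(\<Sum>\<^sub>\<infinity>j. gi i (r + N i * j)) = of_real (1 / sqrt (t * of_int (N i))) * (\<Sum>\<^sub>\<infinity>m. cis (2 * pi * of_int m * (of_int r / of_int (N i))) * hi i m)"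
      using T(1) unfolding e hi_def .
    show "(\<lambda>j. norm (gi i (r + N i * j))) summable_on UNIV"
      using T(2) unfolding e .
    show "(\<lambda>m. norm (cis (2 * pi * of_int m * (of_int r / of_int (N i))) * hi i m)) summable_on UNIV"
      using T(3) unfolding hi_def .
  qed
  have hi_sum: "(\<lambda>m. norm (hi i m)) summable_on UNIV" for i
    using hi_sum'[of 0 i] by simp
  have h_UNIV: "(\<lambda>k. norm (h (emb k))) summable_on UNIV"
    unfolding h_prod by (rule summable_on_prod_fun[OF hi_sum])
  have hK: "(\<lambda>k. norm (h (emb k))) summable_on K"
    by (rule summable_on_subset_banach[OF h_UNIV]) simp
  then show "(\<lambda>w. norm (h w)) summable_on \<Lambda>"
    using summable_on_reindex_bij_betw[OF emb_bij, of "\<lambda>w. norm (h w)"] by simp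
  have gr: "(\<lambda>j. norm (g (emb (comb r j)))) summable_on UNIV" for r
    unfolding g_prod comb_def by (rule summable_on_prod_fun[OF gi_sum])
  have gRK: "(\<lambda>p. norm (g (emb (case p of (r, j) \<Rightarrow> comb r j)))) summable_on RK \<times> UNIV"
  proof -
    have "(\<lambda>x. norm ((\<lambda>(r, j). g (emb (comb r j))) x)) summable_on (SIGMA r:RK. UNIV)"
      by (subst Infinite_Sum.abs_summable_on_Sigma_iff) (auto simp: gr finite_RK summable_on_finite)
    then show ?thesis by (simp add: case_prod_unfold)
  qed
  then have gK: "(\<lambda>k. norm (g (emb k))) summable_on K"
    using summable_on_reindex_bij_betw[OF comb_bij, of "\<lambda>k. norm (g (emb k))"] by simp
  then show "(\<lambda>u. norm (g u)) summable_on \<Lambda>"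
    using summable_on_reindex_bij_betw[OF emb_bij, of "\<lambda>w. norm (g w)"] by simp
  define c where "c = (\<Prod>i\<in>(UNIV::'n set). 1 / sqrt (t * of_int (N i)))"
  have c: "c = (\<Prod>i\<in>(UNIV::'n set). 1 / sqrt (of_int (N i))) * (1 / sqrt t) ^ CARD('n)"
    by (simp add: c_def real_sqrt_mult prod_dividef prod.distrib power_divide)
  have chi_prod: "chi m r = (\<Prod>i\<in>UNIV. cis (2 * pi * of_int (m i) * (of_int (r i) / of_int (N i))))" for m r
    unfolding chi_def inner_expansion[of "emb m" "emb r"] emb_inner
    by (simp add: cis_sum sum_distrib_left mult.assoc)
  have sum_r: "(\<Sum>\<^sub>\<infinity>j. g (emb (comb r j))) = of_real c * (\<Sum>\<^sub>\<infinity>m. chi m r * h (emb m))" for r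
  proof -
    have "(\<Sum>\<^sub>\<infinity>j. g (emb (comb r j))) = (\<Prod>i\<in>UNIV. \<Sum>\<^sub>\<infinity>j. gi i (r i + N i * j))"
      unfolding g_prod comb_def by (rule infsum_prod_fun[OF gi_sum])
    also have "\<dots> = of_real c * (\<Prod>i\<in>UNIV. \<Sum>\<^sub>\<infinity>m. cis (2 * pi * of_int m * (of_int (r i) / of_int (N i))) * hi i m)"
      unfolding theta prod.distrib c_def of_real_prod ..
    also have "(\<Prod>i\<in>UNIV. \<Sum>\<^sub>\<infinity>m. cis (2 * pi * of_int m * (of_int (r i) / of_int (N i))) * hi i m) =
       (\<Sum>\<^sub>\<infinity>m. \<Prod>i\<in>UNIV. cis (2 * pi * of_int (m i) * (of_int (r i) / of_int (N i))) * hi i (m i))"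
      by (rule infsum_prod_fun[OF hi_sum', symmetric])
    also have "\<dots> = (\<Sum>\<^sub>\<infinity>m. chi m r * h (emb m))"
      unfolding prod.distrib chi_prod h_prod ..
    finally show ?thesis .
  qed
  have chi_h: "(\<lambda>m. norm (chi m r * h (emb m))) summable_on UNIV" for r
    using h_UNIV by (simp add: norm_mult chi_def)
  have "(\<Sum>\<^sub>\<infinity>u\<in>\<Lambda>. g u) = (\<Sum>\<^sub>\<infinity>k\<in>K. g (emb k))"
    by (rule infsum_reindex_bij_betw[OF emb_bij, symmetric])
  also have "\<dots> = (\<Sum>\<^sub>\<infinity>(r, j)\<in>RK \<times> UNIV. g (emb (comb r j)))"
    using infsum_reindex_bij_betw[OF comb_bij, of "\<lambda>k. g (emb k)"] by (simp add: case_prod_unfold)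
  also have "\<dots> = (\<Sum>\<^sub>\<infinity>r\<in>RK. \<Sum>\<^sub>\<infinity>j. g (emb (comb r j)))"
    by (rule infsum_Sigma'_banach[symmetric])
       (use abs_summable_summable[OF gRK] in \<open>simp add: case_prod_unfold\<close>)
  also have "\<dots> = (\<Sum>r\<in>RK. of_real c * (\<Sum>\<^sub>\<infinity>m. chi m r * h (emb m)))"
    unfolding sum_r by (rule infsum_finite[OF finite_RK])
  also have "\<dots> = of_real c * (\<Sum>r\<in>RK. \<Sum>\<^sub>\<infinity>m. chi m r * h (emb m))" by (rule sum_distrib_left[symmetric])
  also have "(\<Sum>r\<in>RK. \<Sum>\<^sub>\<infinity>m. chi m r * h (emb m)) = (\<Sum>\<^sub>\<infinity>m. \<Sum>r\<in>RK. chi m r * h (emb m))"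
    by (rule infsum_sum[OF finite_RK, symmetric]) (rule abs_summable_summable[OF chi_h])
  also have "\<dots> = (\<Sum>\<^sub>\<infinity>m. if m \<in> K then of_nat (card RK) * h (emb m) else 0)"
    unfolding sum_distrib_right[symmetric] character_sum by (rule infsum_cong) simp
  also have "\<dots> = (\<Sum>\<^sub>\<infinity>m\<in>K. of_nat (card RK) * h (emb m))"
    by (rule infsum_cong_neutral) auto
  also have "\<dots> = of_nat (card RK) * (\<Sum>\<^sub>\<infinity>m\<in>K. h (emb m))" by (rule infsum_cmult_right')
  also have "(\<Sum>\<^sub>\<infinity>m\<in>K. h (emb m)) = (\<Sum>\<^sub>\<infinity>w\<in>\<Lambda>. h w)" by (rule infsum_reindex_bij_betw[OF emb_bij])
  finally show "(\<Sum>\<^sub>\<infinity>u\<in>\<Lambda>. g u) = of_real (real (card RK) * (\<Prod>i\<in>UNIV. 1 / sqrt (of_int (N i)))) * of_real ((1 / sqrt t) ^ CARD('n)) * (\<Sum>\<^sub>\<infinity>w\<in>\<Lambda>. h w)"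
    by (simp add: c mult_ac)
qed

end

context self_dual_lattice
begin

text \<open>The constant of \<open>lattice_sum_identity\<close> is the same for all t and y. At t =
  1 and y = 0 both sides are the same sum, which is at least 1 by its term at the origin, so the
  constant is 1.\<close>

theorem lattice_poisson:
  fixes t :: real and y :: "real ^ 'n"
  assumes t: "t > 0"
  shows "(\<lambda>u. exp (- pi * t * (u \<bullet> u))) summable_on \<Lambda>"
    and "(\<lambda>w. exp (- pi * ((w - y) \<bullet> (w - y)) / t)) summable_on \<Lambda>"
    and "(\<Sum>\<^sub>\<infinity>u\<in>\<Lambda>. exp (- pi * t * (u \<bullet> u)) * cis (2 * pi * (u \<bullet> y))) =
      of_real ((1 / sqrt t) ^ CARD('n)) * (\<Sum>\<^sub>\<infinity>w\<in>\<Lambda>. complex_of_real (exp (- pi * ((w - y) \<bullet> (w - y)) / t)))"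
proof -
  obtain v :: "'n \<Rightarrow> real ^ 'n" where v: "\<And>i. v i \<in> \<Lambda>" "\<And>i. v i \<noteq> 0" "\<And>i j. i \<noteq> j \<Longrightarrow> v i \<bullet> v j = 0"
  proof (rule orthogonal_frame)
    fix v :: "'n \<Rightarrow> real ^ 'n"
    assume a: "\<And>i. v i \<in> \<Lambda>" "\<And>i. v i \<noteq> 0" "\<And>i j. i \<noteq> j \<Longrightarrow> v i \<bullet> v j = 0"
    show thesis by (rule that[of v]) (fact a)+
  qed
  interpret framed_lattice \<Lambda> v by unfold_locales (fact v)+
  have s1: "(\<lambda>u. exp (- pi * t * (u \<bullet> u))) summable_on \<Lambda>" if "t > 0" for t
    using lattice_sum_identity(1)[OF that, of 0] by (simp add: norm_mult)
  from s1[OF t] show "(\<lambda>u. exp (- pi * t * (u \<bullet> u))) summable_on \<Lambda>" .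
  show s2: "(\<lambda>w. exp (- pi * ((w - y) \<bullet> (w - y)) / t)) summable_on \<Lambda>"
    using lattice_sum_identity(2)[OF t, of y] by simp
  define C where "C = real (card RK) * (\<Prod>i\<in>UNIV. 1 / sqrt (of_int (N i)))"
  define S where "S = (\<Sum>\<^sub>\<infinity>u\<in>\<Lambda>. exp (- pi * (u \<bullet> u)))"
  have "C = 1"
  proof -
    have s: "(\<lambda>u. exp (- pi * (u \<bullet> u))) summable_on \<Lambda>" using s1[of 1] by simp
    have "(\<Sum>\<^sub>\<infinity>u\<in>\<Lambda>. complex_of_real (exp (- pi * (u \<bullet> u)))) = of_real C * (\<Sum>\<^sub>\<infinity>u\<in>\<Lambda>. complex_of_real (exp (- pi * (u \<bullet> u))))"
      using lattice_sum_identity(3)[of 1 0] by (simp add: C_def)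
    moreover have "(\<Sum>\<^sub>\<infinity>u\<in>\<Lambda>. complex_of_real (exp (- pi * (u \<bullet> u)))) = of_real S"
      unfolding S_def by (rule infsumI, rule has_sum_of_real, rule has_sum_infsum, rule s)
    moreover have "S \<ge> 1"
    proof -
      have "(\<Sum>u\<in>{0 :: real ^ 'n}. exp (- pi * (u \<bullet> u))) \<le> S"
        unfolding S_def by (rule finite_sum_le_infsum) (use s zero in auto)
      then show ?thesis by simp
    qed
    ultimately have e: "complex_of_real S = complex_of_real (C * S)" and nz: "S \<noteq> 0" by auto
    from e have "S = C * S" by (rule of_real_eq_iff[THEN iffD1])
    with nz show ?thesis by simp
  qed
  then show "(\<Sum>\<^sub>\<infinity>u\<in>\<Lambda>. exp (- pi * t * (u \<bullet> u)) * cis (2 * pi * (u \<bullet> y))) =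
      of_real ((1 / sqrt t) ^ CARD('n)) * (\<Sum>\<^sub>\<infinity>w\<in>\<Lambda>. complex_of_real (exp (- pi * ((w - y) \<bullet> (w - y)) / t)))"
    using lattice_sum_identity(3)[OF t, of y] by (simp add: C_def)
qed

end

section \<open>Forms of low weight vanishing to second order\<close>

lemma three_le_pi: "3 \<le> pi"
proof -
  have "sin (pi / 6) \<le> pi / 6" by (rule sin_x_le_x) simp
  then show ?thesis by (simp add: sin_30)
qed

text \<open>The height 43/50 lies just below sqrt 3 / 2 = 0.866..., the lowest height in the
  fundamental domain. As 20 / 0.86 is still below 24, the crude estimate pi >= 3 is enough.\<close>

lemma eight_pi_gt: "20 / (43 / 50) < 8 * pi"
proof -
  have "20 / (43 / 50) < (24 :: real)" by simp
  also have "24 \<le> 8 * pi" using three_le_pi by simp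
  finally show ?thesis .
qed

text \<open>By 1 + x <= e^x the power grows at a rate of at most 20 / (43/50), slower than the
  exponential decays.\<close>

lemma power_exp_strict:
  fixes y :: real
  assumes y: "y > 43 / 50" and k: "k \<le> 20"
  shows "(y / (43 / 50)) ^ k * exp (- 8 * pi * (y - 43 / 50)) < 1"
proof -
  let ?c = "43 / 50 :: real"
  have "y / ?c = 1 + (y - ?c) / ?c" by (simp add: field_simps)
  also have "\<dots> \<le> exp ((y - ?c) / ?c)" by (rule exp_ge_add_one_self)
  finally have "(y / ?c) ^ k \<le> exp ((y - ?c) / ?c) ^ k"
    by (rule power_mono) (use y in simp)
  also have "\<dots> = exp (real k * ((y - ?c) / ?c))" by (rule exp_of_nat_mult[symmetric])
  also have "real k * ((y - ?c) / ?c) \<le> 20 * ((y - ?c) / ?c)"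
    using y k by (intro mult_right_mono) auto
  also have "20 * ((y - ?c) / ?c) = (20 / ?c) * (y - ?c)" by simp
  finally have 1: "(y / ?c) ^ k \<le> exp ((20 / ?c) * (y - ?c))" by simp
  have "(20 / ?c) * (y - ?c) < (8 * pi) * (y - ?c)"
    using y by (intro mult_strict_right_mono eight_pi_gt) simp
  then have "exp ((20 / ?c) * (y - ?c)) < exp ((8 * pi) * (y - ?c))" by simp
  with 1 have "(y / ?c) ^ k < exp ((8 * pi) * (y - ?c))" by (rule le_less_trans)
  then have "(y / ?c) ^ k * exp (- ((8 * pi) * (y - ?c))) < exp ((8 * pi) * (y - ?c)) * exp (- ((8 * pi) * (y - ?c)))"
    by (rule mult_strict_right_mono) simp
  then show ?thesis by (simp flip: exp_add)
qed

text \<open>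
  The weight \<open>|f|^2 y^k\<close> of a form vanishing to order two at the cusp attains its maximum over
  a half-plane \<open>y \<ge> c\<close>, \<open>c < sqrt 3 / 2\<close>, at a point with \<open>y > c\<close>: among the maximizers with
  \<open>|Re z| \<le> 1/2\<close> one of largest height has \<open>|z| \<ge> 1\<close>, as \<open>z \<mapsto> -1/z\<close> would raise it otherwise.  The
  maximum principle for \<open>f / q^2\<close>, applied in the disc bounded by the image of \<open>y = c\<close>, excludes this
  as long as \<open>k / c < 8 pi\<close>.
\<close>
locale low_weight_form =
  fixes a :: "nat \<Rightarrow> complex" and k :: nat
  assumes summable: "\<And>q. norm q < 1 \<Longrightarrow> summable (\<lambda>m. a m * q ^ m)"
    and a0: "a 0 = 0" and a1: "a 1 = 0" and k: "k \<le> 20"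
    and inv: "\<And>t. t > 0 \<Longrightarrow>
      (\<Sum>m. a m * of_real (exp (- 2 * pi / t)) ^ m) = (\<i> * of_real t) ^ k * (\<Sum>m. a m * of_real (exp (- 2 * pi * t)) ^ m)"
begin

definition F where "F q = (\<Sum>m. a m * q ^ m)"
definition G where "G q = (\<Sum>m. a (Suc (Suc m)) * q ^ m)"
definition nome :: "complex \<Rightarrow> complex" where "nome z = exp (2 * of_real pi * \<i> * z)"
definition f where "f z = F (nome z)"
definition wt where "wt z = (norm (f z))\<^sup>2 * Im z ^ k"

lemma F_G: "F q = q\<^sup>2 * G q" if "norm q < 1"
proof -
  note s = summable[OF that]
  note s1 = powser_split_head(3)[OF s]
  show ?thesis
    using powser_split_head(1)[OF s] powser_split_head(1)[OF s1] a0 a1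
    by (simp add: F_def G_def power2_eq_square)
qed

lemma F_hol: "F holomorphic_on ball 0 1"
  by (rule power_series_holomorphic[of _ _ a]) (simp add: F_def summable_sums summable)

lemma G_summable: "norm q < 1 \<Longrightarrow> summable (\<lambda>m. a (Suc (Suc m)) * q ^ m)"
  using powser_split_head(3)[OF powser_split_head(3)[OF summable]] by blast

lemma G_hol: "G holomorphic_on ball 0 1"
  by (rule power_series_holomorphic[of _ _ "\<lambda>m. a (Suc (Suc m))"])
     (simp add: G_def summable_sums G_summable)

lemma norm_nome: "norm (nome z) = exp (- 2 * pi * Im z)"
  by (simp add: nome_def)

lemma nome_lt_1: "Im z > 0 \<Longrightarrow> norm (nome z) < 1"
  by (simp add: norm_nome)

lemma f_hol: "f holomorphic_on {z. Im z > 0}"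
proof -
  have "nome holomorphic_on {z. Im z > 0}" unfolding nome_def by (intro holomorphic_intros)
  moreover have "nome ` {z. Im z > 0} \<subseteq> ball 0 1" using nome_lt_1 by auto
  ultimately have "(F \<circ> nome) holomorphic_on {z. Im z > 0}"
    by (rule holomorphic_on_compose_gen[OF _ F_hol])
  then show ?thesis by (simp add: o_def f_def[abs_def])
qed

lemma f_shift: "f (z + of_int n) = f z"
proof -
  have "nome (z + of_int n) = nome z * exp (2 * of_real pi * \<i> * of_int n)"
    by (simp add: nome_def exp_add[symmetric] algebra_simps)
  also have "exp (2 * of_real pi * \<i> * of_int n) = 1"
    using exp_integer_2pi[of "of_int n"] by (simp add: mult_ac)
  finally show ?thesis by (simp add: f_def)
qed

lemma Im_inverse_neg: "Im (- 1 / z) = Im z / (norm z)\<^sup>2"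
  by (simp add: Im_divide cmod_power2)

lemma upper_open: "open {z. Im z > 0}" and upper_convex: "convex {z. Im z > 0}"
  by (rule open_halfspace_Im_gt, rule convex_halfspace_Im_gt)

text \<open>The assumption \<open>inv\<close> is this law on the positive imaginary axis. Both sides
  are holomorphic in the upper half-plane, so the identity theorem extends it.\<close>

lemma f_inversion: "f (- 1 / z) = z ^ k * f z" if "Im z > 0"
proof -
  define H where "H = {z. Im z > 0}"
  define h where "h z = f (- 1 / z) - z ^ k * f z" for z
  define U where "U = (\<lambda>t. \<i> * of_real t) ` {0<..}"
  have H0: "z \<noteq> 0" if "z \<in> H" for z using that by (auto simp: H_def)
  have inv_hol: "(\<lambda>z. - 1 / z) holomorphic_on H" using H0 by (intro holomorphic_intros)
  have inv_im: "(\<lambda>z. - 1 / z) ` H \<subseteq> H"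
  proof (rule image_subsetI)
    fix z assume "z \<in> H"
    then show "- 1 / z \<in> H" using H0[of z] unfolding H_def mem_Collect_eq Im_inverse_neg by simp
  qed
  have "(f \<circ> (\<lambda>z. - 1 / z)) holomorphic_on H"
    by (rule holomorphic_on_compose_gen[OF inv_hol _ inv_im]) (use f_hol in \<open>simp add: H_def\<close>)
  then have h_hol: "h holomorphic_on H"
    unfolding h_def using f_hol by (intro holomorphic_intros) (auto simp: o_def H_def)
  have hU: "h z = 0" if zU: "z \<in> U" for z
  proof -
    obtain t where t: "t > 0" "z = \<i> * of_real t" using zU by (auto simp: U_def)
    have 1: "nome z = of_real (exp (- 2 * pi * t))"
    proof -
      have "2 * complex_of_real pi * \<i> * z = of_real (- 2 * pi * t)" by (simp add: t mult_ac)
      then show ?thesis unfolding nome_def by (simp only: exp_of_real)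
    qed
    have "- 1 / z = \<i> * of_real (1 / t)" using t by (simp add: field_simps)
    note e = this
    have 2: "nome (- 1 / z) = of_real (exp (- 2 * pi / t))"
    proof -
      have "2 * complex_of_real pi * \<i> * (- 1 / z) = of_real (- 2 * pi / t)" unfolding e by (simp add: mult_ac)
      then show ?thesis unfolding nome_def by (simp only: exp_of_real)
    qed
    show ?thesis using inv[OF t(1)] unfolding h_def f_def 1 2 F_def by (simp add: t)
  qed
  have lim: "\<i> islimpt U"
    unfolding islimpt_approachable
  proof (intro allI impI)
    fix e :: real assume e: "e > 0"
    have "\<i> * of_real (1 + e / 2) \<in> U" unfolding U_def by (rule imageI) (use e in simp)
    moreover have "\<i> * of_real (1 + e / 2) \<noteq> \<i>" using e by (simp add: complex_eq_iff)
    moreover have "dist (\<i> * of_real (1 + e / 2)) \<i> < e"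
    proof -
      have "\<i> * of_real (1 + e / 2) - \<i> = \<i> * of_real (e / 2)" by (simp add: algebra_simps)
      then have "norm (\<i> * of_real (1 + e / 2) - \<i>) = e / 2" using e by (simp only: norm_mult) simp
      then show ?thesis using e by (simp only: dist_norm)
    qed
    ultimately show "\<exists>x'\<in>U. x' \<noteq> \<i> \<and> dist x' \<i> < e" by blast
  qed
  have "h z = 0"
  proof (rule analytic_continuation[OF h_hol _ _ _ _ lim hU])
    show "open H" "connected H" using upper_open upper_convex by (simp_all add: H_def convex_connected)
    show "U \<subseteq> H" by (auto simp: U_def H_def)
    show "\<i> \<in> H" "z \<in> H" using that by (simp_all add: H_def)
  qed
  then show ?thesis by (simp add: h_def)
qed

lemma wt_shift: "wt (z + of_int n) = wt z"
  by (simp add: wt_def f_shift)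

lemma wt_inversion: "wt (- 1 / z) = wt z" if "Im z > 0"
proof -
  have z: "z \<noteq> 0" using that by auto
  have "wt (- 1 / z) = (norm z ^ k * norm (f z))\<^sup>2 * (Im z / (norm z)\<^sup>2) ^ k"
    unfolding wt_def f_inversion[OF that] Im_inverse_neg by (simp add: norm_mult norm_power)
  also have "\<dots> = wt z"
    using z by (simp add: wt_def power_mult_distrib power_divide power_mult[symmetric] mult.commute)
  finally show ?thesis .
qed

lemma wt_cont: "continuous_on {z. Im z > 0} wt"
  unfolding wt_def by (intro continuous_intros holomorphic_on_imp_continuous_on f_hol)

text \<open>The double zero at the cusp gives |f|^2 a factor e^(-8 pi y), which outweighs
  y^k.\<close>

lemma wt_decay:
  assumes "e > 0"
  shows "\<exists>Y. \<forall>z. Im z > Y \<longrightarrow> wt z < e"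
proof -
  have "continuous_on (cball 0 (1 / 2)) G"
    by (rule continuous_on_subset[OF holomorphic_on_imp_continuous_on[OF G_hol]]) auto
  then have "compact (G ` cball 0 (1 / 2))" by (rule compact_continuous_image) simp
  then have "bounded (G ` cball 0 (1 / 2))" by (rule compact_imp_bounded)
  then obtain B where B: "B > 0" "\<And>q. q \<in> cball 0 (1 / 2) \<Longrightarrow> norm (G q) \<le> B"
    unfolding bounded_pos by (auto simp only: ball_simps)
  have "((\<lambda>y. B\<^sup>2 * (y ^ k / exp y)) \<longlongrightarrow> B\<^sup>2 * 0) at_top"
    by (intro tendsto_intros tendsto_power_div_exp_0)
  then have "eventually (\<lambda>y. B\<^sup>2 * (y ^ k / exp y) < e) at_top"
    using assms by (simp add: order_tendsto_iff)
  then obtain Y where Y: "\<And>y. y \<ge> Y \<Longrightarrow> B\<^sup>2 * (y ^ k / exp y) < e"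
    by (auto simp: eventually_at_top_linorder)
  show ?thesis
  proof (intro exI[of _ "max Y 1"] allI impI)
    fix z assume z: "Im z > max Y 1"
    have pi_Im: "2 * pi * Im z \<ge> 1"
      using mult_mono[of 3 pi 1 "Im z"] three_le_pi z by simp
    then have "exp (- 2 * pi * Im z) \<le> exp (- 1)" by simp
    also have "exp (- 1 :: real) \<le> 1 / 2"
      using exp_ge_add_one_self[of "1::real"] by (simp add: exp_minus field_simps)
    finally have q: "nome z \<in> cball 0 (1 / 2)" by (simp add: norm_nome)
    have n: "(norm (nome z))\<^sup>2 * (norm (nome z))\<^sup>2 \<le> exp (- Im z)"
    proof -
      have "(norm (nome z))\<^sup>2 * (norm (nome z))\<^sup>2 = exp (- 8 * pi * Im z)"
        by (simp add: norm_nome power2_eq_square flip: exp_add)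
      also have "\<dots> \<le> exp (- Im z)"
        using mult_right_mono[of 3 pi "Im z"] three_le_pi z by simp
      finally show ?thesis .
    qed
    have "norm (f z) = (norm (nome z))\<^sup>2 * norm (G (nome z))"
      using q by (simp add: f_def F_G norm_mult norm_power)
    then have "(norm (f z))\<^sup>2 = ((norm (nome z))\<^sup>2 * (norm (nome z))\<^sup>2) * (norm (G (nome z)))\<^sup>2"
      by (simp add: power2_eq_square)
    also have "\<dots> \<le> exp (- Im z) * B\<^sup>2"
      using n B(2)[OF q] by (intro mult_mono power_mono) auto
    finally have "wt z \<le> exp (- Im z) * B\<^sup>2 * Im z ^ k"
      unfolding wt_def using z by (intro mult_right_mono) auto
    also have "\<dots> = B\<^sup>2 * (Im z ^ k / exp (Im z))" by (simp add: exp_minus divide_inverse)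
    also have "\<dots> < e" using z by (intro Y) auto
    finally show "wt z < e" .
  qed
qed

lemma strip_rep:
  obtains n :: int where "\<bar>Re (z + of_int n)\<bar> \<le> 1 / 2" 
proof
  show "\<bar>Re (z + of_int (- round (Re z)))\<bar> \<le> 1 / 2"
    using of_int_round_abs_le[of "Re z"] by (simp add: abs_minus_commute)
qed

lemma f_zero_half_plane:
  assumes "Im z1 \<ge> 43 / 50"
  shows "f z1 = 0"
proof (rule ccontr)
  assume "f z1 \<noteq> 0"
  then have pos: "wt z1 > 0" using assms by (simp add: wt_def)
  obtain Y where Y: "\<And>z. Im z > Y \<Longrightarrow> wt z < wt z1" using wt_decay[OF pos] by blast
  \<comment> \<open>Integer translations reduce to a strip and the decay bounds the height, so the
    supremum over the half-plane is attained on this rectangle.\<close>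
  define K where "K = {z. \<bar>Re z\<bar> \<le> 1 / 2 \<and> 43 / 50 \<le> Im z \<and> Im z \<le> Y}"
  have Kbox: "K = cbox (Complex (- 1 / 2) (43 / 50)) (Complex (1 / 2) Y)"
    by (auto simp: K_def in_cbox_complex_iff abs_le_iff)
  have Kc: "compact K" unfolding Kbox by (rule compact_cbox)
  have Kcont: "continuous_on K wt"
    by (rule continuous_on_subset[OF wt_cont]) (auto simp: K_def)
  obtain n where n: "\<bar>Re (z1 + of_int n)\<bar> \<le> 1 / 2" by (rule strip_rep)
  have "\<not> Im z1 > Y" using Y[of z1] by auto
  then have zK: "z1 + of_int n \<in> K" using n assms by (simp add: K_def)
  then have "K \<noteq> {}" by blast
  from continuous_attains_sup[OF Kc this Kcont]
  obtain zm where zm: "zm \<in> K" "\<And>z. z \<in> K \<Longrightarrow> wt z \<le> wt zm" by blast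
  define M where "M = wt zm"
  have M1: "wt z1 \<le> M" using zm(2)[OF zK] by (simp add: wt_shift M_def)
  have sup: "wt z \<le> M" if z: "Im z \<ge> 43 / 50" for z
  proof (cases "Im z > Y")
    case True
    then show ?thesis using Y[of z] M1 by simp
  next
    case False
    obtain n where n: "\<bar>Re (z + of_int n)\<bar> \<le> 1 / 2" by (rule strip_rep)
    then have "z + of_int n \<in> K" using z False by (simp add: K_def)
    from zm(2)[OF this] show ?thesis by (simp add: wt_shift M_def)
  qed
  define X where "X = {z \<in> K. wt z = M}"
  have "X = K \<inter> wt -` {M}" by (auto simp: X_def)
  moreover have "closed (K \<inter> wt -` {M})"
    by (rule continuous_closed_preimage[OF Kcont compact_imp_closed[OF Kc]]) simp
  ultimately have "closed X" by simp
  then have "compact (K \<inter> X)" by (rule compact_Int_closed[OF Kc])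
  moreover have "K \<inter> X = X" by (auto simp: X_def)
  ultimately have Xc: "compact X" by simp
  have "X \<noteq> {}" using zm(1) by (auto simp: X_def M_def)
  moreover have "continuous_on X Im" by (intro continuous_intros)
  ultimately obtain z0 where z0: "z0 \<in> X" "\<And>z. z \<in> X \<Longrightarrow> Im z \<le> Im z0"
    using continuous_attains_sup[OF Xc] by blast
  have z0K: "\<bar>Re z0\<bar> \<le> 1 / 2" "43 / 50 \<le> Im z0" "wt z0 = M" using z0(1) by (auto simp: X_def K_def)
  have "norm z0 \<ge> 1"
  proof (rule ccontr)
    assume "\<not> norm z0 \<ge> 1"
    then have lt: "norm z0 < 1" by simp
    have gt: "norm z0 > 0" using z0K(2) by auto
    have n2: "0 < (norm z0)\<^sup>2" "(norm z0)\<^sup>2 < 1"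
      using gt mult_strict_mono[OF lt lt] by (simp_all add: power2_eq_square)
    define w where "w = - 1 / z0"
    have "Im z0 < Im z0 / (norm z0)\<^sup>2" using n2 z0K(2) by (simp add: field_simps)
    then have w: "Im w > Im z0" unfolding w_def Im_inverse_neg .
    have wtw: "wt w = M" unfolding w_def using wt_inversion[of z0] z0K by simp
    obtain n where n: "\<bar>Re (w + of_int n)\<bar> \<le> 1 / 2" by (rule strip_rep)
    have "\<not> Im w > Y" using Y[of w] wtw M1 by auto
    then have "w + of_int n \<in> X" using n w z0K wtw by (simp add: X_def K_def wt_shift)
    from z0(2)[OF this] w show False by simp
  qed
  \<comment> \<open>With |Re z0| <= 1/2 this makes the square of Im z0 at least 3/4, which exceeds
    (43/50)^2: the maximum is attained strictly above the boundary line.\<close>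
  then have "1 \<le> (norm z0)\<^sup>2" by (rule one_le_power)
  then have "1 \<le> (Re z0)\<^sup>2 + (Im z0)\<^sup>2" unfolding cmod_power2 .
  moreover have "(Re z0)\<^sup>2 \<le> (1 / 2)\<^sup>2"
    by (rule abs_le_square_iff[THEN iffD1]) (use z0K(1) in simp)
  moreover have "(1 / 2 :: real)\<^sup>2 = 1 / 4" "(43 / 50 :: real)\<^sup>2 < 3 / 4"
    by (simp_all add: power2_eq_square)
  ultimately have "(43 / 50)\<^sup>2 < (Im z0)\<^sup>2" by linarith
  then have y0: "Im z0 > 43 / 50" by (rule power2_less_imp_less) (use z0K(2) in linarith)
  have M: "M > 0" using M1 pos by simp
  define c where "c = (43 / 50 :: real)"
  define r where "r = exp (- 2 * pi * c)"
  have r: "0 < r" "r < 1" by (simp_all add: r_def c_def)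
  \<comment> \<open>The line Im z = c maps to the circle of radius \<open>r\<close> in the nome.
    There |F|^2 is at most M / c^k, and division by q^2 gives this bound for \<open>G\<close>, which
    the maximum principle carries inside.\<close>
  define B where "B = sqrt (M / c ^ k) / r\<^sup>2"
  have le: "norm (G q) \<le> B" if q: "norm q = r" for q
  proof -
    have q0: "q \<noteq> 0" using q r by auto
    define z where "z = Ln q / (2 * of_real pi * \<i>)"
    have nz: "nome z = q" using q0 by (simp add: nome_def z_def)
    have "exp (- 2 * pi * Im z) = exp (- 2 * pi * c)" using q unfolding nz[symmetric] norm_nome r_def .
    then have Imz: "Im z = c" by simp
    have "(norm (f z))\<^sup>2 * c ^ k \<le> M" using sup[of z] Imz by (simp add: wt_def c_def)
    then have "(norm (f z))\<^sup>2 \<le> M / c ^ k" by (simp add: c_def field_simps)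
    then have fz: "norm (f z) \<le> sqrt (M / c ^ k)" by (rule real_le_rsqrt)
    have "norm (f z) = r\<^sup>2 * norm (G q)"
      using q r by (simp add: f_def nz F_G norm_mult norm_power)
    with fz show ?thesis using r by (simp add: B_def field_simps)
  qed
  have Gn: "norm (G (nome z0)) \<le> B"
  proof (rule maximum_modulus_frontier[of G "ball 0 r"])
    show "G holomorphic_on interior (ball 0 r)"
      using r by (intro holomorphic_on_subset[OF G_hol]) auto
    show "continuous_on (closure (ball 0 r)) G"
      using r by (intro continuous_on_subset[OF holomorphic_on_imp_continuous_on[OF G_hol]]) auto
    show "norm (G z) \<le> B" if "z \<in> frontier (ball 0 r)" for z
      using that r le[of z] by simp
    show "nome z0 \<in> ball 0 r" using y0 by (simp add: norm_nome r_def c_def)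
  qed simp
  have "norm (f z0) = (norm (nome z0))\<^sup>2 * norm (G (nome z0))"
    using nome_lt_1[of z0] y0 by (simp add: f_def F_G norm_mult norm_power)
  also have "\<dots> \<le> (norm (nome z0))\<^sup>2 * B" using Gn by (rule mult_left_mono) simp
  finally have "(norm (f z0))\<^sup>2 \<le> ((norm (nome z0))\<^sup>2 * B)\<^sup>2" by (rule power_mono) simp
  also have "\<dots> = ((norm (nome z0))\<^sup>2 / r\<^sup>2)\<^sup>2 * (M / c ^ k)"
    using M by (simp add: B_def power_mult_distrib power_divide c_def)
  also have "(norm (nome z0))\<^sup>2 / r\<^sup>2 = exp (- 4 * pi * (Im z0 - c))"
    unfolding norm_nome r_def exp_double[symmetric] exp_diff[symmetric]
    by (rule arg_cong[of _ _ exp]) (simp add: algebra_simps)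
  also have "\<dots>\<^sup>2 = exp (- 8 * pi * (Im z0 - c))"
    unfolding exp_double[symmetric] by (rule arg_cong[of _ _ exp]) simp
  finally have f0: "(norm (f z0))\<^sup>2 \<le> exp (- 8 * pi * (Im z0 - c)) * (M / c ^ k)" .
  have "M = (norm (f z0))\<^sup>2 * Im z0 ^ k" using z0K(3) by (simp add: wt_def)
  also have "\<dots> \<le> exp (- 8 * pi * (Im z0 - c)) * (M / c ^ k) * Im z0 ^ k"
    using f0 z0K(2) by (intro mult_right_mono) auto
  \<comment> \<open>The comparison with the boundary circle leaves a factor below 1, so M <
    M.\<close>
  also have "\<dots> = M * ((Im z0 / c) ^ k * exp (- 8 * pi * (Im z0 - c)))"
    by (simp add: power_divide)
  also have "\<dots> < M * 1"
    using power_exp_strict[OF y0 k] M by (intro mult_strict_left_mono) (simp_all add: c_def)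
  finally show False by simp
qed

text \<open>\<open>F\<close> vanishes on a punctured disc, being \<open>f\<close> read in the nome.
  A power series with zero constant term and some nonzero coefficient has 0 as an isolated
  zero.\<close>

theorem coeff_zero: "a m = 0"
proof (rule ccontr)
  assume m: "a m \<noteq> 0"
  then have "m > 0" using a0 by (cases m) auto
  define r where "r = exp (- 2 * pi * (43 / 50))"
  have z: "F q = 0" if "norm q \<le> r" "q \<noteq> 0" for q
  proof -
    define z where "z = Ln q / (2 * of_real pi * \<i>)"
    have nz: "nome z = q" using that by (simp add: nome_def z_def)
    have "exp (- 2 * pi * Im z) \<le> exp (- 2 * pi * (43 / 50))"
      using that(1) unfolding nz[symmetric] norm_nome r_def .
    then have "Im z \<ge> 43 / 50" by simp
    from f_zero_half_plane[OF this] show ?thesis by (simp add: f_def nz)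
  qed
  have F0: "F 0 = 0" by (simp add: F_def a0)
  obtain s where s: "0 < s" "\<And>z. z \<in> cball 0 s - {0} \<Longrightarrow> F z \<noteq> 0"
  proof (rule powser_0_nonzero[of 1 0 a F m])
    show "(\<lambda>n. a n * (x - 0) ^ n) sums F x" if "norm (x - 0) < 1" for x
      using that by (simp add: F_def summable_sums summable)
  qed (use m \<open>m > 0\<close> F0 in auto)
  define t where "t = min s r"
  have t: "t > 0" using s by (simp add: t_def r_def)
  have "F (of_real t) \<noteq> 0" using t by (intro s(2)) (auto simp: t_def)
  moreover have "F (of_real t) = 0" using t by (intro z) (auto simp: t_def)
  ultimately show False by simp
qed

end

section \<open>Moments of spheres and designs\<close>

text \<open>These are low coefficients in s of |a + s b|^(2m), a power of a quadratic polynomial in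
  s. They turn moments in single directions into mixed moments; the case of linear term 0 is that of
  orthogonal a and b.\<close>

lemma coeff_quadratic_power:
  fixes A p B :: real
  shows "coeff ([:A, p, B:] ^ m) 0 = A ^ m"
    and "coeff ([:1, p, B:] ^ m) (Suc 0) = real m * p"
    and "coeff ([:1, p, B:] ^ m) 2 = real m * B + real m * (real m - 1) / 2 * p\<^sup>2"
    and "coeff ([:A, 0, B:] ^ Suc m) 2 = real (Suc m) * A ^ m * B"
proof -
  have c: "coeff ([:a, b, c:] * q) 0 = a * coeff q 0"
    "coeff ([:a, b, c:] * q) (Suc 0) = a * coeff q (Suc 0) + b * coeff q 0"
    "coeff ([:a, b, c:] * q) 2 = a * coeff q 2 + b * coeff q (Suc 0) + c * coeff q 0" for a b c :: real and q
    by (simp_all add: coeff_pCons numeral_2_eq_2 split: nat.splits)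
  show 0: "coeff ([:A, p, B:] ^ m) 0 = A ^ m" for A p B :: real and m by (induction m) (simp_all add: c)
  show 1: "coeff ([:1, p, B:] ^ m) (Suc 0) = real m * p" for m
    by (induction m) (simp_all add: c 0 algebra_simps)
  show "coeff ([:1, p, B:] ^ m) 2 = real m * B + real m * (real m - 1) / 2 * p\<^sup>2"
  proof (induction m)
    case (Suc m)
    show ?case by (simp only: power_Suc c 0 1 Suc.IH) (simp add: field_simps power2_eq_square)
  qed simp
  have z: "coeff ([:A, 0, B:] ^ m) (Suc 0) = 0" for m
    by (induction m) (simp_all add: c)
  show "coeff ([:A, 0, B:] ^ Suc m) 2 = real (Suc m) * A ^ m * B"
  proof (induction m)
    case (Suc m)
    show ?case by (simp only: power_Suc[of _ "Suc m"] c 0 z Suc.IH) (simp add: field_simps)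
  qed (simp add: numeral_2_eq_2)
qed

lemma coeff_even_power_odd:
  fixes A B :: real
  assumes "odd j"
  shows "coeff ([:A, 0, B:] ^ m) j = 0"
  using assms
proof (induction m arbitrary: j)
  case (Suc m)
  have "coeff ([:A, 0, B:] * q) j = A * coeff q j + (if j < 2 then 0 else B * coeff q (j - 2))" for q :: "real poly"
    using Suc.prems by (cases j; cases "j - 1") (auto simp: coeff_pCons split: nat.splits)
  then show ?case using Suc.IH[of j] Suc.IH[of "j - 2"] Suc.prems by auto
qed (auto simp: odd_pos)

text \<open>
  Both averages over the sphere and sums over a finite set of vectors of equal length are such
  functionals \<open>J\<close>; the moments of either are treated simultaneously.
\<close>
locale radial_functional =
  fixes J :: "(real ^ 'n \<Rightarrow> real) \<Rightarrow> real" and R :: real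
  assumes add: "continuous_on UNIV f \<Longrightarrow> continuous_on UNIV g \<Longrightarrow> J (\<lambda>u. f u + g u) = J f + J g"
    and scale: "continuous_on UNIV f \<Longrightarrow> J (\<lambda>u. c * f u) = c * J f"
    and radius: "continuous_on UNIV f \<Longrightarrow> J (\<lambda>u. (u \<bullet> u) * f u) = R * J f"
begin

lemma linear:
  assumes "finite I" "\<And>i. i \<in> I \<Longrightarrow> continuous_on UNIV (g i)"
  shows "J (\<lambda>u. \<Sum>i\<in>I. c i * g i u) = (\<Sum>i\<in>I. c i * J (g i))"
  using assms
proof (induction I rule: finite_induct)
  case empty
  show ?case using scale[of "\<lambda>_. 0" 0] by simp
next
  case (insert i I)
  have "J (\<lambda>u. c i * g i u + (\<Sum>i\<in>I. c i * g i u)) = J (\<lambda>u. c i * g i u) + J (\<lambda>u. \<Sum>i\<in>I. c i * g i u)"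
    using insert.prems by (intro add) (auto intro!: continuous_intros)
  with insert show ?case by (simp add: scale)
qed

text \<open>Polarization: evaluate the moment at x = s b + a and compare the coefficients of
  s^j.\<close>

lemma mixed_moment:
  assumes p: "\<And>x. J (\<lambda>u. (u \<bullet> x) ^ (2 * m)) = c * norm x ^ (2 * m)" and j: "j \<le> 2 * m"
  shows "real (2 * m choose j) * J (\<lambda>u. (u \<bullet> b) ^ j * (u \<bullet> a) ^ (2 * m - j)) = c * coeff ([:a \<bullet> a, 2 * (a \<bullet> b), b \<bullet> b:] ^ m) j"
proof -
  define Q where "Q = (\<Sum>j\<le>2 * m. monom (real (2 * m choose j) * J (\<lambda>u. (u \<bullet> b) ^ j * (u \<bullet> a) ^ (2 * m - j))) j)"
  have "poly Q s = poly (smult c ([:a \<bullet> a, 2 * (a \<bullet> b), b \<bullet> b:] ^ m)) s" for s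
  proof -
    have "poly Q s = (\<Sum>j\<le>2 * m. (real (2 * m choose j) * s ^ j) * J (\<lambda>u. (u \<bullet> b) ^ j * (u \<bullet> a) ^ (2 * m - j)))"
      by (simp add: Q_def poly_sum poly_monom mult_ac)
    also have "\<dots> = J (\<lambda>u. \<Sum>j\<le>2 * m. (real (2 * m choose j) * s ^ j) * ((u \<bullet> b) ^ j * (u \<bullet> a) ^ (2 * m - j)))"
      by (rule linear[symmetric]) (auto intro!: continuous_intros)
    also have "(\<lambda>u. \<Sum>j\<le>2 * m. (real (2 * m choose j) * s ^ j) * ((u \<bullet> b) ^ j * (u \<bullet> a) ^ (2 * m - j))) = (\<lambda>u. (u \<bullet> (s *\<^sub>R b + a)) ^ (2 * m))"
      by (rule ext) (simp add: inner_add_right binomial_ring power_mult_distrib mult_ac)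
    also have "J \<dots> = c * norm (s *\<^sub>R b + a) ^ (2 * m)" by (rule p)
    also have "norm (s *\<^sub>R b + a) ^ (2 * m) = poly [:a \<bullet> a, 2 * (a \<bullet> b), b \<bullet> b:] s ^ m"
      unfolding power_mult power2_norm_eq_inner by (simp add: inner_add_left inner_add_right inner_commute algebra_simps)
    finally show ?thesis by (simp add: poly_power)
  qed
  then have "Q = smult c ([:a \<bullet> a, 2 * (a \<bullet> b), b \<bullet> b:] ^ m)" by (simp add: poly_eq_poly_eq_iff[symmetric] fun_eq_iff)
  from arg_cong[OF this, of "\<lambda>q. coeff q j"] show ?thesis
    using j by (simp add: Q_def coeff_sum)
qed

text \<open>Let \<open>b\<close> run through the coordinate axes in the mixed moments of second
  order in \<open>b\<close>. Their sum contains the factor u.u, which \<open>radius\<close> replaces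
  by \<open>R\<close>.\<close>

lemma moment_recursion:
  assumes p: "\<And>x. J (\<lambda>u. (u \<bullet> x) ^ (2 * Suc e)) = c * norm x ^ (2 * Suc e)"
    and q: "\<And>x. J (\<lambda>u. (u \<bullet> x) ^ (2 * e)) = c' * norm x ^ (2 * e)"
  shows "c * (CARD('n) + 2 * e) = R * (2 * e + 1) * c'"
proof -
  define a where "a = (axis undefined 1 :: real ^ 'n)"
  have a: "norm a = 1" "a \<bullet> a = 1" by (simp_all add: a_def norm_axis_1 inner_axis_axis)
  have ch: "real (2 * Suc e choose 2) = (real e + 1) * (2 * real e + 1)"
    unfolding choose_two by (simp add: real_of_nat_div) (simp add: field_simps)
  have m2: "((real e + 1) * (2 * real e + 1)) * J (\<lambda>u. (u $ i)\<^sup>2 * (u \<bullet> a) ^ (2 * e)) = c * ((real e + 1) + (real e + 1) * real e * 2 * (a $ i)\<^sup>2)" for i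
  proof -
    have "(real (2 * Suc e choose 2)) * J (\<lambda>u. (u \<bullet> axis i 1) ^ 2 * (u \<bullet> a) ^ (2 * Suc e - 2)) = c * coeff ([:1, 2 * (a \<bullet> axis i 1), 1:] ^ Suc e) 2"
      using mixed_moment[OF p, of 2 "axis i 1" a] by (simp add: a inner_axis_axis)
    also have "coeff ([:1, 2 * (a \<bullet> axis i 1), 1:] ^ Suc e) 2 = (real e + 1) + (real e + 1) * real e * 2 * (a $ i)\<^sup>2"
      unfolding coeff_quadratic_power(3) by (simp add: inner_axis field_simps power2_eq_square)
    finally show ?thesis unfolding ch by (simp add: inner_axis)
  qed
  have "((real e + 1) * (2 * real e + 1)) * (R * c') = ((real e + 1) * (2 * real e + 1)) * J (\<lambda>u. (u \<bullet> u) * (u \<bullet> a) ^ (2 * e))"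
    by (subst radius) (auto intro!: continuous_intros simp: q a)
  also have "(\<lambda>u. (u \<bullet> u) * (u \<bullet> a) ^ (2 * e)) = (\<lambda>u. \<Sum>i\<in>UNIV. 1 * ((u $ i)\<^sup>2 * (u \<bullet> a) ^ (2 * e)))"
    by (rule ext) (simp add: inner_vec_def power2_eq_square sum_distrib_right)
  also have "J \<dots> = (\<Sum>i\<in>UNIV. 1 * J (\<lambda>u. (u $ i)\<^sup>2 * (u \<bullet> a) ^ (2 * e)))"
    by (rule linear) (auto intro!: continuous_intros)
  also have "((real e + 1) * (2 * real e + 1)) * \<dots> = (\<Sum>i\<in>UNIV. c * ((real e + 1) + (real e + 1) * real e * 2 * (a $ i)\<^sup>2))"
    by (simp add: sum_distrib_left m2)
  also have "\<dots> = c * ((real e + 1) * CARD('n) + (real e + 1) * real e * 2 * (\<Sum>i\<in>UNIV. (a $ i)\<^sup>2))"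
    by (simp add: sum.distrib sum_distrib_left distrib_left mult_ac)
  also have "(\<Sum>i\<in>UNIV. (a $ i)\<^sup>2) = 1"
    using a(2) by (simp add: inner_vec_def power2_eq_square)
  finally have "(real e + 1) * ((2 * real e + 1) * (R * c')) = (real e + 1) * (c * (CARD('n) + 2 * real e))"
    by (simp add: algebra_simps)
  then have "(2 * real e + 1) * (R * c') = c * (CARD('n) + 2 * real e)"
    by (rule mult_left_cancel[THEN iffD1, rotated]) simp
  then show ?thesis by (simp add: algebra_simps)
qed

end

section \<open>Surface measure: rotation invariance and moments\<close>

abbreviation ball_measure :: "(real ^ 'n) measure" where
  "ball_measure \<equiv> uniform_measure lborel (ball 0 1)"

lemma emeasure_unit_ball: "emeasure lborel (ball 0 1 :: (real ^ 'n) set) \<noteq> 0" "emeasure lborel (ball 0 1 :: (real ^ 'n) set) \<noteq> \<infinity>"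
proof -
  show f: "emeasure lborel (ball 0 1 :: (real ^ 'n) set) \<noteq> \<infinity>"
    using emeasure_lborel_ball_finite[of "0 :: real ^ 'n" 1] by simp
  have "measure lborel (ball 0 1 :: (real ^ 'n) set) > 0"
    using content_ball_pos[of 1 "0 :: real ^ 'n"] by simp
  then show "emeasure lborel (ball 0 1 :: (real ^ 'n) set) \<noteq> 0"
    by (auto simp: measure_def)
qed

lemma prob_space_ball_measure: "prob_space (ball_measure :: (real ^ 'n) measure)"
  by (rule prob_space_uniform_measure) (use emeasure_unit_ball in auto)

lemma sets_ball_measure [measurable_cong]: "sets (ball_measure :: (real ^ 'n) measure) = sets borel"
  by simp

lemma integral_sphere:
  fixes h :: "real ^ 'n \<Rightarrow> real"
  assumes "continuous_on UNIV h"
  shows "integrable sphere_measure h" and "(\<integral>x. h x \<partial>sphere_measure) = (\<integral>x. h (sgn x) \<partial>ball_measure)"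
proof -
  have [measurable]: "h \<in> borel_measurable borel" using assms by (rule borel_measurable_continuous_onI)
  have sg: "sgn \<in> measurable ball_measure (borel :: (real ^ 'n) measure)" by measurable
  show "(\<integral>x. h x \<partial>sphere_measure) = (\<integral>x. h (sgn x) \<partial>ball_measure)"
    unfolding sphere_measure_def by (rule integral_distr[OF sg]) measurable
  have "compact (h ` cball 0 1)"
    by (intro compact_continuous_image continuous_on_subset[OF assms]) auto
  then have "bounded (h ` cball 0 1)" by (rule compact_imp_bounded)
  then obtain B where B: "\<And>x. x \<in> cball 0 1 \<Longrightarrow> norm (h x) \<le> B"
    unfolding bounded_iff by (auto simp only: ball_simps)
  interpret prob_space "ball_measure :: (real ^ 'n) measure" by (rule prob_space_ball_measure)
  have "integrable ball_measure (\<lambda>x. h (sgn x))"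
  proof (rule integrable_const_bound)
    show "AE x in ball_measure. norm (h (sgn x)) \<le> B"
      by (rule AE_I2) (rule B, simp add: norm_sgn)
  qed measurable
  then show "integrable sphere_measure h"
    unfolding sphere_measure_def by (subst integrable_distr_eq[OF sg]) measurable
qed

lemma prob_space_sphere_measure: "prob_space (sphere_measure :: (real ^ 'n) measure)"
proof -
  interpret prob_space "ball_measure :: (real ^ 'n) measure" by (rule prob_space_ball_measure)
  show ?thesis unfolding sphere_measure_def by (rule prob_space_distr) measurable
qed

lemma AE_sphere: "AE x in (sphere_measure :: (real ^ 'n) measure). norm x = 1"
proof -
  have "AE x in (lborel :: (real ^ 'n) measure). x \<noteq> 0" by (rule AE_lborel_singleton)
  then have "AE x in (lborel :: (real ^ 'n) measure). x \<in> ball 0 1 \<longrightarrow> norm (sgn x) = 1"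
    by eventually_elim (simp add: norm_sgn)
  then have "AE x in (ball_measure :: (real ^ 'n) measure). norm (sgn x) = 1"
    by (intro AE_uniform_measureI) auto
  then show ?thesis
    unfolding sphere_measure_def by (subst AE_distr_iff) auto
qed

lemma ball_measure_orthogonal:
  fixes f :: "real ^ 'n::{finite,wellorder} \<Rightarrow> real ^ 'n::_"
  assumes f: "orthogonal_transformation f"
  shows "distr ball_measure borel f = ball_measure"
proof (rule measure_eqI)
  have lin: "linear f" and nf: "norm (f x) = norm x" for x
    using f by (auto simp: orthogonal_transformation)
  have fc: "continuous_on UNIV f" using lin by (simp add: linear_continuous_on linear_linear)
  then have [measurable]: "f \<in> borel_measurable borel" by (rule borel_measurable_continuous_onI)
  have surj: "surj f" using f orthogonal_transformation_surj by blast
  fix A assume "A \<in> sets (distr ball_measure borel f)"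
  then have A[measurable]: "A \<in> sets borel" by simp
  define B where "B = ball 0 1 \<inter> A"
  define S where "S = ball 0 1 \<inter> f -` A"
  have fS: "f ` S = B"
  proof
    show "f ` S \<subseteq> B" by (auto simp: S_def B_def nf)
    show "B \<subseteq> f ` S"
    proof
      fix y assume y: "y \<in> B"
      obtain x where "y = f x" using surj by (rule surjE)
      then show "y \<in> f ` S" using y nf[of x] by (auto simp: B_def S_def)
    qed
  qed
  have vS: "f -` A \<in> sets borel" using measurable_sets[of f borel borel A] by simp
  have Ss: "S \<in> sets borel" "B \<in> sets borel" using vS A by (auto simp: S_def B_def)
  have bd: "bounded S" "bounded B" unfolding S_def B_def by (auto intro: bounded_subset[OF bounded_ball])
  have lm: "S \<in> lmeasurable" "B \<in> lmeasurable"
    using Ss bd by (auto intro!: bounded_set_imp_lmeasurable sets_completionI_sets)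
  have "measure lebesgue B = measure lebesgue S"
    using measure_orthogonal_image[OF f lm(1)] by (simp add: fS)
  then have "emeasure lebesgue B = emeasure lebesgue S"
    using lm by (simp add: emeasure_eq_measure2)
  then have "emeasure lborel B = emeasure lborel S" using Ss by simp
  then show "emeasure (distr ball_measure borel f) A = emeasure ball_measure A"
    using A vS by (simp add: emeasure_distr emeasure_uniform_measure B_def S_def)
qed simp

lemma integral_sphere_orthogonal:
  fixes f :: "real ^ 'n::{finite,wellorder} \<Rightarrow> real ^ 'n::_"
    and h :: "(real, 'n) vec \<Rightarrow> real"
  assumes f: "orthogonal_transformation f" and h: "continuous_on UNIV h"
  shows "(\<integral>x. h (f x) \<partial>sphere_measure) = (\<integral>x. h x \<partial>sphere_measure)"
proof -
  have lin: "linear f" and nf: "norm (f x) = norm x" for x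
    using f by (auto simp: orthogonal_transformation)
  have fc: "continuous_on UNIV f" using lin by (simp add: linear_continuous_on linear_linear)
  then have fm[measurable]: "f \<in> borel_measurable borel" by (rule borel_measurable_continuous_onI)
  have hm[measurable]: "h \<in> borel_measurable borel" using h by (rule borel_measurable_continuous_onI)
  have sf: "f (sgn x) = sgn (f x)" for x
    by (simp add: sgn_div_norm nf linear_scale[OF lin])
  have "continuous_on UNIV (\<lambda>x. h (f x))" by (rule continuous_on_compose2[OF h fc]) simp
  then have "(\<integral>x. h (f x) \<partial>sphere_measure) = (\<integral>x. h (f (sgn x)) \<partial>ball_measure)"
    using integral_sphere(2)[of "\<lambda>x. h (f x)"] by simp
  also have "\<dots> = (\<integral>x. h (sgn x) \<partial>distr ball_measure borel f)"
    unfolding sf by (rule integral_distr[symmetric]) measurable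
  also have "\<dots> = (\<integral>x. h x \<partial>sphere_measure)"
    unfolding ball_measure_orthogonal[OF f] integral_sphere(2)[OF h] ..
  finally show ?thesis .
qed

lemma sphere_moment_scale:
  fixes x y :: "real ^ 'n::{finite,wellorder}"
  assumes "norm x = norm y"
  shows "(\<integral>u. (u \<bullet> x) ^ j \<partial>sphere_measure) = (\<integral>u. (u \<bullet> y) ^ j \<partial>sphere_measure)"
proof -
  obtain f :: "(real, 'n) vec \<Rightarrow> (real, 'n) vec" where f: "orthogonal_transformation f" "f x = y"
    using orthogonal_transformation_exists[OF assms] .
  have "(\<integral>u. (u \<bullet> y) ^ j \<partial>sphere_measure) = (\<integral>u. (f u \<bullet> f x) ^ j \<partial>sphere_measure)"
    using integral_sphere_orthogonal[OF f(1), of "\<lambda>u. (u \<bullet> y) ^ j"] by (simp add: f(2) continuous_intros)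
  also have "\<dots> = (\<integral>u. (u \<bullet> x) ^ j \<partial>sphere_measure)"
    using f(1) by (simp add: orthogonal_transformation_def)
  finally show ?thesis by simp
qed

text \<open>The axis is arbitrary: by rotation invariance any unit vector gives the same
  value.\<close>

definition sphere_moment :: "'n::finite itself \<Rightarrow> nat \<Rightarrow> real" where
  "sphere_moment _ j = (\<integral>u. (u \<bullet> (axis undefined 1 :: real ^ 'n)) ^ j \<partial>sphere_measure)"

lemma sphere_moment:
  fixes x :: "real ^ 'n::{finite,wellorder}"
  shows "(\<integral>u. (u \<bullet> x) ^ j \<partial>sphere_measure) = sphere_moment TYPE('n) j * norm x ^ j"
proof -
  let ?e = "axis undefined 1 :: (real, 'n) vec"
  have "norm x = norm (norm x *\<^sub>R ?e)" by simp
  then have "(\<integral>u. (u \<bullet> x) ^ j \<partial>sphere_measure) = (\<integral>u. (u \<bullet> (norm x *\<^sub>R ?e)) ^ j \<partial>sphere_measure)"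
    by (rule sphere_moment_scale)
  also have "\<dots> = (\<integral>u. norm x ^ j * (u \<bullet> ?e) ^ j \<partial>sphere_measure)"
    by (simp add: power_mult_distrib)
  also have "\<dots> = norm x ^ j * (\<integral>u. (u \<bullet> ?e) ^ j \<partial>sphere_measure)"
    by (rule integral_mult_right_zero)
  finally show ?thesis by (simp add: sphere_moment_def)
qed

lemma radial_functional_sphere:
  "radial_functional (\<lambda>h :: real ^ 'n \<Rightarrow> real. \<integral>u. h u \<partial>sphere_measure) 1"
proof
  show "(\<integral>u. f u + g u \<partial>sphere_measure) = (\<integral>u. f u \<partial>sphere_measure) + (\<integral>u. g u \<partial>sphere_measure)"
    if "continuous_on UNIV f" "continuous_on UNIV g" for f g :: "real ^ 'n \<Rightarrow> real"
    using that by (intro Bochner_Integration.integral_add integral_sphere)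
  show "(\<integral>u. c * f u \<partial>sphere_measure) = c * (\<integral>u. f u \<partial>sphere_measure)" for c and f :: "real ^ 'n \<Rightarrow> real"
    by (rule integral_mult_right_zero)
  fix g :: "real ^ 'n \<Rightarrow> real" assume g: "continuous_on UNIV g"
  then have [measurable]: "g \<in> borel_measurable borel" by (rule borel_measurable_continuous_onI)
  have s: "sets (sphere_measure :: (real ^ 'n) measure) = sets borel" by (simp add: sphere_measure_def)
  have m: "(\<lambda>u. (u \<bullet> u) * g u) \<in> borel_measurable sphere_measure" "g \<in> borel_measurable sphere_measure"
    by (simp_all add: measurable_cong_sets[OF s refl])
  have "(\<integral>u. (u \<bullet> u) * g u \<partial>sphere_measure) = (\<integral>u. g u \<partial>sphere_measure)"
  proof (rule integral_cong_AE[OF m])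
    show "AE u in sphere_measure. (u \<bullet> u) * g u = g u"
      using AE_sphere by eventually_elim (simp add: norm_eq_1)
  qed
  then show "(\<integral>u. (u \<bullet> u) * g u \<partial>sphere_measure) = 1 * (\<integral>u. g u \<partial>sphere_measure)" by simp
qed

lemma sphere_moment_0: "sphere_moment TYPE('n::{finite,wellorder}) 0 = 1"
proof -
  interpret prob_space "sphere_measure :: (real, 'n) vec measure" by (rule prob_space_sphere_measure)
  show ?thesis by (simp add: sphere_moment_def prob_space)
qed

lemma sphere_moment_odd: "odd j \<Longrightarrow> sphere_moment TYPE('n::{finite,wellorder}) j = 0"
proof -
  assume j: "odd j"
  let ?e = "axis undefined 1 :: (real, 'n) vec"
  have "(\<integral>u. (u \<bullet> - ?e) ^ j \<partial>sphere_measure) = sphere_moment TYPE('n) j"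
    unfolding sphere_moment by simp
  moreover have "(\<integral>u. (u \<bullet> - ?e) ^ j \<partial>sphere_measure) = - sphere_moment TYPE('n) j"
    using j by (simp add: sphere_moment_def)
  ultimately show ?thesis by simp
qed

lemma sphere_moment_Suc:
  "sphere_moment TYPE('n::{finite,wellorder}) (2 * Suc e) * (CARD('n) + 2 * e) = (2 * e + 1) * sphere_moment TYPE('n) (2 * e)"
  using radial_functional.moment_recursion[OF radial_functional_sphere, OF sphere_moment[where 'n = 'n] sphere_moment[where 'n = 'n], of e]
  by simp

section \<open>Moment tensors and the criterion for designs\<close>

definition tuples :: "nat \<Rightarrow> (nat \<Rightarrow> 'n::finite) set" where
  "tuples j = PiE {..<j} (\<lambda>_. UNIV)"

text \<open>A coordinate of the j-th tensor power of \<open>u\<close>. Indexing by sequences of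
  coordinates in place of exponents makes (u.x)^j a plain scalar product of tensors, free of
  multinomial coefficients.\<close>

definition tuple_monomial :: "nat \<Rightarrow> (nat \<Rightarrow> 'n::finite) \<Rightarrow> real ^ 'n \<Rightarrow> real" where
  "tuple_monomial j t u = (\<Prod>l<j. u $ t l)"

lemma finite_tuples [simp]: "finite (tuples j)"
  unfolding tuples_def by (intro finite_PiE) auto

lemma inner_power_tuples: "(u \<bullet> x) ^ j = (\<Sum>t\<in>tuples j. tuple_monomial j t x * tuple_monomial j t u)"
proof -
  have "(u \<bullet> x) ^ j = (\<Prod>l<j. \<Sum>i\<in>UNIV. x $ i * u $ i)"
    by (simp add: inner_vec_def mult.commute)
  also have "\<dots> = (\<Sum>t\<in>tuples j. \<Prod>l<j. x $ t l * u $ t l)"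
    unfolding tuples_def by (rule prod_sum_PiE) auto
  finally show ?thesis by (simp add: tuple_monomial_def prod.distrib)
qed

lemma tuple_monomial_continuous [continuous_intros]: "continuous_on A (tuple_monomial j t)"
  unfolding tuple_monomial_def by (intro continuous_intros)

lemma tuple_monomial_exponents:
  "tuple_monomial j t u = (\<Prod>i\<in>UNIV. (u $ i) ^ card {l. l < j \<and> t l = i})"
proof -
  have "tuple_monomial j t u = (\<Prod>i\<in>UNIV. \<Prod>l\<in>{l \<in> {..<j}. t l = i}. u $ t l)"
    unfolding tuple_monomial_def by (rule prod.group[symmetric]) auto
  also have "\<dots> = (\<Prod>i\<in>UNIV. (u $ i) ^ card {l. l < j \<and> t l = i})"
    by (intro prod.cong) auto
  finally show ?thesis .
qed

lemma sum_fiber_cards: "(\<Sum>i\<in>(UNIV :: 'n::finite set). card {l. l < j \<and> t l = i}) = j"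
proof -
  have "(\<Sum>i\<in>(UNIV :: 'n set). card {l. l < j \<and> t l = i}) = (\<Sum>i\<in>UNIV. \<Sum>l\<in>{l \<in> {..<j}. t l = i}. 1)"
    by simp
  also have "\<dots> = (\<Sum>l<j. 1)" by (rule sum.group) auto
  finally show ?thesis by simp
qed

text \<open>A suitable sequence lists each coordinate \<open>i\<close> exactly \<open>a i\<close>
  times.\<close>

lemma exponents_tuple:
  fixes a :: "'n::finite \<Rightarrow> nat"
  shows "\<exists>t\<in>tuples (\<Sum>i\<in>UNIV. a i). \<forall>u. (\<Prod>i\<in>UNIV. (u $ i) ^ a i) = tuple_monomial (\<Sum>i\<in>UNIV. a i) t u"
proof -
  define j where "j = (\<Sum>i\<in>UNIV. a i)"
  define S where "S = (SIGMA i:UNIV. {..<a i})"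
  have "finite S" "card S = j" by (simp_all add: S_def j_def)
  then have "\<exists>h. bij_betw h {..<j} S" by (intro finite_same_card_bij) auto
  then obtain h where h: "bij_betw h {..<j} S" by blast
  define t where "t = restrict (fst \<circ> h) {..<j}"
  have "t \<in> tuples j" by (simp add: t_def tuples_def)
  moreover have "(\<Prod>i\<in>UNIV. (u $ i) ^ a i) = tuple_monomial j t u" for u
  proof -
    have "tuple_monomial j t u = (\<Prod>l<j. u $ fst (h l))"
      unfolding tuple_monomial_def by (intro prod.cong) (auto simp: t_def)
    also have "\<dots> = (\<Prod>s\<in>S. u $ fst s)" by (rule prod.reindex_bij_betw[OF h])
    also have "\<dots> = (\<Prod>i\<in>UNIV. \<Prod>k<a i. u $ i)"
      unfolding S_def by (subst prod.Sigma) (auto simp: case_prod_unfold)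
    finally show ?thesis by simp
  qed
  ultimately show ?thesis unfolding j_def by blast
qed

lemma finite_multi_indices: "finite {a :: 'n::finite \<Rightarrow> nat. (\<Sum>i\<in>UNIV. a i) \<le> d}"
proof (rule finite_subset)
  show "{a :: 'n \<Rightarrow> nat. (\<Sum>i\<in>UNIV. a i) \<le> d} \<subseteq> PiE UNIV (\<lambda>_. {..d})"
  proof
    fix a :: "'n \<Rightarrow> nat" assume "a \<in> {a. (\<Sum>i\<in>UNIV. a i) \<le> d}"
    then have "a i \<le> d" for i using member_le_sum[of i UNIV a] by simp
    then show "a \<in> PiE UNIV (\<lambda>_. {..d})" by (intro PiE_I) auto
  qed
qed (intro finite_PiE; simp)

text \<open>Sequences with equal exponents give equal monomials, so their coefficients are
  collected.\<close>

lemma polynomial_tuple_monomial: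
  assumes "j \<le> d"
  shows "polynomial_of_total_degree_le d (\<lambda>u :: real ^ 'n. \<Sum>t\<in>tuples j. c t * tuple_monomial j t u)"
proof -
  define ex where "ex t = (\<lambda>i :: 'n. card {l. l < j \<and> t l = i})" for t
  define A where "A = {a :: 'n \<Rightarrow> nat. (\<Sum>i\<in>UNIV. a i) \<le> d}"
  have fA: "finite A" unfolding A_def by (rule finite_multi_indices)
  have exA: "ex t \<in> A" for t
    using assms by (simp add: A_def ex_def sum_fiber_cards)
  define c' where "c' a = (\<Sum>t\<in>{t \<in> tuples j. ex t = a}. c t)" for a
  have "(\<Sum>t\<in>tuples j. c t * tuple_monomial j t u) = (\<Sum>a\<in>A. c' a * (\<Prod>i\<in>UNIV. (u $ i) ^ a i))" for u
  proof -
    have "(\<Sum>t\<in>tuples j. c t * tuple_monomial j t u) = (\<Sum>a\<in>A. \<Sum>t\<in>{t \<in> tuples j. ex t = a}. c t * tuple_monomial j t u)"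
      by (rule sum.group[symmetric]) (use fA exA in auto)
    also have "\<dots> = (\<Sum>a\<in>A. c' a * (\<Prod>i\<in>UNIV. (u $ i) ^ a i))"
      unfolding c'_def sum_distrib_right by (intro sum.cong refl) (auto simp: tuple_monomial_exponents ex_def)
    finally show ?thesis .
  qed
  then show ?thesis unfolding polynomial_of_total_degree_le_def A_def by (intro exI[of _ c']) (rule ext)
qed

lemma design_inner_power:
  fixes C :: "(real ^ 'n::{finite,wellorder}) set"
  assumes d: "spherical_design \<tau> C" and j: "j \<le> \<tau>" and C: "C \<noteq> {}"
  shows "(\<Sum>y\<in>C. (y \<bullet> x) ^ j) = real (card C) * (sphere_moment TYPE('n) j * norm x ^ j)"
proof -
  have "polynomial_of_total_degree_le \<tau> (\<lambda>u. (u \<bullet> x) ^ j)"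
    unfolding inner_power_tuples by (rule polynomial_tuple_monomial[OF j])
  then have "(\<Sum>y\<in>C. (y \<bullet> x) ^ j) / real (card C) = (\<integral>u. (u \<bullet> x) ^ j \<partial>sphere_measure)"
    using d by (simp add: spherical_design_def)
  moreover have "card C \<noteq> 0" using C d by (auto simp: spherical_design_def spherical_code_def)
  ultimately show ?thesis by (simp add: sphere_moment field_simps)
qed

lemma design_card_pos: "spherical_design \<tau> C \<Longrightarrow> C \<noteq> ({} :: (real ^ 'n) set)"
proof
  assume d: "spherical_design \<tau> C" and "C = {}"
  interpret prob_space "sphere_measure :: (real ^ 'n) measure" by (rule prob_space_sphere_measure)
  have "polynomial_of_total_degree_le \<tau> (\<lambda>u :: real ^ 'n. \<Sum>t\<in>tuples 0. 1 * tuple_monomial 0 t u)"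
    by (rule polynomial_tuple_monomial) simp
  then have "polynomial_of_total_degree_le \<tau> (\<lambda>u :: real ^ 'n. 1)"
    by (simp add: tuples_def tuple_monomial_def)
  then have "(\<Sum>x\<in>C. 1) / real (card C) = (\<integral>x. 1 \<partial>(sphere_measure :: (real ^ 'n) measure))"
    using d unfolding spherical_design_def by blast
  then show False using \<open>C = {}\<close> by (simp add: prob_space)
qed

text \<open>
  For each degree \<open>j\<close> the squared distance between the \<open>j\<close>-th moment tensors of the code and of
  the sphere is \<open>\<Sum>(x \<bullet> y)^j - N^2 m_j\<close>.
\<close>
lemma designI:
  fixes C :: "(real ^ 'n::{finite,wellorder}) set"
  assumes C: "spherical_code C" "C \<noteq> {}"
    and m: "\<And>j. j \<le> \<tau> \<Longrightarrow> (\<Sum>x\<in>C. \<Sum>y\<in>C. (x \<bullet> y) ^ j) = (real (card C))\<^sup>2 * sphere_moment TYPE('n) j"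
  shows "spherical_design \<tau> C"
proof -
  have fin: "finite C" and nC: "x \<in> C \<Longrightarrow> norm x = 1" for x using C by (auto simp: spherical_code_def)
  define E where "E h = (\<integral>u. h u \<partial>sphere_measure)" for h :: "(real, 'n) vec \<Rightarrow> real"
  define k where "k = real (card C)"
  have k: "k > 0" using C fin by (simp add: k_def card_gt_0_iff)
  have Elin: "E (\<lambda>u. \<Sum>i\<in>I. c i * g i u) = (\<Sum>i\<in>I. c i * E (g i))"
    if "finite I" "\<And>i. i \<in> I \<Longrightarrow> continuous_on UNIV (g i)" for I :: "(nat \<Rightarrow> 'n) set" and c g
    using radial_functional.linear[OF radial_functional_sphere that] unfolding E_def .
  have mono: "(\<Sum>x\<in>C. tuple_monomial j t x) = k * E (tuple_monomial j t)" if j: "j \<le> \<tau>" and t: "t \<in> tuples j" for j t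
  proof -
    define S where "S t = (\<Sum>x\<in>C. tuple_monomial j t x)" for t
    define e where "e t = E (tuple_monomial j t)" for t
    \<comment> \<open>\<open>s1\<close>, \<open>s2\<close> and \<open>s3\<close> are the scalar
      products of the tensor \<open>S\<close> of the code and the tensor \<open>e\<close> of the
      sphere. All are multiples of the same sphere moment, by k^2, k and 1, so the squared length of
      S - k e is 0.\<close>
    have s1: "(\<Sum>t\<in>tuples j. S t * S t) = k\<^sup>2 * sphere_moment TYPE('n) j"
    proof -
      have "(\<Sum>t\<in>tuples j. S t * S t) = (\<Sum>t\<in>tuples j. \<Sum>x\<in>C. \<Sum>y\<in>C. tuple_monomial j t y * tuple_monomial j t x)"
        unfolding S_def sum_product by (simp add: mult.commute)
      also have "\<dots> = (\<Sum>x\<in>C. \<Sum>t\<in>tuples j. \<Sum>y\<in>C. tuple_monomial j t y * tuple_monomial j t x)" by (rule sum.swap)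
      also have "\<dots> = (\<Sum>x\<in>C. \<Sum>y\<in>C. (x \<bullet> y) ^ j)"
        unfolding inner_power_tuples by (intro sum.cong refl sum.swap)
      finally show ?thesis using m[OF j] by (simp add: k_def)
    qed
    have Ex: "(\<Sum>t\<in>tuples j. tuple_monomial j t x * e t) = sphere_moment TYPE('n) j * norm x ^ j" for x
    proof -
      have "(\<Sum>t\<in>tuples j. tuple_monomial j t x * e t) = E (\<lambda>u. (u \<bullet> x) ^ j)"
        unfolding e_def inner_power_tuples by (rule Elin[symmetric]) (auto intro: tuple_monomial_continuous)
      then show ?thesis unfolding E_def sphere_moment .
    qed
    have s2: "(\<Sum>t\<in>tuples j. S t * e t) = k * sphere_moment TYPE('n) j"
    proof -
      have "(\<Sum>t\<in>tuples j. S t * e t) = (\<Sum>x\<in>C. \<Sum>t\<in>tuples j. tuple_monomial j t x * e t)"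
        unfolding S_def sum_distrib_right by (rule sum.swap)
      also have "\<dots> = (\<Sum>x\<in>C. sphere_moment TYPE('n) j)" by (intro sum.cong refl) (simp add: Ex nC)
      finally show ?thesis by (simp add: k_def)
    qed
    have s3: "(\<Sum>t\<in>tuples j. e t * e t) = sphere_moment TYPE('n) j"
    proof -
      have "(\<Sum>t\<in>tuples j. e t * e t) = E (\<lambda>u. \<Sum>t\<in>tuples j. e t * tuple_monomial j t u)"
        unfolding e_def by (rule Elin[symmetric]) (auto intro: tuple_monomial_continuous)
      also have "\<dots> = E (\<lambda>u. sphere_moment TYPE('n) j * norm u ^ j)"
        unfolding Ex[symmetric] by (simp add: mult.commute)
      also have "\<dots> = (\<integral>u. sphere_moment TYPE('n) j \<partial>(sphere_measure :: (real, 'n) vec measure))"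
        unfolding E_def
      proof (rule integral_cong_AE)
        show "AE u in sphere_measure. sphere_moment TYPE('n) j * norm (u :: (real, 'n) vec) ^ j = sphere_moment TYPE('n) j"
          using AE_sphere by eventually_elim simp
      qed (simp_all add: sphere_measure_def)
      also have "\<dots> = sphere_moment TYPE('n) j"
      proof -
        interpret prob_space "sphere_measure :: (real, 'n) vec measure" by (rule prob_space_sphere_measure)
        show ?thesis by (simp add: prob_space)
      qed
      finally show ?thesis .
    qed
    have "(\<Sum>t\<in>tuples j. (S t - k * e t)\<^sup>2) = (\<Sum>t\<in>tuples j. S t * S t) - 2 * k * (\<Sum>t\<in>tuples j. S t * e t) + k\<^sup>2 * (\<Sum>t\<in>tuples j. e t * e t)"
      by (simp add: power2_eq_square algebra_simps sum.distrib sum_subtractf sum_distrib_left)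
    also have "\<dots> = 0" unfolding s1 s2 s3 by (simp add: power2_eq_square)
    finally have "\<forall>t\<in>tuples j. (S t - k * e t)\<^sup>2 = 0"
      by (subst (asm) sum_nonneg_eq_0_iff) auto
    then show ?thesis using t by (simp add: S_def e_def)
  qed
  have "(\<Sum>x\<in>C. p x) / real (card C) = (\<integral>x. p x \<partial>sphere_measure)" if p: "polynomial_of_total_degree_le \<tau> p" for p
  proof -
    define A where "A = {a :: 'n \<Rightarrow> nat. (\<Sum>i\<in>UNIV. a i) \<le> \<tau>}"
    define M where "M a u = (\<Prod>i\<in>UNIV. (u $ i) ^ a i)" for a :: "'n \<Rightarrow> nat" and u :: "(real, 'n) vec"
    obtain c where "p = (\<lambda>x. \<Sum>a | (\<Sum>i\<in>UNIV. a i) \<le> \<tau>. c a * (\<Prod>i\<in>UNIV. (x $ i) ^ a i))"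
      using p unfolding polynomial_of_total_degree_le_def by (rule exE)
    then have pc: "p = (\<lambda>x. \<Sum>a\<in>A. c a * M a x)" unfolding A_def M_def .
    have fA: "finite A" unfolding A_def by (rule finite_multi_indices)
    have Mc: "continuous_on UNIV (M a)" for a unfolding M_def by (intro continuous_intros)
    have Ma: "(\<Sum>x\<in>C. M a x) = k * (\<integral>x. M a x \<partial>sphere_measure)" if a: "a \<in> A" for a
    proof -
      obtain t where t: "t \<in> tuples (\<Sum>i\<in>UNIV. a i)" "\<forall>u. (\<Prod>i\<in>UNIV. (u $ i) ^ a i) = tuple_monomial (\<Sum>i\<in>UNIV. a i) t u"
        using exponents_tuple[of a] by (rule bexE)
      have "M a = tuple_monomial (\<Sum>i\<in>UNIV. a i) t" by (rule ext) (simp add: M_def t(2))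
      then show ?thesis using mono[OF _ t(1)] a by (simp add: A_def E_def)
    qed
    have "(\<Sum>x\<in>C. p x) = (\<Sum>a\<in>A. c a * (\<Sum>x\<in>C. M a x))"
      unfolding pc sum_distrib_left by (rule sum.swap)
    also have "\<dots> = k * (\<Sum>a\<in>A. c a * (\<integral>x. M a x \<partial>sphere_measure))"
      by (simp add: Ma sum_distrib_left mult_ac)
    also have "(\<Sum>a\<in>A. c a * (\<integral>x. M a x \<partial>sphere_measure)) = (\<integral>x. p x \<partial>sphere_measure)"
      unfolding pc using radial_functional.linear[OF radial_functional_sphere fA, of M c] Mc by simp
    finally show ?thesis using k by (simp add: k_def)
  qed
  then show ?thesis using C(1) by (simp add: spherical_design_def)
qed

section \<open>Gegenbauer polynomials\<close>

lemma poly_zero_on_interval: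
  fixes p :: "real poly"
  assumes "\<And>t. t \<in> {-1<..<1} \<Longrightarrow> poly p t = 0"
  shows "p = 0"
proof (rule ccontr)
  assume "p \<noteq> 0"
  then have "finite {t. poly p t = 0}" by (rule poly_roots_finite)
  moreover have "{-1<..<1} \<subseteq> {t. poly p t = 0}" using assms by auto
  ultimately have "finite {-1<..<1::real}" by (rule finite_subset[rotated])
  then show False by (simp add: infinite_Ioo)
qed

lemma poly_span:
  fixes P :: "nat \<Rightarrow> real poly"
  assumes P: "\<And>i. i < n \<Longrightarrow> degree (P i) = i" "\<And>i. i < n \<Longrightarrow> P i \<noteq> 0" and q: "\<And>k. k \<ge> n \<Longrightarrow> coeff q k = 0"
  shows "\<exists>c. q = (\<Sum>i<n. smult (c i) (P i))"
  using assms
proof (induction n arbitrary: q)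
  case 0
  then have "q = 0" by (simp add: poly_eq_iff)
  then show ?case by simp
next
  case (Suc n)
  define a where "a = coeff q n / lead_coeff (P n)"
  define r where "r = q - smult a (P n)"
  have l: "coeff (P n) n \<noteq> 0" using Suc.prems(1)[of n] Suc.prems(2)[of n] leading_coeff_0_iff[of "P n"] by simp
  have "coeff r k = 0" if "k \<ge> n" for k
  proof (cases "k = n")
    case True
    then show ?thesis using l Suc.prems(1)[of n] by (simp add: r_def a_def)
  next
    case False
    then have "k > n" using that by simp
    then show ?thesis using Suc.prems(3)[of k] Suc.prems(1)[of n] by (simp add: r_def coeff_eq_0)
  qed
  then obtain c where c: "r = (\<Sum>i<n. smult (c i) (P i))" using Suc.IH[of r] Suc.prems by auto
  have "q = (\<Sum>i<Suc n. smult ((c(n := a)) i) (P i))"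
  proof -
    have "(\<Sum>i<n. smult ((c(n := a)) i) (P i)) = (\<Sum>i<n. smult (c i) (P i))" by (intro sum.cong) auto
    then show ?thesis using c by (simp add: r_def algebra_simps)
  qed
  then show ?case by blast
qed

text \<open>In dimension 23 the exponent (n - 3) / 2 of the weight is 10, so the weight itself is a
  polynomial.\<close>

definition gegenbauer_functional :: "real poly \<Rightarrow> real" where
  "gegenbauer_functional p = integral {-1..1} (\<lambda>t. poly p t * (1 - t\<^sup>2) ^ 10)"

abbreviation "GL \<equiv> gegenbauer_functional"

lemma GL_integrable: "(\<lambda>t. poly p t * (1 - t\<^sup>2) ^ 10) integrable_on {-1..1::real}"
  by (intro integrable_continuous_real continuous_intros)

lemma GL_add: "GL (p + q) = GL p + GL q"
  unfolding gegenbauer_functional_def by (simp add: distrib_right integral_add GL_integrable)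

lemma GL_smult: "GL (smult c p) = c * GL p"
  unfolding gegenbauer_functional_def by (simp add: mult.assoc)

lemma GL_diff: "GL (p - q) = GL p - GL q"
  using GL_add[of p "smult (-1) q"] GL_smult[of "-1" q] by simp

lemma GL_0: "GL 0 = 0"
  using GL_smult[of 0 0] by simp

lemma GL_sum: "GL (\<Sum>i\<in>I. f i) = (\<Sum>i\<in>I. GL (f i))"
  by (induction I rule: infinite_finite_induct) (simp_all add: GL_0 GL_add)

text \<open>\<open>r\<close> is an extra weight that may vanish at the endpoints: r = 1 gives
  definiteness of the pairing, and r = 1 - t will show that an orthogonal polynomial is nonzero at
  1.\<close>

lemma GL_positive:
  assumes r: "\<And>t. t \<in> {-1<..<1} \<Longrightarrow> poly r t > 0" "\<And>t. t \<in> {-1..1} \<Longrightarrow> poly r t \<ge> 0" and z: "GL (r * q * q) = 0"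
  shows "q = 0"
proof (rule poly_zero_on_interval)
  fix t :: real assume t: "t \<in> {-1<..<1}"
  let ?f = "\<lambda>t. poly (r * q * q) t * (1 - t\<^sup>2) ^ 10"
  have c: "continuous_on {-1..1} ?f" by (intro continuous_intros)
  have nn: "?f s \<ge> 0" if "s \<in> {-1..1}" for s
  proof -
    have "s\<^sup>2 \<le> 1" using that by (simp add: abs_square_le_1 abs_le_iff)
    then have pw: "0 \<le> (1 - s\<^sup>2) ^ 10" by (intro zero_le_power) simp
    have "0 \<le> poly r s * ((poly q s * poly q s) * (1 - s\<^sup>2) ^ 10)"
      by (rule mult_nonneg_nonneg[OF r(2)[OF that] mult_nonneg_nonneg[OF zero_le_square pw]])
    then show ?thesis by (simp add: mult_ac)
  qed
  have "integral {-1..1} ?f = 0" using z unfolding gegenbauer_functional_def .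
  then have "\<forall>s\<in>{-1..1}. ?f s = 0"
    by (subst (asm) integral_eq_0_iff[OF c]) (use nn in auto)
  then have "?f t = 0" by (rule bspec) (use t in simp)
  moreover have "1 - t\<^sup>2 \<noteq> 0"
  proof -
    have "t\<^sup>2 < 1" using t by (simp add: abs_square_less_1 abs_less_iff)
    then show ?thesis by simp
  qed
  moreover have "poly r t \<noteq> 0" using r(1)[OF t] by simp
  ultimately show "poly q t = 0" by simp
qed

lemma GL_definite: "GL (q * q) = 0 \<Longrightarrow> q = 0"
  using GL_positive[of 1 q] by simp

text \<open>The condition on \<open>q\<close> means degree below \<open>i\<close>; phrased by
  coefficients it leaves only q = 0 when i = 0.\<close>

definition orthogonal_poly :: "nat \<Rightarrow> real poly \<Rightarrow> bool" where
  "orthogonal_poly i p \<longleftrightarrow> p \<noteq> 0 \<and> degree p = i \<and> (\<forall>q. (\<forall>k\<ge>i. coeff q k = 0) \<longrightarrow> GL (p * q) = 0)"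

text \<open>Gram-Schmidt: subtract from t^i its projections to the polynomials already
  found.\<close>

lemma orthogonal_poly_exists: "\<exists>p. orthogonal_poly i p"
proof (induction i rule: less_induct)
  case (less i)
  then obtain P where P: "\<And>j. j < i \<Longrightarrow> orthogonal_poly j (P j)" by metis
  have Pd: "degree (P j) = j" "P j \<noteq> 0" if "j < i" for j using P[OF that] by (auto simp: orthogonal_poly_def)
  have orth: "GL (P j * P k) = 0" if jk: "j < i" "k < i" "j \<noteq> k" for j k
  proof -
    have *: "GL (P j * P k) = 0" if "k < j" "j < i" for j k
    proof -
      have "\<forall>l\<ge>j. coeff (P k) l = 0" using that Pd(1)[of k] by (auto intro!: coeff_eq_0)
      then show ?thesis using P[OF that(2)] by (auto simp: orthogonal_poly_def)
    qed
    show ?thesis using *[of k j] *[of j k] jk by (cases "k < j") (auto simp: mult.commute)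
  qed
  define x where "x = (monom 1 i :: real poly)"
  define c where "c j = GL (x * P j) / GL (P j * P j)" for j
  define p where "p = x - (\<Sum>j<i. smult (c j) (P j))"
  have top: "coeff p i = 1"
    by (simp add: p_def x_def coeff_sum coeff_eq_0 Pd)
  have "coeff p l = 0" if "l > i" for l
    using that by (simp add: p_def x_def coeff_sum coeff_eq_0 Pd)
  then have deg: "degree p = i" using top by (intro antisym degree_le le_degree) auto
  have pk: "GL (p * P k) = 0" if k: "k < i" for k
  proof -
    have "GL (p * P k) = GL (x * P k) - (\<Sum>j<i. c j * GL (P j * P k))"
      by (simp add: p_def left_diff_distrib GL_diff sum_distrib_right GL_sum GL_smult)
    also have "(\<Sum>j<i. c j * GL (P j * P k)) = (\<Sum>j<i. if j = k then c k * GL (P k * P k) else 0)"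
      using orth k by (intro sum.cong) auto
    also have "\<dots> = c k * GL (P k * P k)" using k by simp
    also have "\<dots> = GL (x * P k)" using GL_definite[of "P k"] Pd(2)[OF k] by (auto simp: c_def)
    finally show ?thesis by simp
  qed
  have "GL (p * q) = 0" if q: "\<forall>k\<ge>i. coeff q k = 0" for q
  proof -
    obtain d where d: "q = (\<Sum>j<i. smult (d j) (P j))" using poly_span[of i P q] Pd q by blast
    show ?thesis unfolding d by (simp add: sum_distrib_left GL_sum GL_smult pk)
  qed
  then have "orthogonal_poly i p" using deg top by (auto simp: orthogonal_poly_def)
  then show ?case by blast
qed

text \<open>If p = (t - 1) q, then q has lower degree, and the pairing of p with q is minus the
  weighted integral of (1 - t) q^2.\<close>

lemma orthogonal_poly_at_1:
  assumes p: "orthogonal_poly i p"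
  shows "poly p 1 \<noteq> 0"
proof
  assume "poly p 1 = 0"
  then obtain q where q: "p = [:-1, 1:] * q" by (auto simp: poly_eq_0_iff_dvd elim: dvdE)
  have "q \<noteq> 0" using p q by (auto simp: orthogonal_poly_def)
  then have "degree p = Suc (degree q)" unfolding q by (subst degree_mult_eq) auto
  then have "degree q < i" using p by (simp add: orthogonal_poly_def)
  then have "\<forall>k\<ge>i. coeff q k = 0" by (auto intro: coeff_eq_0)
  then have "GL (p * q) = 0" using p by (simp add: orthogonal_poly_def)
  moreover have "[:1, -1:] * q * q = smult (- 1) (p * q)"
  proof -
    have "[:1, -1:] = smult (- 1) [:-1, 1 :: real:]" by simp
    then show ?thesis unfolding q by (simp only: mult_smult_left)
  qed
  ultimately have "GL ([:1, -1:] * q * q) = 0" using GL_smult[of "- 1" "p * q"] by simp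
  then have "q = 0" by (rule GL_positive[rotated 2]) auto
  then show False using \<open>q \<noteq> 0\<close> by simp
qed

text \<open>Scaling \<open>q\<close> to the leading coefficient of \<open>p\<close> leaves a
  difference of lower degree, which is then orthogonal to itself; the value at 1 shows that the
  scaling factor is 1.\<close>

lemma orthogonal_poly_unique:
  assumes p: "orthogonal_poly i p" "poly p 1 = 1" and q: "orthogonal_poly i q" "poly q 1 = 1"
  shows "p = q"
proof -
  define c where "c = lead_coeff p / lead_coeff q"
  define r where "r = p - smult c q"
  have d: "degree p = i" "degree q = i" "q \<noteq> 0" using p q by (auto simp: orthogonal_poly_def)
  have lq: "coeff q i \<noteq> 0" using leading_coeff_0_iff[of q] d by simp
  have r0: "\<forall>k\<ge>i. coeff r k = 0"
  proof (intro allI impI)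
    fix k assume "k \<ge> i"
    then show "coeff r k = 0"
      using d lq by (cases "k = i") (auto simp: r_def c_def coeff_eq_0)
  qed
  have "GL (p * r) = 0" "GL (q * r) = 0" using p(1) q(1) r0 by (auto simp: orthogonal_poly_def)
  moreover have "r * r = p * r - smult c (q * r)"
    by (subst (1) r_def) (simp add: left_diff_distrib)
  ultimately have "GL (r * r) = 0" by (simp add: GL_diff GL_smult)
  then have "r = 0" by (rule GL_definite)
  then have "p = smult c q" by (simp add: r_def)
  with p(2) q(2) show ?thesis by simp
qed

lemma gegenbauer_weight:
  "integral {-1..1} (\<lambda>t. poly p t * poly q t * (1 - t\<^sup>2) powr ((real 23 - 3) / 2)) = GL (p * q)"
  unfolding gegenbauer_functional_def
proof (rule integral_cong)
  fix t :: real assume "t \<in> {-1..1}"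
  then have "t\<^sup>2 \<le> 1" by (simp add: abs_square_le_1 abs_le_iff)
  then have "(1 - t\<^sup>2) powr real 10 = (1 - t\<^sup>2) ^ 10" by (intro powr_realpow') auto
  then show "poly p t * poly q t * (1 - t\<^sup>2) powr ((real 23 - 3) / 2) = poly (p * q) t * (1 - t\<^sup>2) ^ 10"
    by simp
qed

text \<open>The definite description yields its properties once exactly one family has them. Degrees
  0, 1, 2, ... span all lower polynomials, so mutual orthogonality gives
  \<open>orthogonal_poly\<close>, and the value at 1 fixes the scale.\<close>

lemma gegenbauer_23:
  "degree (gegenbauer 23 i) = i" "poly (gegenbauer 23 i) 1 = 1"
  "i \<noteq> j \<Longrightarrow> GL (gegenbauer 23 i * gegenbauer 23 j) = 0"
proof -
  let ?Q = "\<lambda>P. (\<forall>i. degree (P i) = i \<and> poly (P i) 1 = 1) \<and> (\<forall>i j. i \<noteq> j \<longrightarrow> GL (P i * P j) = 0)"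
  have orth: "orthogonal_poly i (P i)" if P: "?Q P" for P i
  proof -
    have nz: "P j \<noteq> 0" for j
    proof
      assume "P j = 0"
      moreover have "poly (P j) 1 = 1" using P by blast
      ultimately show False by simp
    qed
    have "GL (P i * q) = 0" if q: "\<forall>k\<ge>i. coeff q k = 0" for q
    proof -
      obtain d where d: "q = (\<Sum>j<i. smult (d j) (P j))" using poly_span[of i P q] P nz q by blast
      have "GL (P i * P j) = 0" if "j < i" for j using P that by auto
      then show ?thesis unfolding d by (simp add: sum_distrib_left GL_sum GL_smult)
    qed
    then show ?thesis using nz[of i] P by (simp add: orthogonal_poly_def)
  qed
  have "\<exists>!P. ?Q P"
  proof (rule ex_ex1I)
    have "\<exists>p. orthogonal_poly i p \<and> poly p 1 = 1" for i
    proof -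
      obtain p where p: "orthogonal_poly i p" using orthogonal_poly_exists by blast
      have n: "poly p 1 \<noteq> 0" using p by (rule orthogonal_poly_at_1)
      have "orthogonal_poly i (smult (1 / poly p 1) p)"
        using p n by (auto simp: orthogonal_poly_def GL_smult)
      then show ?thesis using n by (intro exI[of _ "smult (1 / poly p 1) p"]) simp
    qed
    then obtain P where P: "\<And>i. orthogonal_poly i (P i) \<and> poly (P i) 1 = 1" by metis
    have *: "GL (P i * P j) = 0" if "j < i" for i j
    proof -
      have "\<forall>k\<ge>i. coeff (P j) k = 0" using that P[of j] by (auto simp: orthogonal_poly_def intro!: coeff_eq_0)
      then show ?thesis using P[of i] by (auto simp: orthogonal_poly_def)
    qed
    have "GL (P i * P j) = 0" if "i \<noteq> j" for i j
      using *[of i j] *[of j i] that by (cases "j < i") (auto simp: mult.commute)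
    then show "\<exists>P. ?Q P" using P by (intro exI[of _ P]) (auto simp: orthogonal_poly_def)
  next
    fix P P' assume a: "?Q P" and b: "?Q P'"
    have 1: "poly (P i) 1 = 1" "poly (P' i) 1 = 1" for i using a b by blast+
    show "P = P'"
    proof (rule ext)
      fix i
      show "P i = P' i"
        by (rule orthogonal_poly_unique[OF orth[where P = P and i = i, OF a] 1(1) orth[where P = P' and i = i, OF b] 1(2)])
    qed
  qed
  from theI'[OF this] have "?Q (gegenbauer 23)"
    unfolding gegenbauer_def gegenbauer_weight .
  then show "degree (gegenbauer 23 i) = i" "poly (gegenbauer 23 i) 1 = 1"
    "i \<noteq> j \<Longrightarrow> GL (gegenbauer 23 i * gegenbauer 23 j) = 0" by blast+
qed

text \<open>Integrate the derivative of t^(k+1) (1 - t^2)^11, a function that vanishes at both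
  endpoints.\<close>

lemma GL_moment: "real (Suc k) * GL (monom 1 k) = (real k + 23) * GL (monom 1 (k + 2))"
proof -
  let ?F = "\<lambda>t::real. t ^ Suc k * (1 - t\<^sup>2) ^ 11"
  have "((\<lambda>t. real (Suc k) * (t ^ k * (1 - t\<^sup>2) ^ 10) - (real k + 23) * (t ^ (k + 2) * (1 - t\<^sup>2) ^ 10)) has_integral ?F 1 - ?F (-1)) {-1..1}"
  proof (rule fundamental_theorem_of_calculus)
    fix t :: real
    have "(?F has_real_derivative real (Suc k) * t ^ k * (1 - t\<^sup>2) ^ 11 + t ^ Suc k * (11 * (1 - t\<^sup>2) ^ 10 * (- 2 * t))) (at t within {-1..1})"
      by (auto intro!: derivative_eq_intros simp del: power_Suc) 
    also have "real (Suc k) * t ^ k * (1 - t\<^sup>2) ^ 11 + t ^ Suc k * (11 * (1 - t\<^sup>2) ^ 10 * (- 2 * t)) =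
        real (Suc k) * (t ^ k * (1 - t\<^sup>2) ^ 10) - (real k + 23) * (t ^ (k + 2) * (1 - t\<^sup>2) ^ 10)"
    proof -
      define E where "E = (1 - t\<^sup>2) ^ 10"
      have E: "(1 - t\<^sup>2) ^ 11 = (1 - t\<^sup>2) * E" unfolding E_def by (simp only: power_Suc[symmetric]) simp
      show ?thesis unfolding E E_def[symmetric] by (simp add: power_add power2_eq_square algebra_simps)
    qed
    finally show "(?F has_vector_derivative real (Suc k) * (t ^ k * (1 - t\<^sup>2) ^ 10) - (real k + 23) * (t ^ (k + 2) * (1 - t\<^sup>2) ^ 10)) (at t within {-1..1})"
      by (rule has_real_derivative_iff_has_vector_derivative[THEN iffD1])
  qed simp
  moreover have "((\<lambda>t. real (Suc k) * (t ^ k * (1 - t\<^sup>2) ^ 10) - (real k + 23) * (t ^ (k + 2) * (1 - t\<^sup>2) ^ 10)) has_integral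
      real (Suc k) * GL (monom 1 k) - (real k + 23) * GL (monom 1 (k + 2))) {-1..1}"
  proof -
    have "((\<lambda>t. t ^ k * (1 - t\<^sup>2) ^ 10) has_integral GL (monom 1 k)) {-1..1}" for k
      using integrable_integral[OF GL_integrable[of "monom 1 k"]] by (simp add: gegenbauer_functional_def poly_monom)
    then show ?thesis by (intro has_integral_diff has_integral_mult_right)
  qed
  ultimately have "real (Suc k) * GL (monom 1 k) - (real k + 23) * GL (monom 1 (k + 2)) = ?F 1 - ?F (-1)"
    by (rule has_integral_unique[rotated])
  then show ?thesis by simp
qed

lemma GL_t: "GL (monom 1 1) = 0"
proof -
  let ?F = "\<lambda>t::real. (0 - (1 - t\<^sup>2) ^ 11) / 22"
  have "((\<lambda>t. t * (1 - t\<^sup>2) ^ 10) has_integral ?F 1 - ?F (-1)) {-1..1}"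
  proof (rule fundamental_theorem_of_calculus)
    fix t :: real
    have "(?F has_real_derivative t * (1 - t\<^sup>2) ^ 10) (at t within {-1..1})"
      by (auto intro!: derivative_eq_intros)
    then show "(?F has_vector_derivative t * (1 - t\<^sup>2) ^ 10) (at t within {-1..1})"
      by (rule has_real_derivative_iff_has_vector_derivative[THEN iffD1])
  qed simp
  then show ?thesis by (simp add: gegenbauer_functional_def poly_monom integral_unique)
qed

text \<open>The polynomial vanishing at the four inner products \<open>-1/2\<close>, \<open>-1/5\<close>, \<open>1/10\<close>, \<open>2/5\<close>.\<close>
definition annihilator :: "real poly" where
  "annihilator = [:1 / 250, - 11 / 500, - 21 / 100, 1 / 5, 1:]"

lemma annihilator_factored: "poly annihilator t = (t + 1 / 2) * (t + 1 / 5) * (t - 1 / 10) * (t - 2 / 5)"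
  by (simp add: annihilator_def field_simps)

text \<open>Pairing with the constant polynomial kills all terms but the first, so
  \<open>c 0\<close> is the weighted mean: 1/250 - (21/100)/23 + 3/575 = 1/11500, with even moments
  from \<open>GL_moment\<close> and vanishing odd ones.\<close>

lemma annihilator_expansion:
  "\<exists>c. annihilator = (\<Sum>i\<le>degree annihilator. smult (c i) (gegenbauer 23 i)) \<and> c 0 = 1 / 11500"
proof -
  have d: "degree annihilator = 4" by (simp add: annihilator_def)
  have nz: "gegenbauer 23 i \<noteq> 0" for i
  proof
    assume "gegenbauer 23 i = 0"
    then show False using gegenbauer_23(2)[of i] by simp
  qed
  have "\<And>k. k \<ge> 5 \<Longrightarrow> coeff annihilator k = 0" using d by (intro coeff_eq_0) simp
  then obtain c where c: "annihilator = (\<Sum>i<5. smult (c i) (gegenbauer 23 i))"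
    using poly_span[of 5 "gegenbauer 23" annihilator] gegenbauer_23(1) nz by blast
  have g0: "gegenbauer 23 0 = 1"
  proof -
    obtain a where "gegenbauer 23 0 = [:a:]" using gegenbauer_23(1)[of 0] by (metis degree_eq_zeroE)
    then show ?thesis using gegenbauer_23(2)[of 0] by simp
  qed
  have g: "GL (gegenbauer 23 i) = 0" if "i \<noteq> 0" for i
    using gegenbauer_23(3)[OF that] by (simp add: g0)
  have "GL annihilator = (\<Sum>i<5. c i * GL (gegenbauer 23 i))"
    by (subst c) (simp add: GL_sum GL_smult)
  also have "\<dots> = c 0 * GL 1"
  proof -
    have "(\<Sum>i<5. c i * GL (gegenbauer 23 i)) = (\<Sum>i<(5::nat). if i = 0 then c 0 * GL 1 else 0)"
      by (intro sum.cong refl) (simp add: g g0)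
    then show ?thesis by simp
  qed
  finally have 1: "GL annihilator = c 0 * GL 1" .
  have "annihilator = smult (1 / 250) (monom 1 0) + smult (- 11 / 500) (monom 1 1) + smult (- 21 / 100) (monom 1 2) + smult (1 / 5) (monom 1 3) + monom 1 4"
    by (simp add: annihilator_def monom_altdef numeral_eq_Suc)
  from arg_cong[OF this, of GL] have "GL annihilator = 1 / 250 * GL (monom 1 0) + (- 11 / 500) * GL (monom 1 1) + (- 21 / 100) * GL (monom 1 2) + 1 / 5 * GL (monom 1 3) + GL (monom 1 4)"
    by (simp only: GL_add GL_smult)
  moreover have "GL (monom 1 2) = GL (monom 1 0) / 23" using GL_moment[of 0] by (simp add: numeral_2_eq_2)
  moreover have "GL (monom 1 4) = 3 * GL (monom 1 2) / 25" using GL_moment[of 2] by simp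
  moreover have "GL (monom 1 3) = 0" using GL_moment[of 1] GL_t by (simp add: numeral_3_eq_3)
  ultimately have "GL annihilator = 1 / 11500 * GL 1" using GL_t by simp
  moreover have "GL 1 \<noteq> 0" using GL_definite[of 1] by auto
  ultimately have "c 0 = 1 / 11500" using 1 by simp
  moreover have "{..<5} = {..(4::nat)}" by auto
  ultimately show ?thesis using c d by (intro exI[of _ c]) simp
qed

section \<open>The Leech lattice\<close>

text \<open>Generators [I | B] and [B | I] of the extended binary Golay code, used as parity checks.
  \<open>B\<close> is symmetric: corner 0, a border of ones, and an 11 by 11 block whose entry (i,
  j), counted from 0, is 0 exactly when i + j is a nonzero square modulo 11.\<close>

definition golay_rows :: "int list list" where
  "golay_rows = [[1, 0, 0, 0, 0, 0, 0, 0, 0, 0, 0, 0, 0, 1, 1, 1, 1, 1, 1, 1, 1, 1, 1, 1],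
   [0, 1, 0, 0, 0, 0, 0, 0, 0, 0, 0, 0, 1, 1, 0, 1, 0, 0, 0, 1, 1, 1, 0, 1],
   [0, 0, 1, 0, 0, 0, 0, 0, 0, 0, 0, 0, 1, 0, 1, 0, 0, 0, 1, 1, 1, 0, 1, 1],
   [0, 0, 0, 1, 0, 0, 0, 0, 0, 0, 0, 0, 1, 1, 0, 0, 0, 1, 1, 1, 0, 1, 1, 0],
   [0, 0, 0, 0, 1, 0, 0, 0, 0, 0, 0, 0, 1, 0, 0, 0, 1, 1, 1, 0, 1, 1, 0, 1],
   [0, 0, 0, 0, 0, 1, 0, 0, 0, 0, 0, 0, 1, 0, 0, 1, 1, 1, 0, 1, 1, 0, 1, 0],
   [0, 0, 0, 0, 0, 0, 1, 0, 0, 0, 0, 0, 1, 0, 1, 1, 1, 0, 1, 1, 0, 1, 0, 0],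
   [0, 0, 0, 0, 0, 0, 0, 1, 0, 0, 0, 0, 1, 1, 1, 1, 0, 1, 1, 0, 1, 0, 0, 0],
   [0, 0, 0, 0, 0, 0, 0, 0, 1, 0, 0, 0, 1, 1, 1, 0, 1, 1, 0, 1, 0, 0, 0, 1],
   [0, 0, 0, 0, 0, 0, 0, 0, 0, 1, 0, 0, 1, 1, 0, 1, 1, 0, 1, 0, 0, 0, 1, 1],
   [0, 0, 0, 0, 0, 0, 0, 0, 0, 0, 1, 0, 1, 0, 1, 1, 0, 1, 0, 0, 0, 1, 1, 1],
   [0, 0, 0, 0, 0, 0, 0, 0, 0, 0, 0, 1, 1, 1, 1, 0, 1, 0, 0, 0, 1, 1, 1, 0],
   [0, 1, 1, 1, 1, 1, 1, 1, 1, 1, 1, 1, 1, 0, 0, 0, 0, 0, 0, 0, 0, 0, 0, 0],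
   [1, 1, 0, 1, 0, 0, 0, 1, 1, 1, 0, 1, 0, 1, 0, 0, 0, 0, 0, 0, 0, 0, 0, 0],
   [1, 0, 1, 0, 0, 0, 1, 1, 1, 0, 1, 1, 0, 0, 1, 0, 0, 0, 0, 0, 0, 0, 0, 0],
   [1, 1, 0, 0, 0, 1, 1, 1, 0, 1, 1, 0, 0, 0, 0, 1, 0, 0, 0, 0, 0, 0, 0, 0],
   [1, 0, 0, 0, 1, 1, 1, 0, 1, 1, 0, 1, 0, 0, 0, 0, 1, 0, 0, 0, 0, 0, 0, 0],
   [1, 0, 0, 1, 1, 1, 0, 1, 1, 0, 1, 0, 0, 0, 0, 0, 0, 1, 0, 0, 0, 0, 0, 0],
   [1, 0, 1, 1, 1, 0, 1, 1, 0, 1, 0, 0, 0, 0, 0, 0, 0, 0, 1, 0, 0, 0, 0, 0],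
   [1, 1, 1, 1, 0, 1, 1, 0, 1, 0, 0, 0, 0, 0, 0, 0, 0, 0, 0, 1, 0, 0, 0, 0],
   [1, 1, 1, 0, 1, 1, 0, 1, 0, 0, 0, 1, 0, 0, 0, 0, 0, 0, 0, 0, 1, 0, 0, 0],
   [1, 1, 0, 1, 1, 0, 1, 0, 0, 0, 1, 1, 0, 0, 0, 0, 0, 0, 0, 0, 0, 1, 0, 0],
   [1, 0, 1, 1, 0, 1, 0, 0, 0, 1, 1, 1, 0, 0, 0, 0, 0, 0, 0, 0, 0, 0, 1, 0],
   [1, 1, 1, 0, 1, 0, 0, 0, 1, 1, 1, 0, 0, 0, 0, 0, 0, 0, 0, 0, 0, 0, 0, 1]]"

text \<open>A basis of the Leech lattice multiplied by sqrt 8: one entry 8, pairs of entries 4,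
  doubled words of \<open>golay_rows\<close>, and the odd vector (-3, 1, ..., 1). The rows are
  ordered to be triangular, so that the determinant is read off the diagonal.\<close>

definition leech_rows :: "int list list" where
  "leech_rows = [[8, 0, 0, 0, 0, 0, 0, 0, 0, 0, 0, 0, 0, 0, 0, 0, 0, 0, 0, 0, 0, 0, 0, 0],
   [4, 4, 0, 0, 0, 0, 0, 0, 0, 0, 0, 0, 0, 0, 0, 0, 0, 0, 0, 0, 0, 0, 0, 0],
   [4, 0, 4, 0, 0, 0, 0, 0, 0, 0, 0, 0, 0, 0, 0, 0, 0, 0, 0, 0, 0, 0, 0, 0],
   [4, 0, 0, 4, 0, 0, 0, 0, 0, 0, 0, 0, 0, 0, 0, 0, 0, 0, 0, 0, 0, 0, 0, 0],
   [4, 0, 0, 0, 4, 0, 0, 0, 0, 0, 0, 0, 0, 0, 0, 0, 0, 0, 0, 0, 0, 0, 0, 0],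
   [4, 0, 0, 0, 0, 4, 0, 0, 0, 0, 0, 0, 0, 0, 0, 0, 0, 0, 0, 0, 0, 0, 0, 0],
   [4, 0, 0, 0, 0, 0, 4, 0, 0, 0, 0, 0, 0, 0, 0, 0, 0, 0, 0, 0, 0, 0, 0, 0],
   [4, 0, 0, 0, 0, 0, 0, 4, 0, 0, 0, 0, 0, 0, 0, 0, 0, 0, 0, 0, 0, 0, 0, 0],
   [4, 0, 0, 0, 0, 0, 0, 0, 4, 0, 0, 0, 0, 0, 0, 0, 0, 0, 0, 0, 0, 0, 0, 0],
   [4, 0, 0, 0, 0, 0, 0, 0, 0, 4, 0, 0, 0, 0, 0, 0, 0, 0, 0, 0, 0, 0, 0, 0],
   [4, 0, 0, 0, 0, 0, 0, 0, 0, 0, 4, 0, 0, 0, 0, 0, 0, 0, 0, 0, 0, 0, 0, 0],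
   [4, 0, 0, 0, 0, 0, 0, 0, 0, 0, 0, 4, 0, 0, 0, 0, 0, 0, 0, 0, 0, 0, 0, 0],
   [0, 2, 2, 2, 2, 2, 2, 2, 2, 2, 2, 2, 2, 0, 0, 0, 0, 0, 0, 0, 0, 0, 0, 0],
   [2, 2, 0, 2, 0, 0, 0, 2, 2, 2, 0, 2, 0, 2, 0, 0, 0, 0, 0, 0, 0, 0, 0, 0],
   [2, 0, 2, 0, 0, 0, 2, 2, 2, 0, 2, 2, 0, 0, 2, 0, 0, 0, 0, 0, 0, 0, 0, 0],
   [2, 2, 0, 0, 0, 2, 2, 2, 0, 2, 2, 0, 0, 0, 0, 2, 0, 0, 0, 0, 0, 0, 0, 0],
   [2, 0, 0, 0, 2, 2, 2, 0, 2, 2, 0, 2, 0, 0, 0, 0, 2, 0, 0, 0, 0, 0, 0, 0],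
   [2, 0, 0, 2, 2, 2, 0, 2, 2, 0, 2, 0, 0, 0, 0, 0, 0, 2, 0, 0, 0, 0, 0, 0],
   [2, 0, 2, 2, 2, 0, 2, 2, 0, 2, 0, 0, 0, 0, 0, 0, 0, 0, 2, 0, 0, 0, 0, 0],
   [2, 2, 2, 2, 0, 2, 2, 0, 2, 0, 0, 0, 0, 0, 0, 0, 0, 0, 0, 2, 0, 0, 0, 0],
   [2, 2, 2, 0, 2, 2, 0, 2, 0, 0, 0, 2, 0, 0, 0, 0, 0, 0, 0, 0, 2, 0, 0, 0],
   [2, 2, 0, 2, 2, 0, 2, 0, 0, 0, 2, 2, 0, 0, 0, 0, 0, 0, 0, 0, 0, 2, 0, 0],
   [2, 0, 2, 2, 0, 2, 0, 0, 0, 2, 2, 2, 0, 0, 0, 0, 0, 0, 0, 0, 0, 0, 2, 0],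
   [-3, 1, 1, 1, 1, 1, 1, 1, 1, 1, 1, 1, 1, 1, 1, 1, 1, 1, 1, 1, 1, 1, 1, 1]]"

definition dot :: "int list \<Rightarrow> int list \<Rightarrow> int" where
  "dot xs ys = sum_list (map2 (*) xs ys)"

lemma leech_rows_length: "length leech_rows = 24" "list_all (\<lambda>r. length r = 24) leech_rows"
  and golay_rows_length: "length golay_rows = 24" "list_all (\<lambda>r. length r = 24) golay_rows"
  by code_simp+

text \<open>The divisors here and in \<open>leech_norms\<close> reflect the scaling: integral inner
  products become multiples of 8, even norms multiples of 16.\<close>

lemma leech_gram: "list_all (\<lambda>r. list_all (\<lambda>s. dot r s mod 8 = 0) leech_rows) leech_rows"
  by code_simp

lemma leech_norms: "list_all (\<lambda>r. dot r r mod 16 = 0) leech_rows"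
  by code_simp

lemma leech_golay: "list_all (\<lambda>h. list_all (\<lambda>r. dot h r mod 4 = 0) leech_rows) golay_rows"
  by code_simp

text \<open>Only the last row is odd, so its coefficient in a combination governs the coordinate sum
  modulo 8 and, by \<open>leech_parity\<close>, the parity of all coordinates at once.\<close>

lemma leech_sums: "list_all (\<lambda>k. (dot (replicate 24 1) (leech_rows ! k) - (if k = 23 then 4 else 0)) mod 8 = 0) [0..<24]"
  by code_simp

lemma leech_parity: "list_all (\<lambda>k. list_all (\<lambda>x. (x - (if k = 23 then 1 else 0)) mod 2 = 0) (leech_rows ! k)) [0..<24]"
  by code_simp

lemma leech_triangular: "list_all (\<lambda>k. list_all (\<lambda>c. leech_rows ! k ! c = 0) [Suc k..<24]) [0..<24]"
  by code_simp

lemma leech_diagonal: "prod_list (map (\<lambda>k. leech_rows ! k ! k) [0..<24]) = 8 ^ 12"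
  by code_simp

text \<open>After division by 8 these are norms 4 and 6: the first row attains the minimum, the
  second is a possible \<open>W\<close>.\<close>

lemma leech_short: "dot (leech_rows ! 1) (leech_rows ! 1) = 32" "dot (leech_rows ! 12) (leech_rows ! 12) = 48"
  by code_simp+

section \<open>No word of weight four passes the parity checks\<close>

definition golay_supp :: "nat \<Rightarrow> nat \<Rightarrow> bool" where "golay_supp s c \<longleftrightarrow> golay_rows ! s ! c = 1"

lemma golay_01: "list_all (list_all (\<lambda>x. x = 0 \<or> x = 1)) golay_rows"
  by code_simp

lemma golay_identity:
  "list_all (\<lambda>s. list_all (\<lambda>c. golay_supp s c = (s = c)) [0..<12]) [0..<12]"
  "list_all (\<lambda>s. list_all (\<lambda>c. golay_supp s c = (s = c)) [12..<24]) [12..<24]"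
  by code_simp+

text \<open>The thresholds 4 here and 3 in \<open>golay_pair\<close> exceed by one the number of
  ones left for the other half: three beside a single one, two beside a pair.\<close>

lemma golay_single:
  "list_all (\<lambda>b. length (filter (\<lambda>s. golay_supp s b) [0..<12]) \<ge> 4) [12..<24]"
  "list_all (\<lambda>b. length (filter (\<lambda>s. golay_supp s b) [12..<24]) \<ge> 4) [0..<12]"
  by code_simp+

lemma golay_pair:
  "list_all (\<lambda>b. list_all (\<lambda>c. b = c \<or> length (filter (\<lambda>s. golay_supp s b \<noteq> golay_supp s c) [0..<12]) \<ge> 3) [12..<24]) [12..<24]"
  "list_all (\<lambda>b. list_all (\<lambda>c. b = c \<or> length (filter (\<lambda>s. golay_supp s b \<noteq> golay_supp s c) [12..<24]) \<ge> 3) [0..<12]) [0..<12]"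
  by code_simp+

text \<open>
  The code with parity checks \<open>[I | B]\<close> and \<open>[B | I]\<close> has no word of weight four: one half of
  such a word has at most two ones, and the checks through the other half force too many ones there.
\<close>
lemma no_weight_four_half:
  assumes D: "finite P" "finite Q" "card P + card Q = 4" "card Q \<le> 2"
    and Q: "Q \<subseteq> set qs" and ps: "distinct ps" "P \<subseteq> set ps"
    and id: "\<And>s c. s \<in> set ps \<Longrightarrow> c \<in> P \<Longrightarrow> E s c = (s = c)"
    and par: "\<And>s. s \<in> set ps \<Longrightarrow> even (card {c \<in> P \<union> Q. E s c})" and disj: "P \<inter> Q = {}"
    and single: "\<And>b. b \<in> set qs \<Longrightarrow> length (filter (\<lambda>s. E s b) ps) \<ge> 4"
    and pair: "\<And>b c. b \<in> set qs \<Longrightarrow> c \<in> set qs \<Longrightarrow> b \<noteq> c \<Longrightarrow> length (filter (\<lambda>s. E s b \<noteq> E s c) ps) \<ge> 3"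
  shows False
proof -
  \<comment> \<open>On the identity half a check \<open>s\<close> sees position \<open>s\<close>
    only.\<close>
  have split: "card {c \<in> P \<union> Q. E s c} = (if s \<in> P then 1 else 0) + card {c \<in> Q. E s c}" if s: "s \<in> set ps" for s
  proof -
    have e: "{c \<in> P \<union> Q. E s c} = {c \<in> P. E s c} \<union> {c \<in> Q. E s c}" by blast
    have "{c \<in> P. E s c} = (if s \<in> P then {s} else {})" using id[OF s] by auto
    moreover have "card {c \<in> P \<union> Q. E s c} = card {c \<in> P. E s c} + card {c \<in> Q. E s c}"
      unfolding e by (rule card_Un_disjoint) (use D disj in auto)
    ultimately show ?thesis by simp
  qed
  \<comment> \<open>A check that is odd on \<open>Q\<close> can become even only through a one of
    \<open>P\<close> at position \<open>s\<close>, so there are at most \<open>card P\<close> such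
    checks.\<close>
  have big: "card {s \<in> set ps. F s} \<le> card P" if F: "\<And>s. s \<in> set ps \<Longrightarrow> F s \<Longrightarrow> odd (card {c \<in> Q. E s c})" for F
  proof (rule card_mono[OF D(1)], rule subsetI)
    fix s assume "s \<in> {s \<in> set ps. F s}"
    then have s: "s \<in> set ps" "odd (card {c \<in> Q. E s c})" using F by auto
    show "s \<in> P"
    proof (rule ccontr)
      assume "s \<notin> P"
      then show False using split[OF s(1)] par[OF s(1)] s(2) by simp
    qed
  qed
  have len: "length (filter F ps) = card {s \<in> set ps. F s}" for F
    using distinct_card[OF distinct_filter[OF ps(1), of F]] by simp
  have "card Q = 0 \<or> card Q = 1 \<or> card Q = 2" using D(4) by linarith
  then show False
  proof (elim disjE)
    assume "card Q = 0"
    then have Qe: "Q = {}" using D(2) by simp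
    then have "P \<noteq> {}" using D(3) by auto
    then obtain s where s: "s \<in> P" by blast
    then show False using split[of s] par[of s] ps(2) Qe by auto
  next
    assume c: "card Q = 1"
    then obtain b where b: "Q = {b}" by (rule card_1_singletonE)
    have "card {s \<in> set ps. E s b} \<le> card P"
    proof (rule big)
      fix s assume "E s b"
      then have "{c \<in> Q. E s c} = {b}" using b by auto
      then show "odd (card {c \<in> Q. E s c})" by simp
    qed
    then show False using single[of b] Q b c D(3) by (simp add: len)
  next
    assume c: "card Q = 2"
    then obtain b b' where b: "Q = {b, b'}" "b \<noteq> b'" by (auto simp: card_2_iff)
    have "card {s \<in> set ps. E s b \<noteq> E s b'} \<le> card P"
    proof (rule big)
      fix s assume "E s b \<noteq> E s b'"
      then have "{c \<in> Q. E s c} = {b} \<or> {c \<in> Q. E s c} = {b'}" using b by auto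
      then show "odd (card {c \<in> Q. E s c})" by auto
    qed
    then show False using pair[of b b'] Q b c D(3) by (simp add: len)
  qed
qed

lemma no_weight_four:
  assumes D: "D \<subseteq> {..<24}" "card D = 4" and par: "\<And>s. s < 24 \<Longrightarrow> even (card {c \<in> D. golay_supp s c})"
  shows False
proof -
  define P where "P = D \<inter> {..<12}"
  define Q where "Q = D \<inter> {12..<24}"
  have fD: "finite D" using D(1) by (rule finite_subset) simp
  have PQ: "P \<union> Q = D" "P \<inter> Q = {}" using D(1) by (auto simp: P_def Q_def)
  have fin: "finite P" "finite Q" using fD by (auto simp: P_def Q_def)
  have c: "card P + card Q = 4" using card_Un_disjoint[OF fin PQ(2)] PQ(1) D(2) by simp
  have sub: "P \<subseteq> set [0..<12]" "Q \<subseteq> set [12..<24]" unfolding P_def Q_def set_upt by auto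
  have c': "card Q + card P = 4" and QP: "Q \<inter> P = {}" using c PQ(2) by (simp_all add: Int_commute)
  note facts = golay_identity golay_single golay_pair
  note f = facts[unfolded list_all_iff]
  show False
  proof (cases "card Q \<le> 2")
    case True
    show False
    proof (rule no_weight_four_half[of P Q "[12..<24]" "[0..<12]" golay_supp])
      show "even (card {c \<in> P \<union> Q. golay_supp s c})" if "s \<in> set [0..<12]" for s
        using par[of s] that PQ(1) unfolding set_upt by simp
      show "golay_supp s c = (s = c)" if "s \<in> set [0..<12]" "c \<in> P" for s c
        using bspec[OF bspec[OF f(1) that(1)] subsetD[OF sub(1) that(2)]] .
      show "4 \<le> length (filter (\<lambda>s. golay_supp s b) [0..<12])" if "b \<in> set [12..<24]" for b
        using f(3) that by (rule bspec)
      show "3 \<le> length (filter (\<lambda>s. golay_supp s b \<noteq> golay_supp s c) [0..<12])"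
        if "b \<in> set [12..<24]" "c \<in> set [12..<24]" "b \<noteq> c" for b c
        using bspec[OF bspec[OF f(5) that(1)] that(2)] that(3) by blast
    qed (rule fin c True PQ(2) sub distinct_upt)+
  next
    case False
    then have "card P \<le> 2" using c by simp
    show False
    proof (rule no_weight_four_half[of Q P "[0..<12]" "[12..<24]" golay_supp])
      show "even (card {c \<in> Q \<union> P. golay_supp s c})" if "s \<in> set [12..<24]" for s
        using par[of s] that PQ(1) unfolding set_upt by (simp add: Un_commute)
      show "golay_supp s c = (s = c)" if "s \<in> set [12..<24]" "c \<in> Q" for s c
        using bspec[OF bspec[OF f(2) that(1)] subsetD[OF sub(2) that(2)]] .
      show "4 \<le> length (filter (\<lambda>s. golay_supp s b) [12..<24])" if "b \<in> set [0..<12]" for b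
        using f(4) that by (rule bspec)
      show "3 \<le> length (filter (\<lambda>s. golay_supp s b \<noteq> golay_supp s c) [12..<24])"
        if "b \<in> set [0..<12]" "c \<in> set [0..<12]" "b \<noteq> c" for b c
        using bspec[OF bspec[OF f(6) that(1)] that(2)] that(3) by blast
    qed (rule fin c' \<open>card P \<le> 2\<close> QP sub distinct_upt)+
  qed
qed

section \<open>Integral arithmetic of the basis\<close>

definition basis_entry :: "nat \<Rightarrow> nat \<Rightarrow> int" where "basis_entry k c = leech_rows ! k ! c"

lemma row_length: "k < 24 \<Longrightarrow> length (leech_rows ! k) = 24" "s < 24 \<Longrightarrow> length (golay_rows ! s) = 24"
  using leech_rows_length golay_rows_length by (auto simp: list_all_length)

lemma dot_sum: "length xs = 24 \<Longrightarrow> length ys = 24 \<Longrightarrow> dot xs ys = (\<Sum>c<24. xs ! c * ys ! c)"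
  by (simp add: dot_def sum_list_sum_nth atLeast0LessThan)

lemma basis_gram: "j < 24 \<Longrightarrow> k < 24 \<Longrightarrow> 8 dvd (\<Sum>c<24. basis_entry j c * basis_entry k c)"
  using leech_gram leech_rows_length(1)
  by (auto simp: list_all_length dot_sum row_length basis_entry_def mod_eq_0_iff_dvd)

lemma basis_norm: "j < 24 \<Longrightarrow> 16 dvd (\<Sum>c<24. basis_entry j c * basis_entry j c)"
  using leech_norms leech_rows_length(1)
  by (auto simp: list_all_length dot_sum row_length basis_entry_def mod_eq_0_iff_dvd)

lemma basis_golay: "s < 24 \<Longrightarrow> k < 24 \<Longrightarrow> 4 dvd (\<Sum>c<24. golay_rows ! s ! c * basis_entry k c)"
  using leech_golay leech_rows_length(1) golay_rows_length(1)
  by (auto simp: list_all_length dot_sum row_length basis_entry_def mod_eq_0_iff_dvd)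

lemma basis_sum: "k < 24 \<Longrightarrow> 8 dvd (\<Sum>c<24. basis_entry k c) - (if k = 23 then 4 else 0)"
  using leech_sums
  by (auto simp: list_all_iff dot_sum row_length basis_entry_def mod_eq_0_iff_dvd split: if_splits)

lemma basis_parity: "k < 24 \<Longrightarrow> c < 24 \<Longrightarrow> 2 dvd basis_entry k c - (if k = 23 then 1 else 0)"
  using leech_parity by (auto simp: list_all_iff all_set_conv_all_nth row_length basis_entry_def mod_eq_0_iff_dvd simp del: even_diff split: if_splits)

lemma basis_triangular: "k < c \<Longrightarrow> c < 24 \<Longrightarrow> basis_entry k c = 0"
  using leech_triangular by (auto simp: list_all_iff basis_entry_def)

lemma basis_diagonal: "(\<Prod>k<24. basis_entry k k) = 8 ^ 12"
proof -
  have "(\<Prod>k<24. basis_entry k k) = prod_list (map (\<lambda>k. leech_rows ! k ! k) [0..<24])"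
    by (simp add: basis_entry_def prod.distinct_set_conv_list[symmetric] atLeast0LessThan)
  then show ?thesis using leech_diagonal by simp
qed

text \<open>A numbering of the coordinates that respects the order of the index type, to which
  triangularity of a matrix refers.\<close>

definition ix :: "24 \<Rightarrow> nat" where "ix i = nat (Rep_bit0 i)"

lemma ix_bij: "bij_betw ix UNIV {..<24}"
proof (rule bij_betw_imageI)
  have r: "Rep_bit0 i \<in> {0..<24}" for i :: 24 using Rep_bit0[of i] by simp
  show "inj ix"
  proof (rule injI)
    fix i j assume "ix i = ix j"
    then have "Rep_bit0 i = Rep_bit0 j"
      using r[of i] r[of j] eq_nat_nat_iff[of "Rep_bit0 i" "Rep_bit0 j"] by (simp add: ix_def)
    then show "i = j" by (simp add: Rep_bit0_inject)
  qed
  show "range ix = {..<24}"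
  proof
    show "range ix \<subseteq> {..<24}" using r by (auto simp: ix_def nat_less_iff)
    show "{..<24} \<subseteq> range ix"
    proof
      fix n :: nat assume "n \<in> {..<24}"
      then have "Rep_bit0 (Abs_bit0 (int n) :: 24) = int n" by (intro Abs_bit0_inverse) simp
      then have "n = ix (Abs_bit0 (int n))" by (simp add: ix_def)
      then show "n \<in> range ix" by blast
    qed
  qed
qed

lemma ix_lt: "ix i < 24" using ix_bij by (auto simp: bij_betw_def)

lemma ix_less: "i < j \<Longrightarrow> ix i < ix j"
proof -
  assume "i < j"
  then have "Rep_bit0 i < Rep_bit0 j" by (simp add: less_bit0_def)
  moreover have "Rep_bit0 i \<ge> 0" using Rep_bit0[of i] by simp
  ultimately show ?thesis by (simp add: ix_def)
qed

lemma sum_ix: "(\<Sum>i\<in>UNIV. f (ix i)) = (\<Sum>c<24. f c)"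
  by (rule sum.reindex_bij_betw[OF ix_bij])

lemma prod_ix: "(\<Prod>i\<in>UNIV. f (ix i)) = (\<Prod>c<24. f c)"
  by (rule prod.reindex_bij_betw[OF ix_bij])

definition lift :: "(nat \<Rightarrow> int) \<Rightarrow> real ^ 24" where "lift X = (\<chi> i. of_int (X (ix i)) / sqrt 8)"

definition leech_matrix :: "real ^ 24 ^ 24" where "leech_matrix = (\<chi> i j. of_int (basis_entry (ix j) (ix i)) / sqrt 8)"

definition combination :: "(nat \<Rightarrow> int) \<Rightarrow> nat \<Rightarrow> int" where
  "combination z c = (\<Sum>k<24. z k * basis_entry k c)"

definition Leech :: "(real ^ 24) set" where "Leech = {leech_matrix *v z | z. \<forall>i. z $ i \<in> \<int>}"

lemma lift_inner: "lift X \<bullet> lift Y = of_int (\<Sum>c<24. X c * Y c) / 8"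
proof -
  have "lift X \<bullet> lift Y = (\<Sum>i\<in>UNIV. of_int (X (ix i) * Y (ix i)) / 8)"
    by (simp add: lift_def inner_vec_def)
  also have "\<dots> = (\<Sum>c<24. of_int (X c * Y c) / 8)" by (rule sum_ix)
  finally show ?thesis by (simp add: sum_divide_distrib)
qed

lemma Leech_eq: "Leech = range (\<lambda>z. lift (combination z))"
proof -
  have m: "leech_matrix *v z = lift (combination z')" if "\<And>i. z $ i = of_int (z' (ix i))" for z z'
  proof -
    have "(leech_matrix *v z) $ i = lift (combination z') $ i" for i
    proof -
      have "(leech_matrix *v z) $ i = (\<Sum>j\<in>UNIV. of_int (z' (ix j) * basis_entry (ix j) (ix i)) / sqrt 8)"
        unfolding matrix_vector_mult_def leech_matrix_def by (simp add: that mult.commute)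
      also have "\<dots> = (\<Sum>k<24. of_int (z' k * basis_entry k (ix i)) / sqrt 8)" by (rule sum_ix)
      finally show ?thesis by (simp add: lift_def combination_def sum_divide_distrib)
    qed
    then show ?thesis by (simp add: vec_eq_iff)
  qed
  show ?thesis
  proof
    show "Leech \<subseteq> range (\<lambda>z. lift (combination z))"
    proof
      fix x assume "x \<in> Leech"
      then obtain z :: "real ^ 24" where z: "x = leech_matrix *v z" "\<And>i. z $ i \<in> \<int>" by (auto simp: Leech_def)
      define z' where "z' n = \<lfloor>z $ (inv_into UNIV ix n)\<rfloor>" for n
      have "z $ i = of_int (z' (ix i))" for i
        using z(2)[of i] ix_bij by (auto simp: z'_def bij_betw_def elim: Ints_cases)
      then show "x \<in> range (\<lambda>z. lift (combination z))" using m[of z z'] z(1) by blast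
    qed
    show "range (\<lambda>z. lift (combination z)) \<subseteq> Leech"
    proof (rule image_subsetI)
      fix z' :: "nat \<Rightarrow> int"
      define z :: "real ^ 24" where "z = (\<chi> i. of_int (z' (ix i)))"
      have "lift (combination z') = leech_matrix *v z" by (rule m[symmetric]) (simp add: z_def)
      then show "lift (combination z') \<in> Leech" by (auto simp: Leech_def z_def)
    qed
  qed
qed

lemma combination_weighted: "(\<Sum>c<24. w c * combination z c) = (\<Sum>k<24. z k * (\<Sum>c<24. w c * basis_entry k c))"
  unfolding combination_def sum_distrib_left by (subst sum.swap) (simp add: mult_ac)

lemma combination_inner: "8 dvd (\<Sum>c<24. combination y c * combination z c)"
proof -
  have *: "8 dvd (\<Sum>c<24. combination y c * basis_entry k c)" if "k < 24" for k
  proof -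
    have "(\<Sum>c<24. combination y c * basis_entry k c) = (\<Sum>l<24. y l * (\<Sum>c<24. basis_entry k c * basis_entry l c))"
      using combination_weighted[of "basis_entry k" y] by (simp only: mult.commute)
    also have "8 dvd \<dots>" using that by (intro dvd_sum dvd_mult basis_gram) simp_all
    finally show ?thesis .
  qed
  show ?thesis unfolding combination_weighted[of "combination y"] by (intro dvd_sum dvd_mult *) simp
qed

text \<open>Induction over partial combinations: a new term adds a square divisible by 16 and twice
  a product divisible by 8.\<close>

lemma combination_norm: "16 dvd (\<Sum>c<24. combination z c * combination z c)"
proof -
  define part where "part m c = (\<Sum>k<m. z k * basis_entry k c)" for m c
  have p: "8 dvd (\<Sum>c<24. part m c * basis_entry k c)" if "m \<le> 24" "k < 24" for m k
  proof -
    have "(\<Sum>c<24. part m c * basis_entry k c) = (\<Sum>l<m. z l * (\<Sum>c<24. basis_entry l c * basis_entry k c))"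
      unfolding part_def sum_distrib_left sum_distrib_right by (subst sum.swap) (simp add: mult_ac)
    also have "8 dvd \<dots>" using that by (intro dvd_sum dvd_mult basis_gram) auto
    finally show ?thesis .
  qed
  have "16 dvd (\<Sum>c<24. part m c * part m c)" if "m \<le> 24" for m
    using that
  proof (induction m)
    case (Suc m)
    have "(\<Sum>c<24. part (Suc m) c * part (Suc m) c) = (\<Sum>c<24. part m c * part m c) + 2 * z m * (\<Sum>c<24. part m c * basis_entry m c) + (z m)\<^sup>2 * (\<Sum>c<24. basis_entry m c * basis_entry m c)"
      by (simp add: part_def sum.distrib sum_distrib_left algebra_simps power2_eq_square)
    moreover have "16 dvd 2 * z m * (\<Sum>c<24. part m c * basis_entry m c)"
    proof -
      obtain q where "(\<Sum>c<24. part m c * basis_entry m c) = 8 * q" using p[of m m] Suc.prems by (auto elim: dvdE)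
      then show ?thesis by simp
    qed
    ultimately show ?case using Suc basis_norm[of m] by (auto intro!: dvd_add)
  qed (simp add: part_def)
  from this[of 24] show ?thesis by (simp add: part_def combination_def)
qed

lemma sum_delta_23: "(\<Sum>k<24. z k * (if k = 23 then a else 0)) = z (23 :: nat) * (a :: int)"
proof -
  have "(\<Sum>k<24. z k * (if k = 23 then a else 0)) = (\<Sum>k<(24::nat). if k = 23 then z 23 * a else 0)"
    by (intro sum.cong) auto
  then show ?thesis by simp
qed

lemma combination_parity: "c < 24 \<Longrightarrow> 2 dvd combination z c - z 23"
proof -
  assume c: "c < 24"
  have "combination z c - z 23 = (\<Sum>k<24. z k * (basis_entry k c - (if k = 23 then 1 else 0)))"
    by (simp only: combination_def right_diff_distrib sum_subtractf sum_delta_23 mult_1_right)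
  also have "2 dvd \<dots>" by (intro dvd_sum dvd_mult basis_parity c) simp
  finally show ?thesis .
qed

lemma combination_sum: "8 dvd (\<Sum>c<24. combination z c) - 4 * z 23"
proof -
  have "(\<Sum>c<24. combination z c) - 4 * z 23 = (\<Sum>k<24. z k * ((\<Sum>c<24. basis_entry k c) - (if k = 23 then 4 else 0)))"
    using combination_weighted[of "\<lambda>_. 1" z] by (simp only: right_diff_distrib sum_subtractf sum_delta_23 mult_1_left mult.commute[of 4])
  also have "8 dvd \<dots>" by (intro dvd_sum dvd_mult basis_sum) simp
  finally show ?thesis .
qed

lemma combination_golay: "s < 24 \<Longrightarrow> 4 dvd (\<Sum>c<24. golay_rows ! s ! c * combination z c)"
  unfolding combination_weighted by (intro dvd_sum dvd_mult basis_golay) simp_all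

text \<open>An odd vector has 24 nonzero coordinates, so its norm is at least 24. An even one is
  halved to a vector of norm 4: a single entry 2 or -2 violates the coordinate sum modulo 4, and
  four entries 1 or -1 would form a word of weight four passing all parity checks.\<close>

lemma combination_min: "(\<Sum>c<24. combination z c * combination z c) \<noteq> 16"
proof
  let ?X = "combination z"
  assume n: "(\<Sum>c<24. ?X c * ?X c) = 16"
  have "even (z 23)"
  proof (rule ccontr)
    assume "odd (z 23)"
    then have oX: "odd (?X c)" if "c < 24" for c using combination_parity[OF that, of z] by auto
    have "?X c * ?X c \<ge> 1" if "c < 24" for c
    proof -
      have "?X c \<noteq> 0" using oX[OF that] by auto
      then have "0 < ?X c * ?X c" by (simp add: zero_less_mult_iff) linarith
      then show ?thesis by simp
    qed
    then have "(\<Sum>c<24. ?X c * ?X c) \<ge> (\<Sum>c<(24::nat). 1)" by (intro sum_mono) auto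
    then show False using n by simp
  qed
  then have "even (?X c)" if "c < 24" for c using combination_parity[OF that, of z] by auto
  then have XY: "?X c = 2 * (?X c div 2)" if "c < 24" for c using that by simp
  define Y where "Y c = ?X c div 2" for c
  have X: "?X c = 2 * Y c" if "c < 24" for c using XY[OF that] by (simp add: Y_def)
  have "(\<Sum>c<24. ?X c * ?X c) = (\<Sum>c<24. 4 * (Y c * Y c))" by (intro sum.cong refl) (simp add: X)
  then have Y4: "(\<Sum>c<24. Y c * Y c) = 4" using n by (simp add: sum_distrib_left[symmetric])
  have "(\<Sum>c<24. ?X c) = 2 * (\<Sum>c<24. Y c)" unfolding sum_distrib_left by (intro sum.cong refl) (simp add: X)
  \<comment> \<open>The sum is congruent to four times the coefficient of the odd row, which is even
    here.\<close>
  moreover have "8 dvd (\<Sum>c<24. ?X c)"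
    using combination_sum[of z] \<open>even (z 23)\<close> by (auto elim!: evenE) presburger
  ultimately have Ysum: "4 dvd (\<Sum>c<24. Y c)" by presburger
  have Ypar: "even (\<Sum>c<24. golay_rows ! s ! c * Y c)" if "s < 24" for s
  proof -
    have "(\<Sum>c<24. golay_rows ! s ! c * ?X c) = 2 * (\<Sum>c<24. golay_rows ! s ! c * Y c)"
      unfolding sum_distrib_left by (intro sum.cong refl) (simp add: X)
    then show ?thesis using combination_golay[OF that, of z] by presburger
  qed
  show False
  proof (cases "\<exists>c<24. \<bar>Y c\<bar> \<ge> 2")
    case True
    then obtain c where c: "c < 24" "\<bar>Y c\<bar> \<ge> 2" by blast
    have s: "(\<Sum>c<24. Y c * Y c) = Y c * Y c + (\<Sum>c\<in>{..<24} - {c}. Y c * Y c)"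
      using c(1) by (intro sum.remove) auto
    have nn: "(\<Sum>c\<in>{..<24} - {c}. Y c * Y c) \<ge> 0" by (intro sum_nonneg) simp
    have sq: "Y c * Y c \<ge> 4" using mult_mono[OF c(2) c(2)] by simp
    have z: "(\<Sum>c\<in>{..<24} - {c}. Y c * Y c) = 0" "Y c * Y c = 4" using s nn sq Y4 by linarith+
    then have "Y d = 0" if "d \<in> {..<24} - {c}" for d
      using that by (subst (asm) sum_nonneg_eq_0_iff) auto
    then have "(\<Sum>c<24. Y c) = Y c" using c(1) sum.remove[of "{..<24}" c Y] by simp
    moreover have "\<bar>Y c\<bar> < 3"
    proof (rule ccontr)
      assume "\<not> \<bar>Y c\<bar> < 3"
      then have "3 * 3 \<le> \<bar>Y c\<bar> * \<bar>Y c\<bar>" by (intro mult_mono) auto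
      then show False using z(2) by simp
    qed
    ultimately have "4 dvd Y c" "\<bar>Y c\<bar> = 2" using Ysum c(2) by auto
    then show False by presburger
  next
    case False
    define D where "D = {c. c < 24 \<and> Y c \<noteq> 0}"
    have Y01: "Y c = 0 \<or> Y c = 1 \<or> Y c = -1" if "c < 24" for c using False that by force
    have "(\<Sum>c<24. Y c * Y c) = (\<Sum>c<24. if Y c \<noteq> 0 then 1 else 0)"
    proof (rule sum.cong[OF refl])
      fix c :: nat assume "c \<in> {..<24}"
      then show "Y c * Y c = (if Y c \<noteq> 0 then 1 else 0)" using Y01[of c] by auto
    qed
    also have "\<dots> = int (card D)" by (simp add: D_def sum.If_cases Int_def)
    finally have card: "card D = 4" using Y4 by simp
    have par: "even (card {c \<in> D. golay_supp s c})" if s: "s < 24" for s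
    proof -
      have h: "golay_rows ! s ! c = (if golay_supp s c then 1 else 0)" if "c < 24" for c
        using golay_01[unfolded list_all_length, rule_format, of s c] golay_rows_length(1) row_length(2)[OF s] s that
        by (auto simp: golay_supp_def)
      have "even ((\<Sum>c<24. golay_rows ! s ! c * Y c) - (\<Sum>c<24. if golay_supp s c \<and> Y c \<noteq> 0 then 1 else 0))"
        unfolding sum_subtractf[symmetric]
      proof (rule dvd_sum)
        fix c :: nat assume "c \<in> {..<24}"
        then show "even (golay_rows ! s ! c * Y c - (if golay_supp s c \<and> Y c \<noteq> 0 then 1 else 0))"
          using h[of c] Y01[of c] by auto
      qed
      then have "even (\<Sum>c<24. if golay_supp s c \<and> Y c \<noteq> 0 then 1 else 0 :: int)"
        using Ypar[OF s] by simp
      also have "(\<Sum>c<24. if golay_supp s c \<and> Y c \<noteq> 0 then 1 else 0 :: int) = int (card ({..<24} \<inter> {c. golay_supp s c \<and> Y c \<noteq> 0}))"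
        by (simp add: sum.If_cases)
      also have "{..<24} \<inter> {c. golay_supp s c \<and> Y c \<noteq> 0} = {c \<in> D. golay_supp s c}" by (auto simp: D_def)
      finally show ?thesis by simp
    qed
    show False by (rule no_weight_four[OF _ card par]) (auto simp: D_def)
  qed
qed

lemma row_in_Leech:
  assumes "k < 24"
  shows "lift (basis_entry k) \<in> Leech"
proof -
  have "combination (\<lambda>l. if l = k then 1 else 0) = basis_entry k"
    using assms by (simp add: combination_def fun_eq_iff if_distrib[of "\<lambda>x. x * _"] cong: if_cong)
  moreover have "lift (combination (\<lambda>l. if l = k then 1 else 0)) \<in> Leech"
    unfolding Leech_eq by (rule rangeI)
  ultimately show ?thesis by simp
qed

lemma Leech_lattice: "leech_lattice Leech"
proof -
  have det: "\<bar>det leech_matrix\<bar> = 1"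
  proof -
    have "det leech_matrix = (\<Prod>i\<in>UNIV. leech_matrix $ i $ i)"
      by (rule det_upperdiagonal) (simp add: leech_matrix_def basis_triangular ix_less ix_lt)
    also have "\<dots> = (\<Prod>i\<in>UNIV. of_int (basis_entry (ix i) (ix i)) / sqrt 8)" by (simp add: leech_matrix_def)
    also have "\<dots> = (\<Prod>k<24. of_int (basis_entry k k) / sqrt 8)" by (rule prod_ix)
    also have "\<dots> = of_int (\<Prod>k<24. basis_entry k k) / sqrt 8 ^ 24" by (simp add: prod_dividef)
    also have "sqrt 8 ^ 24 = (sqrt 8 ^ 2) ^ 12" by (simp only: power_mult[symmetric]) simp
    also have "\<dots> = (8 :: real) ^ 12" by simp
    finally show ?thesis unfolding basis_diagonal by simp
  qed
  have int: "x \<bullet> y \<in> \<int>" if xy: "x \<in> Leech" "y \<in> Leech" for x y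
  proof -
    obtain a b where "x = lift (combination a)" "y = lift (combination b)" using xy by (auto simp: Leech_eq)
    moreover obtain q where "(\<Sum>c<24. combination a c * combination b c) = 8 * q"
      using combination_inner[of a b] by (rule dvdE)
    ultimately show ?thesis by (simp add: lift_inner)
  qed
  have even: "\<exists>k :: int. x \<bullet> x = 2 * of_int k" and min: "x \<bullet> x \<ge> 4 \<or> x = 0" if x: "x \<in> Leech" for x
  proof -
    obtain a where a: "x = lift (combination a)" using x by (auto simp: Leech_eq)
    obtain q where q: "(\<Sum>c<24. combination a c * combination a c) = 16 * q"
      using combination_norm[of a] by (rule dvdE)
    have xx: "x \<bullet> x = 2 * of_int q" unfolding a lift_inner q by simp
    then show "\<exists>k :: int. x \<bullet> x = 2 * of_int k" by blast
    \<comment> \<open>Evenness leaves 2 as the only norm strictly between 0 and 4; scaled by 8 it is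
      the excluded 16.\<close>
    have "q \<noteq> 1" using q combination_min[of a] by auto
    show "x \<bullet> x \<ge> 4 \<or> x = 0"
    proof (cases "x = 0")
      case False
      then have "x \<bullet> x > 0" by simp
      then have "q > 0" unfolding xx by simp
      then have "q \<ge> 2" using \<open>q \<noteq> 1\<close> by simp
      then show ?thesis unfolding xx by simp
    qed simp
  qed
  have n: "lift (basis_entry 1) \<bullet> lift (basis_entry 1) = 4"
    unfolding lift_inner using leech_short(1) by (simp add: dot_sum row_length basis_entry_def)
  show ?thesis
    unfolding leech_lattice_def even_unimodular_lattice_def
  proof (intro conjI ballI impI)
    show "\<exists>A :: real ^ 24 ^ 24. \<bar>det A\<bar> = 1 \<and> Leech = {A *v z | z. \<forall>i. z $ i \<in> \<int>}"
      using det unfolding Leech_def by blast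
    show "\<exists>x\<in>Leech. x \<bullet> x = 4" using n row_in_Leech[of 1] by auto
  qed (use int even min in auto)
qed

lemma Leech_norm_6: "\<exists>W\<in>Leech. norm W = sqrt 6"
proof
  have "lift (basis_entry 12) \<bullet> lift (basis_entry 12) = 6"
    unfolding lift_inner using leech_short(2) by (simp add: dot_sum row_length basis_entry_def)
  then show "norm (lift (basis_entry 12)) = sqrt 6" by (simp add: norm_eq_sqrt_inner)
qed (rule row_in_Leech, simp)

section \<open>Shells of the Leech lattice\<close>

locale even_rootless_lattice = self_dual_lattice \<Lambda> for \<Lambda> :: "(real ^ 24) set" +
  assumes even: "x \<in> \<Lambda> \<Longrightarrow> \<exists>k::int. x \<bullet> x = 2 * of_int k"
    and rootless: "x \<in> \<Lambda> \<Longrightarrow> x \<noteq> 0 \<Longrightarrow> x \<bullet> x \<ge> 4"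
begin

definition shell :: "nat \<Rightarrow> (real ^ 24) set" where "shell m = {u \<in> \<Lambda>. u \<bullet> u = 2 * real m}"

lemma shell_cover: "u \<in> \<Lambda> \<Longrightarrow> \<exists>m. u \<in> shell m"
proof -
  assume u: "u \<in> \<Lambda>"
  then obtain k :: int where k: "u \<bullet> u = 2 * of_int k" using even by blast
  then have "k \<ge> 0" using inner_ge_zero[of u] by simp
  then have "u \<bullet> u = 2 * real (nat k)" using k by simp
  then show ?thesis using u by (auto simp: shell_def)
qed

text \<open>All vectors of a shell contribute the same positive amount to a convergent sum.\<close>

lemma finite_shell: "finite (shell m)"
proof -
  define e where "e = exp (- pi * (2 * real m))"
  define S where "S = (\<Sum>\<^sub>\<infinity>u\<in>\<Lambda>. exp (- pi * 1 * (u \<bullet> u)))"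
  have s: "(\<lambda>u. exp (- pi * 1 * (u \<bullet> u))) summable_on \<Lambda>" by (rule lattice_poisson(1)) simp
  have "finite (shell m) \<and> card (shell m) \<le> nat \<lceil>S / e\<rceil>"
  proof (rule finite_if_finite_subsets_card_bdd)
    show "card G \<le> nat \<lceil>S / e\<rceil>" if G: "G \<subseteq> shell m" "finite G" for G
    proof -
      have "real (card G) * e = (\<Sum>u\<in>G. exp (- pi * 1 * (u \<bullet> u)))"
        using G(1) by (simp add: e_def shell_def subset_iff)
      also have "\<dots> \<le> S"
        unfolding S_def using G by (intro finite_sum_le_infsum s) (auto simp: shell_def)
      finally have "real (card G) \<le> S / e" by (simp add: e_def pos_le_divide_eq)
      then show ?thesis by linarith
    qed
  qed
  then show ?thesis ..
qed

lemma shell_0: "shell 0 = {0}"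
  using zero by (auto simp: shell_def)

lemma shell_1: "shell 1 = {}"
  using rootless by (force simp: shell_def)

lemma shell_bij: "bij_betw snd (SIGMA m:UNIV. shell m) \<Lambda>"
proof (rule bij_betw_imageI)
  show "inj_on snd (SIGMA m:UNIV. shell m)" by (auto simp: inj_on_def shell_def)
  show "snd ` (SIGMA m:UNIV. shell m) = \<Lambda>"
  proof
    show "snd ` (SIGMA m:UNIV. shell m) \<subseteq> \<Lambda>" by (auto simp: shell_def)
    show "\<Lambda> \<subseteq> snd ` (SIGMA m:UNIV. shell m)"
    proof
      fix u assume "u \<in> \<Lambda>"
      then obtain m where "u \<in> shell m" using shell_cover by blast
      then have "(m, u) \<in> (SIGMA m:UNIV. shell m)" by simp
      then show "u \<in> snd ` (SIGMA m:UNIV. shell m)" by (metis image_eqI snd_conv)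
    qed
  qed
qed

definition wt :: "real \<Rightarrow> real ^ 24 \<Rightarrow> real" where "wt t u = exp (- pi * t * (u \<bullet> u))"

text \<open>Completing the square trades half of the Gaussian for the linear exponential.\<close>

lemma wt_exp_summable:
  assumes t: "t > 0" and r: "r \<ge> 0"
  shows "(\<lambda>u. wt t u * exp (r * norm u)) summable_on \<Lambda>"
proof -
  define q where "q = pi * t"
  have q: "q > 0" using t by (simp add: q_def)
  define C where "C = exp (r\<^sup>2 / (2 * q))"
  have "(\<lambda>u. C * exp (- pi * (t / 2) * (u \<bullet> u))) summable_on \<Lambda>"
    by (intro summable_on_cmult_right lattice_poisson(1)) (use t in simp)
  then show ?thesis
  proof (rule summable_on_comparison_test)
    fix u :: "real ^ 24"
    define x where "x = norm u"
    have x2: "u \<bullet> u = x\<^sup>2" by (simp add: x_def power2_norm_eq_inner)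
    have "0 \<le> (q * x - r)\<^sup>2 / (2 * q)" using q by simp
    also have "\<dots> = r\<^sup>2 / (2 * q) + (q * x\<^sup>2) / 2 - r * x"
      using q by (simp add: power2_eq_square field_simps)
    finally have "- (q * x\<^sup>2) + r * x \<le> r\<^sup>2 / (2 * q) + - ((q * x\<^sup>2) / 2)" by simp
    then have "exp (- (q * x\<^sup>2) + r * x) \<le> exp (r\<^sup>2 / (2 * q) + - ((q * x\<^sup>2) / 2))" by simp
    then show "wt t u * exp (r * norm u) \<le> C * exp (- pi * (t / 2) * (u \<bullet> u))"
      unfolding C_def wt_def x2 exp_add x_def[symmetric] by (simp add: q_def)
  qed (simp add: wt_def)
qed

definition mom :: "real \<Rightarrow> real ^ 24 \<Rightarrow> nat \<Rightarrow> complex" where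
  "mom t a n = (\<Sum>\<^sub>\<infinity>u\<in>\<Lambda>. complex_of_real (wt t u * (u \<bullet> a) ^ n))"

text \<open>The theta series at the modular parameter i t, with elliptic variable \<open>z\<close>
  in the direction \<open>a\<close>. Its Taylor coefficients in \<open>z\<close> are
  \<open>mom t a n / fact n\<close>.\<close>

definition TH :: "real \<Rightarrow> real ^ 24 \<Rightarrow> complex \<Rightarrow> complex" where
  "TH t a z = (\<Sum>\<^sub>\<infinity>u\<in>\<Lambda>. of_real (wt t u) * exp (z * of_real (u \<bullet> a)))"

text \<open>Absolute convergence in both variables allows the lattice sum and the exponential series
  to be exchanged.\<close>

lemma double_summable:
  assumes t: "t > 0"
  shows "(\<lambda>(u, n). norm (complex_of_real (wt t u) * (z * of_real (u \<bullet> a)) ^ n /\<^sub>R fact n)) summable_on \<Lambda> \<times> UNIV"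
proof -
  have hs: "((\<lambda>n. norm (complex_of_real (wt t u) * (z * of_real (u \<bullet> a)) ^ n /\<^sub>R fact n)) has_sum wt t u * exp (norm z * \<bar>u \<bullet> a\<bar>)) UNIV" for u
  proof (rule sums_nonneg_imp_has_sum)
    have "(\<lambda>n. wt t u * ((norm z * \<bar>u \<bullet> a\<bar>) ^ n /\<^sub>R fact n)) sums (wt t u * exp (norm z * \<bar>u \<bullet> a\<bar>))"
      by (intro sums_mult exp_converges)
    then show "(\<lambda>n. norm (complex_of_real (wt t u) * (z * of_real (u \<bullet> a)) ^ n /\<^sub>R fact n)) sums (wt t u * exp (norm z * \<bar>u \<bullet> a\<bar>))"
      by (simp add: norm_mult norm_power wt_def mult_ac)
  qed simp
  have "(\<lambda>u. wt t u * exp ((norm z * norm a) * norm u)) summable_on \<Lambda>"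
    by (rule wt_exp_summable[OF t]) simp
  then have s: "(\<lambda>u. wt t u * exp (norm z * \<bar>u \<bullet> a\<bar>)) summable_on \<Lambda>"
  proof (rule summable_on_comparison_test)
    fix u
    have "norm z * \<bar>u \<bullet> a\<bar> \<le> norm z * (norm a * norm u)"
      using Cauchy_Schwarz_ineq2[of u a] by (intro mult_left_mono) (simp_all add: mult.commute)
    then show "wt t u * exp (norm z * \<bar>u \<bullet> a\<bar>) \<le> wt t u * exp ((norm z * norm a) * norm u)"
      by (simp add: wt_def mult.assoc)
  qed (simp add: wt_def)
  have "(\<lambda>p. norm ((\<lambda>(u, n). complex_of_real (wt t u) * (z * of_real (u \<bullet> a)) ^ n /\<^sub>R fact n) p)) summable_on (SIGMA u:\<Lambda>. UNIV)"
  proof (subst Infinite_Sum.abs_summable_on_Sigma_iff, intro conjI ballI)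
    show "(\<lambda>n. norm ((\<lambda>(u, n). complex_of_real (wt t u) * (z * of_real (u \<bullet> a)) ^ n /\<^sub>R fact n) (u, n))) summable_on UNIV" for u
      using has_sum_imp_summable[OF hs[of u]] by (simp only: prod.case)
    show "(\<lambda>u. norm (\<Sum>\<^sub>\<infinity>n. norm ((\<lambda>(u, n). complex_of_real (wt t u) * (z * of_real (u \<bullet> a)) ^ n /\<^sub>R fact n) (u, n)))) summable_on \<Lambda>"
      unfolding prod.case infsumI[OF hs] using s by (simp add: wt_def)
  qed
  then show ?thesis by (simp only: case_prod_unfold)
qed

lemma TH_sums:
  assumes t: "t > 0"
  shows "(\<lambda>n. mom t a n / fact n * z ^ n) sums TH t a z"
proof -
  define G where "G u n = complex_of_real (wt t u) * (z * of_real (u \<bullet> a)) ^ n /\<^sub>R fact n" for u n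
  have "(\<lambda>p. norm (case p of (u, n) \<Rightarrow> G u n)) summable_on \<Lambda> \<times> UNIV"
    using double_summable[OF t, of z a] by (simp only: G_def case_prod_unfold)
  then have sG: "(\<lambda>(u, n). G u n) summable_on \<Lambda> \<times> UNIV" by (rule abs_summable_summable)
  then have sG': "(\<lambda>(n, u). G u n) summable_on UNIV \<times> \<Lambda>"
    by (subst (asm) summable_on_swap) (simp only: prod.case case_prod_unfold fst_conv snd_conv)
  have inner: "(\<Sum>\<^sub>\<infinity>n. G u n) = of_real (wt t u) * exp (z * of_real (u \<bullet> a))" if u: "u \<in> \<Lambda>" for u
  proof -
    have "G u summable_on UNIV" using summable_on_SigmaD1[OF sG u] .
    then have "(G u has_sum (\<Sum>\<^sub>\<infinity>n. G u n)) UNIV" by (rule has_sum_infsum)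
    then have 1: "G u sums (\<Sum>\<^sub>\<infinity>n. G u n)" by (rule has_sum_imp_sums)
    have "(\<lambda>n. of_real (wt t u) * ((z * of_real (u \<bullet> a)) ^ n /\<^sub>R fact n)) sums (of_real (wt t u) * exp (z * of_real (u \<bullet> a)))"
      by (intro sums_mult exp_converges)
    then have 2: "G u sums (of_real (wt t u) * exp (z * of_real (u \<bullet> a)))"
      by (simp only: G_def[abs_def] mult_scaleR_right)
    from 1 2 show ?thesis by (rule sums_unique2)
  qed
  have outer: "(\<Sum>\<^sub>\<infinity>u\<in>\<Lambda>. G u n) = mom t a n / fact n * z ^ n" for n
  proof -
    have "(\<Sum>\<^sub>\<infinity>u\<in>\<Lambda>. G u n) = (\<Sum>\<^sub>\<infinity>u\<in>\<Lambda>. (z ^ n / fact n) * complex_of_real (wt t u * (u \<bullet> a) ^ n))"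
      by (rule infsum_cong) (simp add: G_def power_mult_distrib scaleR_conv_of_real field_simps)
    also have "\<dots> = (z ^ n / fact n) * mom t a n" unfolding mom_def by (rule infsum_cmult_right')
    finally show ?thesis by simp
  qed
  have "((\<lambda>n. \<Sum>\<^sub>\<infinity>u\<in>\<Lambda>. G u n) has_sum (\<Sum>\<^sub>\<infinity>n. \<Sum>\<^sub>\<infinity>u\<in>\<Lambda>. G u n)) UNIV"
    by (rule has_sum_infsum) (rule summable_on_Sigma_banach[OF sG'])
  moreover have "(\<Sum>\<^sub>\<infinity>n. \<Sum>\<^sub>\<infinity>u\<in>\<Lambda>. G u n) = TH t a z"
  proof -
    have "(\<Sum>\<^sub>\<infinity>n. \<Sum>\<^sub>\<infinity>u\<in>\<Lambda>. G u n) = (\<Sum>\<^sub>\<infinity>u\<in>\<Lambda>. \<Sum>\<^sub>\<infinity>n. G u n)"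
      by (rule infsum_swap_banach[OF sG'])
    also have "\<dots> = TH t a z" unfolding TH_def by (rule infsum_cong) (rule inner)
    finally show ?thesis .
  qed
  ultimately have "((\<lambda>n. mom t a n / fact n * z ^ n) has_sum TH t a z) UNIV" by (simp only: outer)
  then show ?thesis by (rule has_sum_imp_sums)
qed

lemma mom_summable:
  assumes t: "t > 0"
  shows "(\<lambda>u. norm (complex_of_real (wt t u * (u \<bullet> a) ^ n))) summable_on \<Lambda>"
proof -
  have "(\<lambda>(n, u). norm (of_real (wt t u) * (1 * of_real (u \<bullet> a)) ^ n /\<^sub>R fact n :: complex)) summable_on UNIV \<times> \<Lambda>"
    using double_summable[OF t, of 1 a] by (subst (asm) summable_on_swap) (simp only: prod.case case_prod_unfold fst_conv snd_conv)
  from summable_on_SigmaD1[OF this, of n]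
  have "(\<lambda>u. norm (of_real (wt t u) * (1 * of_real (u \<bullet> a)) ^ n /\<^sub>R fact n :: complex)) summable_on \<Lambda>" by simp
  from summable_on_cmult_right[OF this, of "fact n"] show ?thesis
    by (simp add: norm_mult norm_power abs_mult power_abs mult.assoc[symmetric])
qed

text \<open>Poisson summation with y = s a. Expanding the square of w - s a splits off a Gaussian in
  s and leaves a theta series at 1 / t with a real exponent.\<close>

lemma TH_functional:
  assumes t: "t > 0" and a: "norm a = 1"
  shows "TH t a (complex_of_real (2 * pi) * \<i> * of_real s) = complex_of_real ((1 / t ^ 12) * exp (- pi * s\<^sup>2 / t)) * TH (1 / t) a (complex_of_real (2 * pi / t) * of_real s)"
proof -
  have "TH t a (complex_of_real (2 * pi) * \<i> * of_real s) = (\<Sum>\<^sub>\<infinity>u\<in>\<Lambda>. exp (- pi * t * (u \<bullet> u)) * cis (2 * pi * (u \<bullet> (s *\<^sub>R a))))"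
    unfolding TH_def wt_def by (rule infsum_cong) (simp add: cis_conv_exp mult_ac)
  also have "\<dots> = complex_of_real ((1 / sqrt t) ^ CARD(24)) * (\<Sum>\<^sub>\<infinity>w\<in>\<Lambda>. complex_of_real (exp (- pi * ((w - s *\<^sub>R a) \<bullet> (w - s *\<^sub>R a)) / t)))"
    by (rule lattice_poisson(3)[OF t])
  also have "(1 / sqrt t) ^ CARD(24) = 1 / t ^ 12"
  proof -
    have "sqrt t ^ 24 = ((sqrt t)\<^sup>2) ^ 12" by (simp only: power_mult[symmetric]) simp
    then show ?thesis using t by (simp add: power_divide)
  qed
  also have "(\<Sum>\<^sub>\<infinity>w\<in>\<Lambda>. complex_of_real (exp (- pi * ((w - s *\<^sub>R a) \<bullet> (w - s *\<^sub>R a)) / t))) =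
      (\<Sum>\<^sub>\<infinity>w\<in>\<Lambda>. complex_of_real (exp (- pi * s\<^sup>2 / t)) * (complex_of_real (wt (1 / t) w) * exp (complex_of_real (2 * pi / t) * of_real s * of_real (w \<bullet> a))))"
  proof (rule infsum_cong)
    fix w
    have aa: "a \<bullet> a = 1" using a by (simp add: norm_eq_1)
    have "(w - s *\<^sub>R a) \<bullet> (w - s *\<^sub>R a) = w \<bullet> w - 2 * s * (w \<bullet> a) + s\<^sup>2"
      by (simp add: inner_diff_left inner_diff_right inner_commute aa power2_eq_square)
    note e = this
    have "- pi * ((w - s *\<^sub>R a) \<bullet> (w - s *\<^sub>R a)) / t = - pi * s\<^sup>2 / t + (- pi * (1 / t) * (w \<bullet> w) + 2 * pi / t * s * (w \<bullet> a))"
      unfolding e using t by (simp add: field_simps)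
    then have "exp (- pi * ((w - s *\<^sub>R a) \<bullet> (w - s *\<^sub>R a)) / t) = exp (- pi * s\<^sup>2 / t) * (wt (1 / t) w * exp (2 * pi / t * s * (w \<bullet> a)))"
      by (simp only: exp_add wt_def)
    then have "complex_of_real (exp (- pi * ((w - s *\<^sub>R a) \<bullet> (w - s *\<^sub>R a)) / t)) = of_real (exp (- pi * s\<^sup>2 / t)) * (of_real (wt (1 / t) w) * of_real (exp (2 * pi / t * s * (w \<bullet> a))))"
      by (simp only: of_real_mult)
    then show "complex_of_real (exp (- pi * ((w - s *\<^sub>R a) \<bullet> (w - s *\<^sub>R a)) / t)) =
      complex_of_real (exp (- pi * s\<^sup>2 / t)) * (complex_of_real (wt (1 / t) w) * exp (complex_of_real (2 * pi / t) * of_real s * of_real (w \<bullet> a)))"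
      by (simp only: exp_of_real[symmetric] of_real_mult)
  qed
  also have "\<dots> = of_real (exp (- pi * s\<^sup>2 / t)) * TH (1 / t) a (complex_of_real (2 * pi / t) * of_real s)"
    unfolding TH_def by (rule infsum_cmult_right')
  finally show ?thesis by (simp add: mult.assoc)
qed

text \<open>On shell \<open>m\<close> the Gaussian weight is the m-th power of exp (-2 pi t), so a
  moment is a power series in the nome, with the power sums over the shells as coefficients.\<close>

lemma shell_expansion:
  assumes t: "t > 0"
  shows "(\<lambda>m. (\<Sum>u\<in>shell m. complex_of_real ((u \<bullet> a) ^ n)) * of_real (exp (- 2 * pi * t)) ^ m) sums mom t a n"
proof -
  define f where "f u = complex_of_real (wt t u * (u \<bullet> a) ^ n)" for u
  have s: "f summable_on \<Lambda>" unfolding f_def by (rule abs_summable_summable[OF mom_summable[OF t]])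
  have sg: "(\<lambda>(m, u). f u) summable_on (SIGMA m:UNIV. shell m)"
    using summable_on_reindex_bij_betw[OF shell_bij, of f] s by (simp add: case_prod_unfold)
  have e: "(\<Sum>\<^sub>\<infinity>u\<in>shell m. f u) = (\<Sum>u\<in>shell m. complex_of_real ((u \<bullet> a) ^ n)) * of_real (exp (- 2 * pi * t)) ^ m" for m
  proof -
    have "wt t u = exp (- 2 * pi * t) ^ m" if "u \<in> shell m" for u
      using that by (simp add: wt_def shell_def exp_of_nat_mult[symmetric] mult_ac)
    then have "(\<Sum>u\<in>shell m. f u) = (\<Sum>u\<in>shell m. complex_of_real ((u \<bullet> a) ^ n) * of_real (exp (- 2 * pi * t)) ^ m)"
      by (intro sum.cong refl) (simp add: f_def)
    then show ?thesis by (simp add: infsum_finite[OF finite_shell] sum_distrib_right)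
  qed
  have "((\<lambda>m. \<Sum>\<^sub>\<infinity>u\<in>shell m. f u) has_sum (\<Sum>\<^sub>\<infinity>m. \<Sum>\<^sub>\<infinity>u\<in>shell m. f u)) UNIV"
    by (rule has_sum_infsum) (rule summable_on_Sigma_banach[OF sg])
  moreover have "(\<Sum>\<^sub>\<infinity>m. \<Sum>\<^sub>\<infinity>u\<in>shell m. f u) = mom t a n"
  proof -
    have "(\<Sum>\<^sub>\<infinity>m. \<Sum>\<^sub>\<infinity>u\<in>shell m. f u) = (\<Sum>\<^sub>\<infinity>(m, u)\<in>(SIGMA m:UNIV. shell m). f u)"
      by (rule infsum_Sigma'_banach[OF sg])
    also have "\<dots> = (\<Sum>\<^sub>\<infinity>u\<in>\<Lambda>. f u)"
      using infsum_reindex_bij_betw[OF shell_bij, of f] by (simp add: case_prod_unfold)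
    finally show ?thesis by (simp add: mom_def f_def)
  qed
  ultimately have "((\<lambda>m. (\<Sum>u\<in>shell m. complex_of_real ((u \<bullet> a) ^ n)) * of_real (exp (- 2 * pi * t)) ^ m) has_sum mom t a n) UNIV"
    by (simp only: e)
  then show ?thesis by (rule has_sum_imp_sums)
qed

lemma powser_leading_limit:
  fixes \<alpha> :: "nat \<Rightarrow> complex"
  assumes s: "\<And>x. (\<lambda>n. \<alpha> n * x ^ n) sums f x" and z: "\<And>j. j < d \<Longrightarrow> \<alpha> j = 0"
  shows "((\<lambda>x. f x / x ^ d) \<longlongrightarrow> \<alpha> d) (at 0)"
proof -
  have "((\<lambda>x. f x / x ^ d) \<longlongrightarrow> (\<lambda>n. \<alpha> (n + d)) 0) (at 0)"
  proof (rule powser_limit_0_strong[of 1])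
    fix x :: complex assume x: "x \<noteq> 0"
    have "(\<lambda>n. \<alpha> (n + d) * x ^ (n + d)) sums (f x - (\<Sum>j<d. \<alpha> j * x ^ j))"
      by (rule sums_split_initial_segment[OF s])
    also have "(\<Sum>j<d. \<alpha> j * x ^ j) = 0" using z by simp
    finally have "(\<lambda>n. \<alpha> (n + d) * x ^ (n + d) / x ^ d) sums ((f x - 0) / x ^ d)" by (rule sums_divide)
    then show "(\<lambda>n. \<alpha> (n + d) * x ^ n) sums (f x / x ^ d)" using x by (simp add: power_add)
  qed simp
  then show ?thesis by simp
qed

text \<open>
  The difference of the theta series with linear terms in two directions of equal length is a Jacobi form
  (in the elliptic variable \<open>s\<close>), whose first non-vanishing Taylor coefficient transforms like a modular form.
\<close>
lemma leading_coefficient_inversion: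
  assumes a: "norm a = 1" "norm a' = 1"
    and z: "\<And>j t. j < d \<Longrightarrow> t > 0 \<Longrightarrow> mom t a j = mom t a' j" and t: "t > 0"
  shows "mom (1 / t) a d - mom (1 / t) a' d = (\<i> * of_real t) ^ (12 + d) * (mom t a d - mom t a' d)"
proof -
  define M where "M t n = mom t a n - mom t a' n" for t n
  have t': "1 / t > 0" using t by simp
  have sM: "(\<lambda>n. (M t n / fact n * c ^ n) * x ^ n) sums (TH t a (c * x) - TH t a' (c * x))" if "t > 0" for t c x
    using sums_diff[OF TH_sums[OF that, of a "c * x"] TH_sums[OF that, of a' "c * x"]]
    by (simp add: M_def power_mult_distrib diff_divide_distrib algebra_simps)
  have M0: "M t j = 0" if "j < d" "t > 0" for t j using z[OF that] by (simp add: M_def)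
  define f where "f x = TH t a (complex_of_real (2 * pi) * \<i> * x) - TH t a' (complex_of_real (2 * pi) * \<i> * x)" for x
  define g where "g x = TH (1 / t) a (complex_of_real (2 * pi / t) * x) - TH (1 / t) a' (complex_of_real (2 * pi / t) * x)" for x
  have f: "((\<lambda>x. f x / x ^ d) \<longlongrightarrow> M t d / fact d * (complex_of_real (2 * pi) * \<i>) ^ d) (at 0)"
  proof (rule powser_leading_limit)
    show "(\<lambda>n. (M t n / fact n * (complex_of_real (2 * pi) * \<i>) ^ n) * x ^ n) sums f x" for x
      unfolding f_def by (rule sM[OF t])
    show "M t j / fact j * (complex_of_real (2 * pi) * \<i>) ^ j = 0" if "j < d" for j
      by (simp add: M0[OF that t])
  qed
  have g: "((\<lambda>x. g x / x ^ d) \<longlongrightarrow> M (1 / t) d / fact d * complex_of_real (2 * pi / t) ^ d) (at 0)"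
  proof (rule powser_leading_limit)
    show "(\<lambda>n. (M (1 / t) n / fact n * complex_of_real (2 * pi / t) ^ n) * x ^ n) sums g x" for x
      unfolding g_def by (rule sM[OF t'])
    show "M (1 / t) j / fact j * complex_of_real (2 * pi / t) ^ j = 0" if "j < d" for j
      by (simp add: M0[OF that t'])
  qed
  have r: "filterlim complex_of_real (at 0) (at 0)"
    by (auto intro!: filterlim_atI tendsto_eq_intros simp: eventually_at_filter)
  have f': "((\<lambda>s. f (of_real s) / of_real s ^ d) \<longlongrightarrow> M t d / fact d * (complex_of_real (2 * pi) * \<i>) ^ d) (at 0)"
    by (rule filterlim_compose[OF f r])
  have g': "((\<lambda>s. g (of_real s) / of_real s ^ d) \<longlongrightarrow> M (1 / t) d / fact d * complex_of_real (2 * pi / t) ^ d) (at 0)"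
    by (rule filterlim_compose[OF g r])
  \<comment> \<open>The Gaussian factor tends to 1, so only t^(-12) enters the transformation of the
    leading coefficient.\<close>
  have e: "((\<lambda>s. complex_of_real ((1 / t ^ 12) * exp (- pi * s\<^sup>2 / t))) \<longlongrightarrow> complex_of_real ((1 / t ^ 12) * exp (- pi * 0\<^sup>2 / t))) (at 0)"
    by (intro tendsto_intros) (use t in auto)
  have "((\<lambda>s. complex_of_real ((1 / t ^ 12) * exp (- pi * s\<^sup>2 / t)) * (g (of_real s) / of_real s ^ d)) \<longlongrightarrow>
      complex_of_real ((1 / t ^ 12) * exp (- pi * 0\<^sup>2 / t)) * (M (1 / t) d / fact d * complex_of_real (2 * pi / t) ^ d)) (at 0)"
    by (rule tendsto_mult[OF e g'])
  moreover have "complex_of_real ((1 / t ^ 12) * exp (- pi * s\<^sup>2 / t)) * (g (of_real s) / of_real s ^ d) = f (of_real s) / of_real s ^ d" for s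
    unfolding f_def g_def TH_functional[OF t a(1)] TH_functional[OF t a(2)] by (simp add: right_diff_distrib diff_divide_distrib)
  ultimately have "((\<lambda>s. f (of_real s) / of_real s ^ d) \<longlongrightarrow> complex_of_real ((1 / t ^ 12) * exp (- pi * 0\<^sup>2 / t)) * (M (1 / t) d / fact d * complex_of_real (2 * pi / t) ^ d)) (at (0 :: real))"
    by simp
  from tendsto_unique[OF _ f' this]
  have "M t d / fact d * (complex_of_real (2 * pi) * \<i>) ^ d = complex_of_real (1 / t ^ 12) * (M (1 / t) d / fact d * complex_of_real (2 * pi / t) ^ d)" by simp
  then have "M t d * (complex_of_real (2 * pi) * \<i>) ^ d = complex_of_real (1 / t ^ 12) * (M (1 / t) d * complex_of_real (2 * pi / t) ^ d)" by (simp add: field_simps)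
  then have "M t d * (2 * of_real pi) ^ d * \<i> ^ d = M (1 / t) d * (2 * of_real pi) ^ d / (of_real t ^ 12 * of_real t ^ d)"
    by (simp add: power_mult_distrib power_divide mult_ac)
  then have "(2 * of_real pi) ^ d * (M t d * \<i> ^ d) = (2 * of_real pi) ^ d * (M (1 / t) d / of_real t ^ (12 + d))"
    by (simp only: power_add mult_ac times_divide_eq_right)
  then have "M t d * \<i> ^ d = M (1 / t) d / of_real t ^ (12 + d)"
    by (rule mult_left_cancel[THEN iffD1, rotated]) simp
  then have "M (1 / t) d = \<i> ^ d * of_real t ^ (12 + d) * M t d" using t by (simp add: field_simps)
  \<comment> \<open>Since \<open>\<i> ^ 12\<close> is 1, the factor is absorbed into the power of i
    t required of weight 12 + d.\<close>
  also have "\<i> ^ d = \<i> ^ (12 + d)"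
  proof -
    have "\<i> ^ 12 = (\<i>\<^sup>2) ^ 6" by (simp only: power_mult[symmetric]) simp
    then show ?thesis by (simp add: power_add)
  qed
  finally show ?thesis by (simp add: M_def power_mult_distrib)
qed

text \<open>Strong induction on the degree: agreement in all lower degrees makes the difference a
  leading coefficient, of weight 12 + d <= 20. Its expansion begins with the zero vector, which
  contributes equally in both directions, and with the empty shell of roots, so
  \<open>low_weight_form.coeff_zero\<close> annihilates every shell's contribution.\<close>

lemma mom_direction:
  assumes a: "norm a = 1" "norm a' = 1" and d: "d \<le> 8"
  shows "(\<forall>t>0. mom t a d = mom t a' d) \<and> (\<forall>m. (\<Sum>u\<in>shell m. (u \<bullet> a) ^ d) = (\<Sum>u\<in>shell m. (u \<bullet> a') ^ d))"
  using d
proof (induction d rule: less_induct)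
  case (less d)
  define c where "c m = (\<Sum>u\<in>shell m. complex_of_real ((u \<bullet> a) ^ d)) - (\<Sum>u\<in>shell m. complex_of_real ((u \<bullet> a') ^ d))" for m
  have sums: "(\<lambda>m. c m * of_real (exp (- 2 * pi * t)) ^ m) sums (mom t a d - mom t a' d)" if "t > 0" for t
    using sums_diff[OF shell_expansion[OF that, of a d] shell_expansion[OF that, of a' d]]
    by (simp add: c_def left_diff_distrib)
  have zero: "mom t a j = mom t a' j" if "j < d" "t > 0" for j t
    using less.IH[OF that(1)] less.prems that by simp
  have "c m = 0" for m
  proof (rule low_weight_form.coeff_zero[of c "12 + d"], unfold_locales)
    fix q :: complex assume q: "norm q < 1"
    \<comment> \<open>A radius between |q| and 1 has the form exp (-2 pi t), where convergence is
      known; this gives convergence at \<open>q\<close>.\<close>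
    define r where "r = (1 + norm q) / 2"
    have r: "0 < r" "norm q < r" "r < 1" using q by (auto simp: r_def add_pos_nonneg)
    define t where "t = - ln r / (2 * pi)"
    have "ln r < 0" using r by simp
    then have "t > 0" unfolding t_def by (intro divide_pos_pos) simp_all
    moreover have "exp (- 2 * pi * t) = r" using r by (simp add: t_def)
    ultimately have "summable (\<lambda>m. c m * complex_of_real r ^ m)" using sums_summable[OF sums] by metis
    then show "summable (\<lambda>m. c m * q ^ m)" by (rule powser_inside) (use r in simp)
  next
    show "c 0 = 0" by (simp add: c_def shell_0)
    show "c 1 = 0" by (simp add: c_def shell_1[unfolded One_nat_def])
    show "12 + d \<le> 20" using less.prems by simp
    fix t :: real assume t: "t > 0"
    have t': "1 / t > 0" using t by simp
    have "(\<Sum>m. c m * complex_of_real (exp (- 2 * pi / t)) ^ m) = mom (1 / t) a d - mom (1 / t) a' d"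
      using sums_unique[OF sums[OF t']] by simp
    also have "\<dots> = (\<i> * of_real t) ^ (12 + d) * (mom t a d - mom t a' d)"
      by (rule leading_coefficient_inversion[OF a zero t])
    also have "mom t a d - mom t a' d = (\<Sum>m. c m * complex_of_real (exp (- 2 * pi * t)) ^ m)"
      by (rule sums_unique[OF sums[OF t]])
    finally show "(\<Sum>m. c m * complex_of_real (exp (- 2 * pi / t)) ^ m) = (\<i> * of_real t) ^ (12 + d) * (\<Sum>m. c m * complex_of_real (exp (- 2 * pi * t)) ^ m)" .
  qed
  note c0 = this
  have "mom t a d = mom t a' d" if "t > 0" for t
  proof -
    have "(\<lambda>m. 0 :: complex) sums (mom t a d - mom t a' d)" using sums[OF that] by (simp add: c0)
    from sums_unique2[OF this sums_zero] show ?thesis by simp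
  qed
  moreover have "(\<Sum>u\<in>shell m. (u \<bullet> a) ^ d) = (\<Sum>u\<in>shell m. (u \<bullet> a') ^ d)" for m
  proof -
    have "complex_of_real (\<Sum>u\<in>shell m. (u \<bullet> a) ^ d) = complex_of_real (\<Sum>u\<in>shell m. (u \<bullet> a') ^ d)"
      using c0[of m] unfolding c_def by simp
    then show ?thesis by (rule of_real_eq_iff[THEN iffD1])
  qed
  ultimately show ?case by blast
qed

section \<open>Moments of the shells\<close>

definition shell_moment :: "nat \<Rightarrow> nat \<Rightarrow> real" where
  "shell_moment m d = (\<Sum>u\<in>shell m. (u \<bullet> axis undefined 1) ^ d)"

theorem shell_moment:
  assumes "d \<le> 8"
  shows "(\<Sum>u\<in>shell m. (u \<bullet> x) ^ d) = shell_moment m d * norm x ^ d"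
proof (cases "x = 0")
  case True
  then show ?thesis by (cases "d = 0") (simp_all add: shell_moment_def)
next
  case False
  define a where "a = x /\<^sub>R norm x"
  have a: "norm a = 1" using False by (simp add: a_def)
  have x: "x = norm x *\<^sub>R a" using False by (simp add: a_def)
  have "(\<Sum>u\<in>shell m. (u \<bullet> x) ^ d) = (\<Sum>u\<in>shell m. norm x ^ d * (u \<bullet> a) ^ d)"
    by (subst x) (simp add: power_mult_distrib)
  also have "\<dots> = norm x ^ d * (\<Sum>u\<in>shell m. (u \<bullet> a) ^ d)" by (rule sum_distrib_left[symmetric])
  also have "(\<Sum>u\<in>shell m. (u \<bullet> a) ^ d) = shell_moment m d"
    unfolding shell_moment_def using mom_direction[OF a _ assms, of "axis undefined 1"] by (simp add: norm_axis_1)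
  finally show ?thesis by simp
qed

lemma radial_functional_shell: "radial_functional (\<lambda>h. \<Sum>u\<in>shell m. h u) (2 * real m)"
proof
  fix f :: "real ^ 24 \<Rightarrow> real"
  have "(\<Sum>u\<in>shell m. (u \<bullet> u) * f u) = (\<Sum>u\<in>shell m. 2 * real m * f u)"
    by (rule sum.cong[OF refl]) (simp add: shell_def)
  then show "(\<Sum>u\<in>shell m. (u \<bullet> u) * f u) = 2 * real m * (\<Sum>u\<in>shell m. f u)"
    by (simp only: sum_distrib_left)
qed (simp_all add: sum.distrib sum_distrib_left)

lemma shell_moment_Suc:
  assumes "2 * Suc e \<le> 8"
  shows "shell_moment m (2 * Suc e) * real (24 + 2 * e) = 2 * real m * real (2 * e + 1) * shell_moment m (2 * e)"
  using radial_functional.moment_recursion[OF radial_functional_shell, where c = "shell_moment m (2 * Suc e)" and c' = "shell_moment m (2 * e)" and e = e, OF shell_moment shell_moment] assms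
  by simp

lemma shell_moment_0: "shell_moment m 0 = real (card (shell m))"
  by (simp add: shell_moment_def)

end

section \<open>The derived code\<close>

lemma det_Ints:
  fixes M :: "real ^ 'n ^ 'n"
  assumes "\<And>i j. M $ i $ j \<in> \<int>"
  shows "det M \<in> \<int>"
  unfolding det_def by (intro Ints_sum Ints_mult Ints_prod assms) auto

text \<open>For x in the dual, A^T x is integral, and the Gram matrix A^T A is integral with
  determinant 1. Cramer's rule gives an integral z with A^T A z = A^T x, and injectivity of A^T
  yields x = A z.\<close>

lemma even_unimodular_self_dual:
  fixes \<Lambda> :: "(real ^ 'n) set"
  assumes "even_unimodular_lattice \<Lambda>"
  shows "self_dual_lattice \<Lambda>"
proof -
  obtain A :: "real ^ 'n ^ 'n" where A: "\<bar>det A\<bar> = 1" "\<Lambda> = {A *v z | z. \<forall>i. z $ i \<in> \<int>}"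
    using assms unfolding even_unimodular_lattice_def by blast
  have int: "x \<bullet> y \<in> \<int>" if "x \<in> \<Lambda>" "y \<in> \<Lambda>" for x y
    using assms that unfolding even_unimodular_lattice_def by blast
  have mem: "A *v z \<in> \<Lambda>" if "\<And>i. z $ i \<in> \<int>" for z :: "real ^ 'n" using that unfolding A(2) by blast
  have col: "A *v axis i 1 \<in> \<Lambda>" for i by (rule mem) (simp add: axis_def)
  have lin: "linear ((*v) A)" by (rule matrix_vector_mul_linear)
  have adj: "(transpose A *v x) \<bullet> y = x \<bullet> (A *v y)" for x y
    by (simp add: transpose_matrix_vector dot_lmul_matrix)
  have detA: "det A \<noteq> 0" using A(1) by auto
  show ?thesis
  proof
    show "0 \<in> \<Lambda>" using mem[of 0] by simp
    show "x + y \<in> \<Lambda>" if xy: "x \<in> \<Lambda>" "y \<in> \<Lambda>" for x y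
    proof -
      obtain a b :: "real ^ 'n" where "x = A *v a" "y = A *v b" "\<And>i. a $ i \<in> \<int>" "\<And>i. b $ i \<in> \<int>" using xy unfolding A(2) by blast
      then show ?thesis using mem[of "a + b"] by (simp add: matrix_vector_right_distrib)
    qed
    show "- x \<in> \<Lambda>" if x: "x \<in> \<Lambda>" for x
    proof -
      obtain a :: "real ^ 'n" where "x = A *v a" "\<And>i. a $ i \<in> \<int>" using x unfolding A(2) by blast
      then show ?thesis using mem[of "- a"] linear_neg[OF lin, of a] by simp
    qed
    show "x \<bullet> y \<in> \<int>" if "x \<in> \<Lambda>" "y \<in> \<Lambda>" for x y using int[OF that] .
    show "span \<Lambda> = UNIV"
    proof -
      have "x \<in> span \<Lambda>" for x
      proof -
        have "invertible A" using detA by (simp add: invertible_det_nz)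
        then obtain A' where A': "A ** A' = mat 1" unfolding invertible_def by blast
        define y where "y = A' *v x"
        have y: "x = A *v y" by (simp add: y_def matrix_vector_mul_assoc A')
        have "y = (\<Sum>i\<in>UNIV. y $ i *\<^sub>R axis i 1)"
          using basis_expansion[of y] by (simp add: scalar_mult_eq_scaleR)
        then have "x = A *v (\<Sum>i\<in>UNIV. y $ i *\<^sub>R axis i 1)" using y by simp
        also have "\<dots> = (\<Sum>i\<in>UNIV. y $ i *\<^sub>R (A *v axis i 1))"
          by (simp add: linear_sum[OF lin] linear_scale[OF lin])
        also have "\<dots> \<in> span \<Lambda>" by (intro span_sum span_scale span_base col)
        finally show ?thesis .
      qed
      then show ?thesis by blast
    qed
    show "x \<in> \<Lambda>" if x: "\<And>y. y \<in> \<Lambda> \<Longrightarrow> x \<bullet> y \<in> \<int>" for x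
    proof -
      define G where "G = transpose A ** A"
      define m where "m = transpose A *v x"
      have mi: "m $ i \<in> \<int>" for i
        using adj[of x "axis i 1"] x[OF col[of i]] by (simp add: m_def inner_axis)
      have Gi: "G $ i $ j \<in> \<int>" for i j
      proof -
        have "G $ i $ j = (G *v axis j 1) \<bullet> axis i 1"
          by (simp add: inner_axis matrix_vector_mult_basis column_def)
        also have "\<dots> = (A *v axis j 1) \<bullet> (A *v axis i 1)"
          unfolding G_def matrix_vector_mul_assoc[symmetric] by (rule adj)
        also have "\<dots> \<in> \<int>" by (intro int col)
        finally show ?thesis .
      qed
      have detG: "det G = 1"
      proof -
        have "det G = det A * det A" by (simp add: G_def det_mul)
        also have "\<dots> = \<bar>det A\<bar> * \<bar>det A\<bar>" by simp
        finally show ?thesis by (simp add: A(1))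
      qed
      define z where "z = (\<chi> k. det (\<chi> i j. if j = k then m $ i else G $ i $ j) / det G)"
      have Gz: "G *v z = m" using cramer[of G z m] detG by (simp add: z_def)
      have "z $ k \<in> \<int>" for k
        unfolding z_def using detG by (auto intro!: det_Ints mi Gi)
      then have "A *v z \<in> \<Lambda>" by (rule mem)
      moreover have "transpose A *v (A *v z) = transpose A *v x"
        using Gz by (simp add: G_def m_def matrix_vector_mul_assoc)
      moreover have "inj ((*v) (transpose A))"
        using detA by (simp add: inj_matrix_vector_mult invertible_det_nz)
      ultimately show ?thesis by (metis injD)
    qed
  qed
qed

lemma leech_even_rootless: "leech_lattice \<Lambda> \<Longrightarrow> even_rootless_lattice \<Lambda>"
proof -
  assume L: "leech_lattice \<Lambda>"
  then have e: "even_unimodular_lattice \<Lambda>" by (simp add: leech_lattice_def)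
  interpret self_dual_lattice \<Lambda> using e by (rule even_unimodular_self_dual)
  show ?thesis
  proof
    show "\<exists>k::int. x \<bullet> x = 2 * of_int k" if "x \<in> \<Lambda>" for x
      using e that unfolding even_unimodular_lattice_def by blast
    show "x \<bullet> x \<ge> 4" if "x \<in> \<Lambda>" "x \<noteq> 0" for x
      using L that unfolding leech_lattice_def by blast
  qed
qed

section \<open>Minimal vectors sorted by an inner product\<close>

context even_rootless_lattice
begin

abbreviation "S \<equiv> shell 2"

lemma S_iff: "u \<in> S \<longleftrightarrow> u \<in> \<Lambda> \<and> u \<bullet> u = 4"
  by (simp add: shell_def)

lemma S_minus: "u \<in> S \<Longrightarrow> - u \<in> S"
  using minus by (simp add: S_iff)

lemma S_moments:
  "shell_moment 2 0 = card S" "shell_moment 2 2 = card S / 6" "shell_moment 2 4 = card S / 13"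
  "shell_moment 2 6 = 5 * card S / 91" "shell_moment 2 8 = 2 * card S / 39"
proof -
  show 0: "shell_moment 2 0 = card S" by (rule shell_moment_0)
  show 2: "shell_moment 2 2 = card S / 6" using shell_moment_Suc[of 0 2] 0 by (simp add: numeral_eq_Suc)
  show 4: "shell_moment 2 4 = card S / 13" using shell_moment_Suc[of 1 2] 2 by (simp add: numeral_eq_Suc)
  show 6: "shell_moment 2 6 = 5 * card S / 91" using shell_moment_Suc[of 2 2] 4 by (simp add: numeral_eq_Suc)
  show "shell_moment 2 8 = 2 * card S / 39" using shell_moment_Suc[of 3 2] 6 by (simp add: numeral_eq_Suc)
qed

definition level :: "real ^ 24 \<Rightarrow> int \<Rightarrow> (real ^ 24) set" where
  "level W v = {u \<in> S. u \<bullet> W = of_int v}"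

lemma finite_level [simp]: "finite (level W v)"
  unfolding level_def using finite_shell[of 2] by simp

lemma level_sum:
  assumes V: "finite V" "\<And>u. u \<in> S \<Longrightarrow> \<exists>v\<in>V. u \<bullet> W = of_int v"
  shows "(\<Sum>u\<in>S. (u \<bullet> W) ^ i * g u) = (\<Sum>v\<in>V. of_int v ^ i * (\<Sum>u\<in>level W v. g u))"
proof -
  have fl: "\<lfloor>u \<bullet> W\<rfloor> \<in> V" "of_int \<lfloor>u \<bullet> W\<rfloor> = u \<bullet> W" if "u \<in> S" for u using V(2)[OF that] by auto
  have "(\<Sum>u\<in>S. (u \<bullet> W) ^ i * g u) = (\<Sum>v\<in>V. \<Sum>u\<in>{u \<in> S. \<lfloor>u \<bullet> W\<rfloor> = v}. (u \<bullet> W) ^ i * g u)"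
    by (rule sum.group[symmetric]) (use V(1) fl finite_shell in auto)
  also have "\<dots> = (\<Sum>v\<in>V. of_int v ^ i * (\<Sum>u\<in>level W v. g u))"
  proof (rule sum.cong[OF refl])
    fix v assume "v \<in> V"
    have "{u \<in> S. \<lfloor>u \<bullet> W\<rfloor> = v} = level W v" using fl(2) unfolding level_def by force
    then show "(\<Sum>u\<in>{u \<in> S. \<lfloor>u \<bullet> W\<rfloor> = v}. (u \<bullet> W) ^ i * g u) = of_int v ^ i * (\<Sum>u\<in>level W v. g u)"
      unfolding sum_distrib_left by (intro sum.cong) (auto simp: level_def)
  qed
  finally show ?thesis .
qed

lemma level_minus_sum: "(\<Sum>u\<in>level W (- v). g u) = (\<Sum>u\<in>level W v. g (- u))"
  by (rule sum.reindex_bij_witness[of _ uminus uminus]) (auto simp: level_def S_minus)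

lemma level_card_minus: "card (level W (- v)) = card (level W v)"
  using level_minus_sum[of "\<lambda>_. 1 :: nat" W v] by simp

lemma int_bound_square:
  fixes v :: int
  assumes "(of_int v :: real)\<^sup>2 \<le> b" "b < (of_int (n + 1))\<^sup>2" "n \<ge> 0"
  shows "v \<in> {- n..n}"
proof -
  have "\<bar>real_of_int v\<bar> < \<bar>of_int (n + 1)\<bar>"
    using assms(1,2) by (intro power2_less_imp_less[of "\<bar>_\<bar>"]) auto
  then show ?thesis using assms(3) by auto
qed

lemma level_values:
  assumes W: "W \<in> \<Lambda>" "W \<bullet> W = b" "4 * b < (of_int (n + 1))\<^sup>2" "n \<ge> 0" and u: "u \<in> S"
  shows "\<exists>v\<in>{-n..n}. u \<bullet> W = of_int v"
proof -
  obtain v :: int where v: "u \<bullet> W = of_int v" using integral[of u W] u W(1) by (auto simp: S_iff elim: Ints_cases)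
  have "(u \<bullet> W)\<^sup>2 \<le> (u \<bullet> u) * (W \<bullet> W)" by (rule Cauchy_Schwarz_ineq)
  then have "(of_int v :: real)\<^sup>2 \<le> 4 * b" using u W(2) by (simp add: v S_iff)
  then have "v \<in> {-n..n}" using W(3,4) by (rule int_bound_square)
  then show ?thesis using v by blast
qed

text \<open>For such a vector \<open>u\<close> the norm of u - W would lie strictly between 0 and
  4.\<close>

lemma level_empty:
  assumes "W \<in> \<Lambda>" "0 < 4 + W \<bullet> W - 2 * of_int v" "4 + W \<bullet> W - 2 * of_int v < 4"
  shows "level W v = {}"
proof -
  have False if u: "u \<in> level W v" for u
  proof -
    have n: "(u - W) \<bullet> (u - W) = 4 + W \<bullet> W - 2 * of_int v"
      using u by (simp add: level_def S_iff inner_diff_left inner_diff_right inner_commute)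
    have "u - W \<in> \<Lambda>" using u assms(1) by (intro diff) (simp_all add: level_def S_iff)
    then show False using rootless[of "u - W"] n assms(2,3) by (cases "u - W = 0") auto
  qed
  then show ?thesis by blast
qed

lemma sum_pm3: "(\<Sum>v\<in>{-3..3::int}. g v) = g 0 + (g 1 + g (-1)) + (g 2 + g (-2)) + (g 3 + g (-3 :: int) :: real)"
proof -
  have "{-3..3::int} = {-3, -2, -1, 0, 1, 2, 3}" by auto
  then show ?thesis by simp
qed

lemma sum_pm4: "(\<Sum>v\<in>{-4..4::int}. g v) = g 0 + (g 1 + g (-1)) + (g 2 + g (-2)) + (g 3 + g (-3)) + (g 4 + g (-4 :: int) :: real)"
proof -
  have "{-4..4::int} = {-4, -3, -2, -1, 0, 1, 2, 3, 4}" by auto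
  then show ?thesis by simp
qed

text \<open>Relative to a minimal vector w, the levels 3 and -3 are empty while 4 and -4 contain
  only w and - w. The moments of degrees 0, 2, 4, 6 are then four linear equations for
  \<open>card S\<close> and the sizes of levels 0, 1, 2.\<close>

lemma card_S:
  assumes "S \<noteq> {}"
  shows "card S = 196560"
proof -
  obtain w where w: "w \<in> S" using assms by blast
  have wL: "w \<in> \<Lambda>" "w \<bullet> w = 4" using w by (simp_all add: S_iff)
  define n where "n v = real (card (level w v))" for v
  have vals: "\<exists>v\<in>{-4..4}. u \<bullet> w = of_int v" if "u \<in> S" for u
    by (rule level_values[OF wL _ _ that]) simp_all
  have n3: "n 3 = 0" using level_empty[OF wL(1), of 3] wL(2) by (simp add: n_def)
  have n4: "n 4 = 1"
  proof -
    have "level w 4 = {w}"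
    proof
      show "{w} \<subseteq> level w 4" using w wL by (simp add: level_def)
      show "level w 4 \<subseteq> {w}"
      proof
        fix u assume "u \<in> level w 4"
        then have "(u - w) \<bullet> (u - w) = 0"
          using wL by (simp add: level_def S_iff inner_diff_left inner_diff_right inner_commute)
        then show "u \<in> {w}" by simp
      qed
    qed
    then show ?thesis by (simp add: n_def)
  qed
  have nm: "n (-1) = n 1" "n (-2) = n 2" "n (-3) = n 3" "n (-4) = n 4"
    unfolding n_def by (simp_all only: level_card_minus)
  have eq: "shell_moment 2 d * 2 ^ d = 0 ^ d * n 0 + (n 1 + (-1) ^ d * n (-1)) + (2 ^ d * n 2 + (-2) ^ d * n (-2)) + (3 ^ d * n 3 + (-3) ^ d * n (-3)) + (4 ^ d * n 4 + (-4) ^ d * n (-4))"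
    if "d \<le> 8" for d
  proof -
    have "norm w = 2" using wL(2) by (simp add: norm_eq_sqrt_inner)
    then have "shell_moment 2 d * 2 ^ d = (\<Sum>u\<in>S. (u \<bullet> w) ^ d * 1)"
      using shell_moment[OF that, where m = 2 and x = w] by simp
    also have "\<dots> = (\<Sum>v\<in>{-4..4}. of_int v ^ d * (\<Sum>u\<in>level w v. 1))"
      by (rule level_sum) (use vals in auto)
    finally show ?thesis unfolding sum_pm4 by (simp add: n_def)
  qed
  have "real (card S) = 196560"
    using eq[of 0] eq[of 2] eq[of 4] eq[of 6] unfolding nm n3 n4 S_moments by simp
  then show ?thesis by simp
qed

context
  fixes W :: "real ^ 24"
  assumes W: "W \<in> \<Lambda>" "W \<bullet> W = 6" and S_ne: "S \<noteq> {}"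
begin

text \<open>Cauchy-Schwarz alone would permit 4, but then u - W would have norm 2; the value -4 is
  excluded by passing to - u.\<close>

lemma W_values: "u \<in> S \<Longrightarrow> \<exists>v\<in>{-3..3}. u \<bullet> W = of_int v"
proof -
  assume u: "u \<in> S"
  obtain v where v: "v \<in> {-4..4}" "u \<bullet> W = of_int v"
    using level_values[OF W _ _ u, of 4] by auto
  have "level W 4 = {}" by (rule level_empty[OF W(1)]) (simp_all add: W(2))
  then have "v \<noteq> 4" using u v by (auto simp: level_def)
  moreover have "v \<noteq> -4"
  proof
    assume "v = -4"
    then have "- u \<in> level W 4" using u v S_minus by (simp add: level_def)
    then show False using \<open>level W 4 = {}\<close> by simp
  qed
  ultimately have "v \<in> {-3..3}" using v(1) by auto
  then show ?thesis using v(2) by blast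
qed

lemma W_level_sum: "(\<Sum>u\<in>S. (u \<bullet> W) ^ i * g u) = (\<Sum>v\<in>{-3..3}. of_int v ^ i * (\<Sum>u\<in>level W v. g u))"
  by (rule level_sum) (use W_values in auto)

abbreviation "D \<equiv> level W 2"

text \<open>The moments of degrees 0, 2, 4, 6 are four linear equations for the sizes of levels 0,
  1, 2, 3.\<close>

lemma card_D: "card D = 11178"
proof -
  define n where "n v = real (card (level W v))" for v
  have nm: "n (-1) = n 1" "n (-2) = n 2" "n (-3) = n 3"
    unfolding n_def by (simp_all only: level_card_minus)
  have eq: "shell_moment 2 (2 * d) * 6 ^ d = 0 ^ (2 * d) * n 0 + (n 1 + (-1) ^ (2 * d) * n (-1)) + (2 ^ (2 * d) * n 2 + (-2) ^ (2 * d) * n (-2)) + (3 ^ (2 * d) * n 3 + (-3) ^ (2 * d) * n (-3))"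
    if "d \<le> 4" for d
  proof -
    have "norm W ^ (2 * d) = 6 ^ d" unfolding power_mult power2_norm_eq_inner W(2) ..
    then have "shell_moment 2 (2 * d) * 6 ^ d = (\<Sum>u\<in>S. (u \<bullet> W) ^ (2 * d) * 1)"
      using shell_moment[of "2 * d", where m = 2 and x = W] that by simp
    also have "\<dots> = (\<Sum>v\<in>{-3..3}. of_int v ^ (2 * d) * (\<Sum>u\<in>level W v. 1))"
      by (rule W_level_sum)
    finally show ?thesis unfolding sum_pm3 by (simp add: n_def)
  qed
  have "n 2 = 11178"
    using eq[of 0] eq[of 1] eq[of 2] eq[of 3] unfolding nm by (simp add: S_moments card_S[OF S_ne])
  then show ?thesis by (simp add: n_def)
qed

text \<open>The sums \<open>B v\<close> are odd in v. The involution u -> W - u preserves level 3,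
  not level 2, and negates u.b, so \<open>B 3\<close> is 0. The mixed moments with the first and
  third powers of u.W, of total degree at most 8, then read B 1 + 2 B 2 = 0 and B 1 + 8 B 2 =
  0.\<close>

lemma D_odd_moment:
  assumes b: "b \<bullet> W = 0" and j: "j \<in> {1, 3, 5}"
  shows "(\<Sum>u\<in>D. (u \<bullet> b) ^ j) = 0"
proof -
  define B where "B v = (\<Sum>u\<in>level W v. (u \<bullet> b) ^ j)" for v
  have odd: "odd j" using j by auto
  have Bm: "B (- v) = - B v" for v
    unfolding B_def level_minus_sum using odd by (simp add: sum_negf)
  have B3: "B 3 = 0"
  proof -
    have "B 3 = (\<Sum>u\<in>level W 3. ((W - u) \<bullet> b) ^ j)"
      unfolding B_def
    proof (rule sum.reindex_bij_witness[of _ "\<lambda>u. W - u" "\<lambda>u. W - u"])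
      show "W - u \<in> level W 3" if "u \<in> level W 3" for u
        using that W diff[OF W(1), of u]
        by (simp add: level_def S_iff inner_diff_left inner_diff_right inner_commute)
      then show "W - u \<in> level W 3" if "u \<in> level W 3" for u using that .
    qed simp_all
    also have "\<dots> = - B 3"
      using odd b by (simp add: B_def inner_diff_left inner_commute[of W b] sum_negf)
    finally show ?thesis by simp
  qed
  \<comment> \<open>Since b is orthogonal to W, the squared length of W + s b is even in s, and
    coefficients of odd order vanish.\<close>
  have z: "(\<Sum>u\<in>S. (u \<bullet> W) ^ i * (u \<bullet> b) ^ j) = 0" if i: "i \<in> {1, 3}" for i
  proof -
    define m where "m = (i + j) div 2"
    have m: "i = 2 * m - j" "j \<le> 2 * m" "2 * m \<le> 8" using i j by (auto simp: m_def)
    have p: "(\<Sum>u\<in>S. (u \<bullet> x) ^ (2 * m)) = shell_moment 2 (2 * m) * norm x ^ (2 * m)" for x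
      using shell_moment[OF m(3)] .
    have "real (2 * m choose j) * (\<Sum>u\<in>S. (u \<bullet> b) ^ j * (u \<bullet> W) ^ (2 * m - j)) = 0"
      using radial_functional.mixed_moment[OF radial_functional_shell p m(2), of b W] coeff_even_power_odd[OF odd] b
      by (simp add: inner_commute)
    moreover have "(2 * m choose j) \<noteq> 0" using m(2) by simp
    ultimately show ?thesis unfolding m(1)[symmetric] by (simp add: mult.commute)
  qed
  have e: "0 = (B 1 + (-1) ^ i * B (-1)) + (2 ^ i * B 2 + (-2) ^ i * B (-2)) + (3 ^ i * B 3 + (-3) ^ i * B (-3))"
    if "i \<in> {1, 3}" for i
    using z[OF that] that unfolding W_level_sum sum_pm3 B_def[symmetric] by auto
  have "B 2 = 0" using e[of 1] e[of 3] Bm[of 1] Bm[of 2] B3 Bm[of 3] by simp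
  then show ?thesis by (simp add: B_def)
qed

text \<open>Weighting by the powers 0, 2, 4, 6 of u.W gives four equations for \<open>B 0\<close>,
  \<open>B 1\<close>, \<open>B 2\<close>, \<open>B 3\<close>; the last has total degree 8, the
  largest at hand.\<close>

lemma D_second_moment:
  assumes b: "b \<bullet> W = 0"
  shows "(\<Sum>u\<in>D. (u \<bullet> b)\<^sup>2) = 1620 * (b \<bullet> b)"
proof -
  define B where "B v = (\<Sum>u\<in>level W v. (u \<bullet> b)\<^sup>2)" for v
  have Bm: "B (- v) = B v" for v unfolding B_def level_minus_sum by simp
  have e: "real (2 * Suc d choose 2) * (0 ^ (2 * d) * B 0 + (B 1 + B 1) + (2 ^ (2 * d) * B 2 + 2 ^ (2 * d) * B 2) + (3 ^ (2 * d) * B 3 + 3 ^ (2 * d) * B 3))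
      = shell_moment 2 (2 * Suc d) * (real (Suc d) * 6 ^ d * (b \<bullet> b))" if d: "d \<le> 3" for d
  proof -
    have p: "(\<Sum>u\<in>S. (u \<bullet> x) ^ (2 * Suc d)) = shell_moment 2 (2 * Suc d) * norm x ^ (2 * Suc d)" for x
      by (rule shell_moment) (use d in simp)
    have "real (2 * Suc d choose 2) * (\<Sum>u\<in>S. (u \<bullet> b) ^ 2 * (u \<bullet> W) ^ (2 * Suc d - 2)) = shell_moment 2 (2 * Suc d) * coeff ([:6, 0, b \<bullet> b:] ^ Suc d) 2"
      using radial_functional.mixed_moment[OF radial_functional_shell p, of 2 b W] b W(2) by (simp add: inner_commute)
    also have "(\<Sum>u\<in>S. (u \<bullet> b) ^ 2 * (u \<bullet> W) ^ (2 * Suc d - 2)) = (\<Sum>u\<in>S. (u \<bullet> W) ^ (2 * d) * (u \<bullet> b)\<^sup>2)"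
      by (simp add: mult.commute)
    also have "\<dots> = 0 ^ (2 * d) * B 0 + (B 1 + B 1) + (2 ^ (2 * d) * B 2 + 2 ^ (2 * d) * B 2) + (3 ^ (2 * d) * B 3 + 3 ^ (2 * d) * B 3)"
      unfolding W_level_sum sum_pm3 B_def[symmetric] Bm by simp
    finally show ?thesis unfolding coeff_quadratic_power(4) .
  qed
  have ch: "2 * Suc 0 choose 2 = 1" "2 * Suc 1 choose 2 = 6" "2 * Suc 2 choose 2 = 15" "2 * Suc 3 choose 2 = 28"
    by (simp_all add: choose_two)
  have sm: "shell_moment 2 (2 * Suc 0) = 32760" "shell_moment 2 (2 * Suc 1) = 15120" "shell_moment 2 (2 * Suc 2) = 10800" "shell_moment 2 (2 * Suc 3) = 10080"
    using S_moments card_S[OF S_ne] by simp_all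
  have "B 2 = 1620 * (b \<bullet> b)"
    using e[of 0] e[of 1] e[of 2] e[of 3] unfolding ch sm by simp
  then show ?thesis by (simp add: B_def)
qed

text \<open>With k = u.u', the lattice vectors u - u' and u + u' - W have norms 8 - 2k and 6 + 2k.
  Nonzero norms are at least 4, so distinct u and u' have k between -1 and 2.\<close>

lemma D_inner:
  assumes u: "u \<in> D" "u' \<in> D"
  obtains k :: int where "u \<bullet> u' = of_int k" "u = u' \<or> k \<in> {-1, 0, 1, 2}"
proof -
  have uL: "u \<in> \<Lambda>" "u' \<in> \<Lambda>" "u \<bullet> u = 4" "u' \<bullet> u' = 4" "u \<bullet> W = 2" "u' \<bullet> W = 2"
    using u by (simp_all add: level_def S_iff)
  obtain k :: int where k: "u \<bullet> u' = of_int k" using integral[OF uL(1,2)] by (auto elim: Ints_cases)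
  have "k \<in> {-1, 0, 1, 2}" if ne: "u \<noteq> u'"
  proof -
    have "(u - u') \<bullet> (u - u') = 8 - 2 * of_int k"
      using uL k by (simp add: inner_diff_left inner_diff_right inner_commute)
    then have "8 - 2 * real_of_int k \<ge> 4" using rootless[OF diff[OF uL(1,2)]] ne by simp
    then have k2: "k \<le> 2" by linarith
    define y where "y = u + u' - W"
    have yL: "y \<in> \<Lambda>" unfolding y_def by (intro diff add uL W)
    have yy: "y \<bullet> y = 6 + 2 * of_int k"
      unfolding y_def using uL k W(2) by (simp add: inner_diff_left inner_diff_right inner_add_left inner_add_right inner_commute)
    have "y \<noteq> 0"
    proof
      assume y0: "y = 0"
      then have "W = u + u'" by (simp add: y_def)
      then have "u \<bullet> W = 4 + of_int k" using uL k by (simp add: inner_add_right)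
      then have "real_of_int k = - 2" using uL by simp
      then show False using yy y0 by simp
    qed
    then have "6 + 2 * real_of_int k \<ge> 4" using rootless[OF yL] yy by simp
    then have "k \<ge> - 1" by linarith
    with k2 show ?thesis by auto
  qed
  with k show ?thesis using that by blast
qed

end

end

section \<open>The linear programming bound\<close>

lemma sphere_moments_23:
  "sphere_moment TYPE(23) 0 = 1" "sphere_moment TYPE(23) (Suc 0) = 0" "sphere_moment TYPE(23) 1 = 0" "sphere_moment TYPE(23) 2 = 1 / 23"
  "sphere_moment TYPE(23) 3 = 0" "sphere_moment TYPE(23) 4 = 3 / 575" "sphere_moment TYPE(23) 5 = 0"
proof -
  show 0: "sphere_moment TYPE(23) 0 = 1" by (rule sphere_moment_0)
  show 2: "sphere_moment TYPE(23) 2 = 1 / 23"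
    using sphere_moment_Suc[of 0, where 'n = 23] 0 by (simp add: numeral_eq_Suc)
  show "sphere_moment TYPE(23) 4 = 3 / 575"
    using sphere_moment_Suc[of 1, where 'n = 23] 2 by (simp add: numeral_eq_Suc)
qed (rule sphere_moment_odd, simp)+

lemma annihilator_sum:
  fixes x :: "real ^ 23"
  shows "(\<Sum>y\<in>C. poly annihilator (y \<bullet> x)) = 1 / 250 * (\<Sum>y\<in>C. (y \<bullet> x) ^ 0) - 11 / 500 * (\<Sum>y\<in>C. (y \<bullet> x) ^ 1) - 21 / 100 * (\<Sum>y\<in>C. (y \<bullet> x) ^ 2) + 1 / 5 * (\<Sum>y\<in>C. (y \<bullet> x) ^ 3) + (\<Sum>y\<in>C. (y \<bullet> x) ^ 4)"
  unfolding sum_distrib_left sum.distrib[symmetric] sum_subtractf[symmetric]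
  by (intro sum.cong refl) (simp add: annihilator_def power_numeral_reduce algebra_simps)

text \<open>Up to degree 4 the points average like the sphere, over which the polynomial has the
  mean 1/11500 of \<open>annihilator_expansion\<close>.\<close>

lemma annihilator_average:
  fixes C :: "(real ^ 23) set"
  assumes m: "\<And>x j. x \<in> C \<Longrightarrow> j \<le> 4 \<Longrightarrow> (\<Sum>y\<in>C. (y \<bullet> x) ^ j) = real (card C) * sphere_moment TYPE(23) j" and x: "x \<in> C"
  shows "(\<Sum>y\<in>C. poly annihilator (y \<bullet> x)) = real (card C) / 11500"
proof -
  have "(\<Sum>y\<in>C. poly annihilator (y \<bullet> x)) = 1 / 250 * (\<Sum>y\<in>C. (y \<bullet> x) ^ 0) - 11 / 500 * (\<Sum>y\<in>C. (y \<bullet> x) ^ 1) - 21 / 100 * (\<Sum>y\<in>C. (y \<bullet> x) ^ 2) + 1 / 5 * (\<Sum>y\<in>C. (y \<bullet> x) ^ 3) + (\<Sum>y\<in>C. (y \<bullet> x) ^ 4)"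
    by (rule annihilator_sum)
  also have "\<dots> = real (card C) * (1 / 250 * sphere_moment TYPE(23) 0 - 11 / 500 * sphere_moment TYPE(23) 1 - 21 / 100 * sphere_moment TYPE(23) 2 + 1 / 5 * sphere_moment TYPE(23) 3 + sphere_moment TYPE(23) 4)"
    using m[OF x, of 0] m[OF x, of 1] m[OF x, of 2] m[OF x, of 3] m[OF x, of 4] by (simp add: algebra_simps)
  finally show ?thesis by (simp add: sphere_moments_23)
qed


text \<open>Each of the two quadratic factors is negative on exactly one of the two excluded
  intervals.\<close>

lemma annihilator_nonneg:
  assumes "t \<notin> {- 1 / 2 <..< - 1 / 5} \<union> {1 / 10 <..< 2 / 5}"
  shows "poly annihilator t \<ge> 0"
proof -
  have "(t + 1 / 2) * (t + 1 / 5) \<ge> 0 \<and> (t - 1 / 10) * (t - 2 / 5) \<ge> 0"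
    using assms by (auto simp: zero_le_mult_iff)
  then have "0 \<le> ((t + 1 / 2) * (t + 1 / 5)) * ((t - 1 / 10) * (t - 2 / 5))" by simp
  then show ?thesis by (simp only: annihilator_factored mult.assoc)
qed

lemma annihilator_1: "poly annihilator 1 = 243 / 250"
  by (simp add: annihilator_factored)

text \<open>The bound is read off at a single point x: its own summand is 243/250 and the others are
  nonnegative, so |C| / 11500 is at least 243/250.\<close>

lemma design_card_ge:
  fixes C :: "(real ^ 23) set"
  assumes d: "spherical_design \<tau> C" and \<tau>: "4 \<le> \<tau>" and a: "avoiding ({- 1 / 2 <..< - 1 / 5} \<union> {1 / 10 <..< 2 / 5}) C"
  shows "11178 \<le> card C"
proof -
  have ne: "C \<noteq> {}" using d by (rule design_card_pos)
  have C: "finite C" "\<And>x. x \<in> C \<Longrightarrow> norm x = 1"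
    using d by (auto simp: spherical_design_def spherical_code_def)
  obtain x where x: "x \<in> C" using ne by blast
  have "(\<Sum>y\<in>C. poly annihilator (y \<bullet> x)) = real (card C) / 11500"
  proof (rule annihilator_average[OF _ x])
    show "(\<Sum>y\<in>C. (y \<bullet> x) ^ j) = real (card C) * sphere_moment TYPE(23) j" if "x \<in> C" "j \<le> 4" for x j
      using design_inner_power[OF d _ ne, of j x] that \<tau> C(2) by simp
  qed
  moreover have "poly annihilator (x \<bullet> x) \<le> (\<Sum>y\<in>C. poly annihilator (y \<bullet> x))"
  proof (rule member_le_sum[OF x _ C(1)])
    fix y assume y: "y \<in> C - {x}"
    then have "y \<bullet> x \<in> inner_products C" using x by (auto simp: inner_products_def)
    then show "0 \<le> poly annihilator (y \<bullet> x)" using a by (intro annihilator_nonneg) (auto simp: avoiding_def)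
  qed
  moreover have "x \<bullet> x = 1" using C(2)[OF x] by (simp add: norm_eq_1)
  ultimately show ?thesis by (simp add: annihilator_1)
qed

section \<open>The derived code in dimension 23\<close>

locale derived_leech_code =
  fixes \<Lambda> :: "(real ^ 24) set" and W :: "real ^ 24" and \<phi> :: "real ^ 23 \<Rightarrow> real ^ 24"
  assumes L: "leech_lattice \<Lambda>" and WL: "W \<in> \<Lambda>" and nW: "norm W = sqrt 6"
    and iso: "isometry_onto_orthogonal \<phi> (W /\<^sub>R sqrt 6)"
begin

sublocale even_rootless_lattice \<Lambda> by (rule leech_even_rootless[OF L])

lemma S_nonempty: "S \<noteq> {}"
proof -
  obtain x where "x \<in> \<Lambda>" "x \<bullet> x = 4" using L unfolding leech_lattice_def by blast
  then have "x \<in> S" by (simp add: S_iff)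
  then show ?thesis by blast
qed

lemma WW: "W \<bullet> W = 6"
  using nW by (simp add: norm_eq_sqrt_inner)

text \<open>The point of the derived code belonging to the unit vector u / 2: the projection to W is
  W / 6, and the squared length left over is 1 - 1/6 = 5/6.\<close>

definition g :: "real ^ 24 \<Rightarrow> real ^ 24" where "g u = ((1 / 2) *\<^sub>R u - (1 / 6) *\<^sub>R W) /\<^sub>R sqrt (5 / 6)"

lemma inner_scaled:
  fixes X Y :: "real ^ 24"
  shows "(X /\<^sub>R c) \<bullet> Y = (X \<bullet> Y) / c" "(X /\<^sub>R c) \<bullet> (Y /\<^sub>R c) = (X \<bullet> Y) / (c * c)"
  by (simp_all add: divide_inverse mult_ac)

lemma code_eq: "code_sqrt6_6 \<Lambda> W = g ` level W 2"
proof -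
  have aw: "(sqrt 6 / 6) *\<^sub>R (W /\<^sub>R sqrt 6) = (1 / 6) *\<^sub>R W" by simp
  have s: "1 - (sqrt 6 / 6)\<^sup>2 = (5 / 6 :: real)" by (simp add: power_divide)
  have c: "(u /\<^sub>R 2) \<bullet> (W /\<^sub>R sqrt 6) = sqrt 6 / 6 \<longleftrightarrow> u \<bullet> W = 2" for u
  proof -
    have "(u /\<^sub>R 2) \<bullet> (W /\<^sub>R sqrt 6) = (u \<bullet> W) / (2 * sqrt 6)" by (simp add: field_simps)
    also have "\<dots> = sqrt 6 / 6 \<longleftrightarrow> u \<bullet> W = (sqrt 6 / 6) * (2 * sqrt 6)" by (simp add: divide_eq_eq)
    also have "(sqrt 6 / 6) * (2 * sqrt 6) = (2 :: real)" by simp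
    finally show ?thesis .
  qed
  have n: "norm u = 2 \<longleftrightarrow> u \<bullet> u = 4" for u :: "real ^ 24"
  proof -
    have "norm u = 2 \<longleftrightarrow> (norm u)\<^sup>2 = 2\<^sup>2" by (subst power2_eq_iff_nonneg) auto
    then show ?thesis by (simp add: power2_norm_eq_inner)
  qed
  have gu: "g u = (u /\<^sub>R 2 - (sqrt 6 / 6) *\<^sub>R (W /\<^sub>R sqrt 6)) /\<^sub>R sqrt (1 - (sqrt 6 / 6)\<^sup>2)" for u
    unfolding aw s g_def by (simp only: inverse_eq_divide)
  show ?thesis
  proof
    show "code_sqrt6_6 \<Lambda> W \<subseteq> g ` level W 2"
    proof
      fix x assume "x \<in> code_sqrt6_6 \<Lambda> W"
      then obtain u where u: "u \<in> \<Lambda>" "norm u = 2" "(u /\<^sub>R 2) \<bullet> (W /\<^sub>R sqrt 6) = sqrt 6 / 6"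
        "x = (u /\<^sub>R 2 - (sqrt 6 / 6) *\<^sub>R (W /\<^sub>R sqrt 6)) /\<^sub>R sqrt (1 - (sqrt 6 / 6)\<^sup>2)"
        unfolding code_sqrt6_6_def derived_code_def normalized_minimal_vectors_def by blast
      have "u \<in> level W 2" using u(1,2) u(3)[unfolded c] by (simp add: level_def S_iff n)
      moreover have "x = g u" unfolding u(4) gu ..
      ultimately show "x \<in> g ` level W 2" by blast
    qed
    show "g ` level W 2 \<subseteq> code_sqrt6_6 \<Lambda> W"
    proof (rule image_subsetI)
      fix u assume u: "u \<in> level W 2"
      then have "u \<in> \<Lambda>" "norm u = 2" "(u /\<^sub>R 2) \<bullet> (W /\<^sub>R sqrt 6) = sqrt 6 / 6"
        unfolding c n by (simp_all add: level_def S_iff)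
      then show "g u \<in> code_sqrt6_6 \<Lambda> W"
        unfolding code_sqrt6_6_def derived_code_def normalized_minimal_vectors_def gu by blast
    qed
  qed
qed

lemma phi: "linear \<phi>" "norm (\<phi> x) = norm x" "range \<phi> = {v. v \<bullet> (W /\<^sub>R sqrt 6) = 0}"
  using iso by (auto simp: isometry_onto_orthogonal_def)

lemma phi_inner: "\<phi> x \<bullet> \<phi> y = x \<bullet> y"
  unfolding dot_norm linear_add[OF phi(1), symmetric] phi(2) ..

lemma phi_inj: "inj \<phi>"
proof (rule injI)
  fix x y assume "\<phi> x = \<phi> y"
  then have "\<phi> (x - y) = 0" by (simp add: linear_diff[OF phi(1)])
  then have "norm (x - y) = 0" by (simp only: phi(2)[symmetric] norm_zero)
  then show "x = y" by simp
qed

lemma phi_W: "\<phi> x \<bullet> W = 0"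
proof -
  have "\<phi> x \<in> {v. v \<bullet> (W /\<^sub>R sqrt 6) = 0}" unfolding phi(3)[symmetric] by (rule rangeI)
  then show ?thesis by simp
qed

definition h :: "real ^ 24 \<Rightarrow> real ^ 23" where "h u = inv \<phi> (g u)"

abbreviation "code \<equiv> \<phi> -` code_sqrt6_6 \<Lambda> W"

lemma phi_h: "u \<in> level W 2 \<Longrightarrow> \<phi> (h u) = g u"
proof -
  assume u: "u \<in> level W 2"
  have "g u \<bullet> (W /\<^sub>R sqrt 6) = 0"
    using u WW by (simp add: g_def level_def inner_diff_left)
  then have "g u \<in> range \<phi>" unfolding phi(3) by blast
  then show ?thesis unfolding h_def by (rule f_inv_into_f)
qed

lemma h_bij: "bij_betw h (level W 2) code"
proof (rule bij_betw_imageI)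
  show "inj_on h (level W 2)"
  proof (rule inj_onI)
    fix u u' assume u: "u \<in> level W 2" "u' \<in> level W 2" "h u = h u'"
    then have "g u = g u'" using phi_h[of u] phi_h[of u'] by simp
    then show "u = u'" by (simp add: g_def)
  qed
  show "h ` level W 2 = code"
  proof
    show "h ` level W 2 \<subseteq> code" using phi_h by (auto simp: code_eq)
    show "code \<subseteq> h ` level W 2"
    proof
      fix x assume "x \<in> code"
      then obtain u where u: "u \<in> level W 2" "\<phi> x = g u" by (auto simp: code_eq)
      then have "\<phi> x = \<phi> (h u)" using phi_h[OF u(1)] by simp
      then have "x = h u" by (rule injD[OF phi_inj])
      then show "x \<in> h ` level W 2" using u(1) by blast
    qed
  qed
qed

lemma card_code: "card code = 11178"
  using bij_betw_same_card[OF h_bij] card_D[OF WL WW S_nonempty] by simp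

text \<open>The values 4, 2, 1, 0, -1 of u.u' turn into 1, 2/5, 1/10, -1/5, -1/2.\<close>

lemma h_inner:
  assumes "u \<in> level W 2" "u' \<in> level W 2"
  shows "h u \<bullet> h u' = (3 * (u \<bullet> u') - 2) / 10"
proof -
  have uW: "u \<bullet> W = 2" "W \<bullet> u = 2" "u' \<bullet> W = 2" "W \<bullet> u' = 2" using assms by (simp_all add: level_def inner_commute)
  have "h u \<bullet> h u' = g u \<bullet> g u'" using phi_inner[of "h u" "h u'"] assms by (simp add: phi_h)
  also have "\<dots> = ((1 / 2) *\<^sub>R u - (1 / 6) *\<^sub>R W) \<bullet> ((1 / 2) *\<^sub>R u' - (1 / 6) *\<^sub>R W) / (sqrt (5 / 6) * sqrt (5 / 6))"
    unfolding g_def by (rule inner_scaled(2))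
  also have "sqrt (5 / 6) * sqrt (5 / 6) = (5 / 6 :: real)" unfolding real_sqrt_mult_self by simp
  also have "((1 / 2) *\<^sub>R u - (1 / 6) *\<^sub>R W) \<bullet> ((1 / 2) *\<^sub>R u' - (1 / 6) *\<^sub>R W) = (u \<bullet> u') / 4 - 1 / 6"
    unfolding inner_diff_left inner_diff_right inner_scaleR_left inner_scaleR_right uW WW by simp
  finally show ?thesis by simp
qed

lemma h_phi_inner: "u \<in> level W 2 \<Longrightarrow> h u \<bullet> x = (u \<bullet> \<phi> x) / (2 * sqrt (5 / 6))"
proof -
  assume u: "u \<in> level W 2"
  have "h u \<bullet> x = g u \<bullet> \<phi> x" using phi_inner[of "h u" x] u by (simp add: phi_h)
  also have "\<dots> = ((1 / 2) * (u \<bullet> \<phi> x) - (1 / 6) * (W \<bullet> \<phi> x)) / sqrt (5 / 6)"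
    unfolding g_def inner_scaled(1) inner_diff_left inner_scaleR_left divide_inverse by (rule refl mult.commute)
  also have "W \<bullet> \<phi> x = 0" using phi_W[of x] unfolding inner_commute[of W] .
  finally show ?thesis by simp
qed

lemma sum_code: "(\<Sum>y\<in>code. f y) = (\<Sum>u\<in>level W 2. f (h u))"
  by (rule sum.reindex_bij_betw[OF h_bij, symmetric])

lemma norm_code: "x \<in> code \<Longrightarrow> x \<bullet> x = 1"
proof -
  assume "x \<in> code"
  then obtain u where u: "u \<in> level W 2" "x = h u" using h_bij by (auto simp: bij_betw_def)
  have "u \<bullet> u = 4" using u(1) by (simp add: level_def S_iff)
  then show ?thesis using h_inner[OF u(1) u(1)] u(2) by simp
qed

lemma inner_code:
  assumes "x \<in> code" "y \<in> code" "x \<noteq> y"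
  shows "x \<bullet> y \<in> {- 1 / 2, - 1 / 5, 1 / 10, 2 / 5}"
proof -
  have im: "code = h ` level W 2" using bij_betw_imp_surj_on[OF h_bij] by (rule sym)
  obtain u where u1: "x = h u" "u \<in> level W 2" using assms(1) unfolding im by (rule imageE)
  obtain u' where u2: "y = h u'" "u' \<in> level W 2" using assms(2) unfolding im by (rule imageE)
  note u = u1(2,1) u2(2,1)
  have "u \<noteq> u'" using u assms(3) by blast
  then obtain k :: int where "u \<bullet> u' = of_int k" "k \<in> {-1, 0, 1, 2}"
    using D_inner[OF WL WW S_nonempty u(1) u(3)] by blast
  then show ?thesis using h_inner[OF u(1) u(3)] u(2,4) by auto
qed

lemma code_moment:
  assumes x: "x \<in> code" and j: "j \<le> 5"
  shows "(\<Sum>y\<in>code. (y \<bullet> x) ^ j) = 11178 * sphere_moment TYPE(23) j"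
proof -
  have s: "(\<Sum>y\<in>code. (y \<bullet> x) ^ j) = (\<Sum>u\<in>level W 2. (u \<bullet> \<phi> x) ^ j) / (2 * sqrt (5 / 6)) ^ j" for j
    unfolding sum_code sum_divide_distrib by (intro sum.cong refl) (simp add: h_phi_inner power_divide)
  have odd: "(\<Sum>y\<in>code. (y \<bullet> x) ^ j) = 0" if "j \<in> {1, 3, 5}" for j
    unfolding s D_odd_moment[OF WL WW S_nonempty phi_W that] by simp
  \<comment> \<open>The factor 1620 divided by 4 (5/6) is 486, which equals 11178 / 23 as on the
    sphere.\<close>
  have two: "(\<Sum>y\<in>code. (y \<bullet> x)\<^sup>2) = 486"
    unfolding s D_second_moment[OF WL WW S_nonempty phi_W] phi_inner norm_code[OF x]
    by (simp add: power_mult_distrib)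
  have zero: "(\<Sum>y\<in>code. (y \<bullet> x) ^ 0) = 11178" using card_code by simp
  \<comment> \<open>Every inner product with another code point is a zero of the polynomial, so its
    sum is the value 243/250 at 1. As 243/250 = 11178/11500, solving for the fourth moment yields
    the spherical one.\<close>
  have four: "(\<Sum>y\<in>code. (y \<bullet> x) ^ 4) = 11178 * (3 / 575)"
  proof -
    have fin: "finite code" using card_code by (intro card_ge_0_finite) simp
    have "(\<Sum>y\<in>code. poly annihilator (y \<bullet> x)) = (\<Sum>y\<in>code. if y = x then 243 / 250 else 0)"
    proof (rule sum.cong[OF refl])
      fix y assume y: "y \<in> code"
      show "poly annihilator (y \<bullet> x) = (if y = x then 243 / 250 else 0)"
        using inner_code[OF y x] norm_code[OF x] by (auto simp: annihilator_1) (auto simp: annihilator_factored)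
    qed
    also have "\<dots> = 243 / 250" using x fin by simp
    also have "(\<Sum>y\<in>code. poly annihilator (y \<bullet> x)) = 1 / 250 * (\<Sum>y\<in>code. (y \<bullet> x) ^ 0) - 11 / 500 * (\<Sum>y\<in>code. (y \<bullet> x) ^ 1) - 21 / 100 * (\<Sum>y\<in>code. (y \<bullet> x) ^ 2) + 1 / 5 * (\<Sum>y\<in>code. (y \<bullet> x) ^ 3) + (\<Sum>y\<in>code. (y \<bullet> x) ^ 4)"
      by (rule annihilator_sum)
    finally show ?thesis using odd[of 1] odd[of 3] two zero by simp
  qed
  have "j = 0 \<or> j = 1 \<or> j = 2 \<or> j = 3 \<or> j = 4 \<or> j = 5" using j by linarith
  then show ?thesis
  proof (elim disjE)
    show ?thesis if "j = 0" unfolding that zero sphere_moments_23 by simp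
    show ?thesis if j: "j = 1" unfolding j sphere_moments_23 using odd[of 1] by simp
    show ?thesis if "j = 2" unfolding that two sphere_moments_23 by simp
    show ?thesis if j: "j = 3" unfolding j sphere_moments_23 using odd[of 3] by simp
    show ?thesis if "j = 4" unfolding that four sphere_moments_23 by simp
    show ?thesis if j: "j = 5" unfolding j sphere_moments_23 using odd[of 5] by simp
  qed
qed

lemma design_code: "\<tau> \<le> 5 \<Longrightarrow> spherical_design \<tau> code"
proof (rule designI)
  have fin: "finite code" by (rule card_ge_0_finite) (unfold card_code, simp)
  show "spherical_code code"
    unfolding spherical_code_def
  proof (intro conjI subsetI)
    fix x assume "x \<in> code"
    then show "x \<in> sphere 0 1" using norm_code[of x] by (simp add: norm_eq_1)
  qed (rule fin)
  show "code \<noteq> {}"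
  proof
    assume "code = {}"
    then have "card code = card ({} :: (real ^ 23) set)" by (rule arg_cong)
    then show False unfolding card_code by simp
  qed
  assume \<tau>: "\<tau> \<le> 5"
  fix j assume "j \<le> \<tau>"
  then have j: "j \<le> 5" using \<tau> by simp
  have "(\<Sum>x\<in>code. \<Sum>y\<in>code. (x \<bullet> y) ^ j) = (\<Sum>x\<in>code. 11178 * sphere_moment TYPE(23) j)"
  proof (rule sum.cong[OF refl])
    fix x assume x: "x \<in> code"
    show "(\<Sum>y\<in>code. (x \<bullet> y) ^ j) = 11178 * sphere_moment TYPE(23) j"
      unfolding code_moment[OF x j, symmetric] by (rule sum.cong[OF refl]) (subst inner_commute, rule refl)
  qed
  also have "\<dots> = (real (card code))\<^sup>2 * sphere_moment TYPE(23) j"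
    unfolding sum_constant card_code by simp
  finally show "(\<Sum>x\<in>code. \<Sum>y\<in>code. (x \<bullet> y) ^ j) = (real (card code))\<^sup>2 * sphere_moment TYPE(23) j" .
qed

lemma avoiding_code: "avoiding ({- 1 / 2 <..< - 1 / 5} \<union> {1 / 10 <..< 2 / 5}) code"
proof -
  have "t \<notin> {- 1 / 2 <..< - 1 / 5} \<union> {1 / 10 <..< 2 / 5}" if t: "t \<in> inner_products code" for t
  proof -
    obtain x y where "x \<in> code" "y \<in> code" "x \<noteq> y" "t = x \<bullet> y" using t unfolding inner_products_def by blast
    then show ?thesis using inner_code[of x y] by auto
  qed
  then show ?thesis unfolding avoiding_def by blast
qed

lemma tight_code: "tight_avoiding_design ({- 1 / 2 <..< - 1 / 5} \<union> {1 / 10 <..< 2 / 5}) 5 code"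
proof -
  obtain c where c: "annihilator = (\<Sum>i\<le>degree annihilator. smult (c i) (gegenbauer 23 i))" "c 0 = 1 / 11500"
    using annihilator_expansion by blast
  have d: "degree annihilator = 4" by (simp add: annihilator_def)
  show ?thesis
    unfolding tight_avoiding_design_def
  proof (intro conjI exI[of _ annihilator] exI[of _ c])
    show "annihilator = (\<Sum>i\<le>degree annihilator. smult (c i) (gegenbauer CARD(23) i))" using c(1) by simp
    show "\<forall>t\<in>{-1..1} - ({- 1 / 2 <..< - 1 / 5} \<union> {1 / 10 <..< 2 / 5}). 0 \<le> poly annihilator t"
      using annihilator_nonneg by blast
    show "\<forall>i\<in>{5 + 1..degree annihilator}. c i \<le> 0" by (simp add: d)
    show "real (card code) = poly annihilator 1 / c 0" unfolding card_code annihilator_1 c(2) by simp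
    show "spherical_design 5 code" by (rule design_code) simp
    show "avoiding ({- 1 / 2 <..< - 1 / 5} \<union> {1 / 10 <..< 2 / 5}) code" by (rule avoiding_code)
    show "c 0 > 0" using c(2) by simp
  qed
qed

end

section \<open>The minimum and tightness\<close>

lemma isometry_exists:
  fixes w :: "real ^ 24"
  assumes "w \<noteq> 0"
  shows "\<exists>\<phi> :: real ^ 23 \<Rightarrow> real ^ 24. isometry_onto_orthogonal \<phi> w"
proof -
  let ?V = "{v. v \<bullet> w = 0}"
  have e: "?V = {v. w \<bullet> v = 0}" by (simp add: inner_commute)
  have "subspace ?V" unfolding e by (rule subspace_hyperplane)
  moreover have "dim (UNIV :: (real ^ 23) set) = dim ?V" unfolding e dim_hyperplane[OF assms] by simp
  ultimately show ?thesis
    unfolding isometry_onto_orthogonal_def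
    using isometries_subspaces[OF subspace_UNIV, of ?V] by (metis UNIV_I)
qed

text \<open>The upper bound requires an actual code: it is taken from the explicit lattice
  \<open>Leech\<close>, one of its vectors of length sqrt 6, and some isometry onto the orthogonal
  hyperplane.\<close>

lemma min_design_card_eq:
  assumes \<tau>: "\<tau> \<in> {4, 5}"
  shows "min_design_card TYPE(23) \<tau> ({- 1 / 2 <..< - 1 / 5} \<union> {1 / 10 <..< 2 / 5}) = 11178"
proof -
  let ?T = "{- 1 / 2 <..< - 1 / 5} \<union> {1 / 10 <..< 2 / 5 :: real}"
  obtain W where W: "W \<in> Leech" "norm W = sqrt 6" using Leech_norm_6 by blast
  then have "W \<noteq> 0" by auto
  then obtain \<phi> :: "real ^ 23 \<Rightarrow> real ^ 24" where \<phi>: "isometry_onto_orthogonal \<phi> (W /\<^sub>R sqrt 6)"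
    using isometry_exists[of "W /\<^sub>R sqrt 6"] by auto
  interpret derived_leech_code Leech W \<phi>
    by unfold_locales (fact Leech_lattice W \<phi>)+
  have "spherical_design \<tau> code" using \<tau> by (intro design_code) auto
  then have mem: "code \<in> {C. spherical_design \<tau> C \<and> avoiding ?T C}" using avoiding_code by blast
  have "min_design_card TYPE(23) \<tau> ?T \<le> enat (card code)"
    unfolding min_design_card_def by (rule INF_lower[OF mem])
  moreover have "enat 11178 \<le> min_design_card TYPE(23) \<tau> ?T"
    unfolding min_design_card_def
  proof (rule INF_greatest)
    fix C :: "(real ^ 23) set" assume "C \<in> {C. spherical_design \<tau> C \<and> avoiding ?T C}"
    then show "enat 11178 \<le> enat (card C)" using design_card_ge[of \<tau> C] \<tau> by auto
  qed
  ultimately have "min_design_card TYPE(23) \<tau> ?T = enat 11178" unfolding card_code by (rule antisym)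
  then show ?thesis by (simp add: numeral_eq_enat)
qed

theorem theorem6p4:
  fixes T :: "real set"
  assumes T: "T = {- 1 / 2 <..< - 1 / 5} \<union> {1 / 10 <..< 2 / 5}"
  shows "min_design_card TYPE(23) 4 T = 11178 \<and>
    min_design_card TYPE(23) 5 T = 11178 \<and>
    (\<forall>(\<Lambda> :: (real ^ 24) set) (W :: real ^ 24) (\<phi> :: real ^ 23 \<Rightarrow> real ^ 24).
       leech_lattice \<Lambda> \<longrightarrow> W \<in> \<Lambda> \<longrightarrow> norm W = sqrt 6 \<longrightarrow>
       isometry_onto_orthogonal \<phi> (W /\<^sub>R sqrt 6) \<longrightarrow>
       tight_avoiding_design T 5 (\<phi> -` code_sqrt6_6 \<Lambda> W))"
proof (intro conjI allI impI)
  show "min_design_card TYPE(23) 4 T = 11178" "min_design_card TYPE(23) 5 T = 11178"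
    unfolding T by (rule min_design_card_eq, simp)+
  fix \<Lambda> :: "(real ^ 24) set" and W :: "real ^ 24" and \<phi> :: "real ^ 23 \<Rightarrow> real ^ 24"
  assume "leech_lattice \<Lambda>" "W \<in> \<Lambda>" "norm W = sqrt 6" "isometry_onto_orthogonal \<phi> (W /\<^sub>R sqrt 6)"
  then have "derived_leech_code \<Lambda> W \<phi>" by unfold_locales
  then show "tight_avoiding_design T 5 (\<phi> -` code_sqrt6_6 \<Lambda> W)"
    unfolding T by (rule derived_leech_code.tight_code)
qed

end
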